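(* Let $G$ be a group acting topically-transitively on a quasi-median graph $X$. Suppose that every vertex of $X$ belongs to finitely many cliques and that vertex-stabilisers are finite. If, for every clique $C$ of $X$, the stabiliser $\mathrm{stab}(C)$ acts metrically properly on some CAT(0) cube complex, then $G$ acts metrically properly on some CAT(0) cube complex.
   Context: Quasi-median graphs. A graph is weakly modular if it satisfies: (triangle condition) for any vertex $u$ and any two adjacent vertices $v,w$ both at distance $k$ from $u$, there exists a common neighbour $x$ of $v,w$ at distance $k-1$ from $u$; (quadrangle condition) for any vertices $u,z$ at distance $k$ apart and any two distinct neighbours $v,w$ of $z$ at distance $k-1$ from $u$, there exists a common neighbour $x$ of $v,w$ at distance $k-2$ from $u$. A graph is quasi-median if it is connected, weakly modular, and contains neither $K_4^-$ (the complete graph $K_4$ with one edge removed) nor the complete bipartite graph $K_{3,2}$ as an induced subgraph. A clique is a maximal complete subgraph. Hyperplanes. A hyperplane of a quasi-median graph $X$ is an equivalence class of edges for the transitive closure of the relation identifying two edges whenever they are opposite sides of a square (induced 4-cycle) or two sides of a triangle. All edges of a clique are in the same hyperplane; a clique is dual to a hyperplane $J$ if its edges belong to $J$. The sectors delimited by $J$ are the connected components of the graph obtained from $X$ by removing the interiors of the edges of $J$. Actions. Groups act on graphs by graph automorphisms. $\mathrm{stab}(J)$ denotes the stabiliser of the hyperplane $J$; $\mathrm{stab}(C)$ denotes the setwise stabiliser of a clique $C$ and $\mathrm{fix}(C)$ its pointwise stabiliser. The action of $G$ on $X$ is topical if for every hyperplane $J$, every clique $C$ dual to $J$ and every $g\in\mathrm{stab}(J)$,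 there exists $\rho_C(g)\in\mathrm{stab}(C)$ such that $g$ and $\rho_C(g)$ induce the same permutation on the set of sectors delimited by $J$. It is topical-transitive if moreover the action of $\mathrm{stab}(C)$ on the vertices of $C$ is free and transitive for every clique $C$ which either is infinite or satisfies $\mathrm{stab}(C)\neq\mathrm{fix}(C)$. "$G$ acts topically-transitively" means that its action is topical-transitive. CAT(0) cube complexes are not assumed finite-dimensional or locally finite; groups act on them by cubical automorphisms, and distances are measured in the combinatorial metric on vertices (the graph metric of the one-skeleton). An action of a group $H$ on a CAT(0) cube complex $Z$ is metrically proper if for some (equivalently, any) vertex $z\in Z$ and every $R\geq0$ the set $\{h\in H\mid d(z,h\cdot z)\leq R\}$ is finite. *)

theory Defs
  imports "HOL-Algebra.Group_Action"
begin

section \<open>Graphs\<close>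

text \<open>
  A graph is given by a (possibly infinite) vertex set \<open>V\<close> and a set \<open>E\<close> of two-element
  subsets of \<open>V\<close>.
\<close>

definition simple_graph :: "'v set \<Rightarrow> 'v set set \<Rightarrow> bool" where
  "simple_graph V E \<longleftrightarrow> (\<forall>e\<in>E. e \<subseteq> V \<and> card e = 2)"

definition walk :: "'v set \<Rightarrow> 'v set set \<Rightarrow> 'v list \<Rightarrow> bool" where
  "walk V E p \<longleftrightarrow> p \<noteq> [] \<and> set p \<subseteq> V \<and> successively (\<lambda>u v. {u, v} \<in> E) p"

definition joined :: "'v set \<Rightarrow> 'v set set \<Rightarrow> 'v \<Rightarrow> 'v \<Rightarrow> bool" where
  "joined V E u v \<longleftrightarrow> (\<exists>p. walk V E p \<and> hd p = u \<and> last p = v)"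

definition connected_graph :: "'v set \<Rightarrow> 'v set set \<Rightarrow> bool" where
  "connected_graph V E \<longleftrightarrow> simple_graph V E \<and> V \<noteq> {} \<and> (\<forall>u\<in>V. \<forall>v\<in>V. joined V E u v)"

definition connected_components :: "'v set \<Rightarrow> 'v set set \<Rightarrow> 'v set set" where
  "connected_components V E = (\<lambda>u. {v. joined V E u v}) ` V"

text \<open>Only meaningful for vertices in the same connected component.\<close>

definition graph_dist :: "'v set \<Rightarrow> 'v set set \<Rightarrow> 'v \<Rightarrow> 'v \<Rightarrow> nat" where
  "graph_dist V E u v =
     (LEAST n. \<exists>p. walk V E p \<and> hd p = u \<and> last p = v \<and> length p = Suc n)"

definition complete_in :: "'v set set \<Rightarrow> 'v set \<Rightarrow> bool" where
  "complete_in E C \<longleftrightarrow> (\<forall>u\<in>C. \<forall>v\<in>C. u \<noteq> v \<longrightarrow> {u, v} \<in> E)"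

definition is_clique :: "'v set \<Rightarrow> 'v set set \<Rightarrow> 'v set \<Rightarrow> bool" where
  "is_clique V E C \<longleftrightarrow>
     C \<subseteq> V \<and> complete_in E C \<and> (\<forall>D. C \<subseteq> D \<and> D \<subseteq> V \<and> complete_in E D \<longrightarrow> D = C)"

definition has_induced :: "'v set \<Rightarrow> 'v set set \<Rightarrow> 'w set \<Rightarrow> 'w set set \<Rightarrow> bool" where
  "has_induced V E V' E' \<longleftrightarrow>
     (\<exists>f. inj_on f V' \<and> f ` V' \<subseteq> V \<and>
          (\<forall>a\<in>V'. \<forall>b\<in>V'. {f a, f b} \<in> E \<longleftrightarrow> {a, b} \<in> E'))"


section \<open>Quasi-median graphs\<close>

definition triangle_condition :: "'v set \<Rightarrow> 'v set set \<Rightarrow> bool" where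
  "triangle_condition V E \<longleftrightarrow>
     (\<forall>k. \<forall>u\<in>V. \<forall>v\<in>V. \<forall>w\<in>V.
        {v, w} \<in> E \<and> graph_dist V E u v = k \<and> graph_dist V E u w = k \<longrightarrow>
        (\<exists>x\<in>V. {x, v} \<in> E \<and> {x, w} \<in> E \<and> graph_dist V E u x + 1 = k))"

definition quadrangle_condition :: "'v set \<Rightarrow> 'v set set \<Rightarrow> bool" where
  "quadrangle_condition V E \<longleftrightarrow>
     (\<forall>k. \<forall>u\<in>V. \<forall>z\<in>V. \<forall>v\<in>V. \<forall>w\<in>V.
        graph_dist V E u z = k \<and> v \<noteq> w \<and> {v, z} \<in> E \<and> {w, z} \<in> E \<and>
        graph_dist V E u v + 1 = k \<and> graph_dist V E u w + 1 = k \<longrightarrow>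
        (\<exists>x\<in>V. {x, v} \<in> E \<and> {x, w} \<in> E \<and> graph_dist V E u x + 2 = k))"

definition K4_minus_edges :: "nat set set" where
  "K4_minus_edges = {{i, j} | i j. i < 4 \<and> j < 4 \<and> i \<noteq> j} - {{0, 1}}"

definition K32_edges :: "nat set set" where
  "K32_edges = {{i, j} | i j. i < 3 \<and> 3 \<le> j \<and> j < 5}"

definition quasi_median_graph :: "'v set \<Rightarrow> 'v set set \<Rightarrow> bool" where
  "quasi_median_graph V E \<longleftrightarrow>
     connected_graph V E \<and> triangle_condition V E \<and> quadrangle_condition V E \<and>
     \<not> has_induced V E {..<4} K4_minus_edges \<and>
     \<not> has_induced V E {..<5} K32_edges"

text \<open>Two sides of a triangle, respectively opposite sides of an induced 4-cycle.\<close>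

definition elementary_parallel :: "'v set set \<Rightarrow> ('v set \<times> 'v set) set" where
  "elementary_parallel E =
     {({a, b}, {a, c}) | a b c. {a, b} \<in> E \<and> {a, c} \<in> E \<and> {b, c} \<in> E} \<union>
     {({a, b}, {c, d}) | a b c d.
        distinct [a, b, c, d] \<and>
        {a, b} \<in> E \<and> {b, c} \<in> E \<and> {c, d} \<in> E \<and> {d, a} \<in> E \<and>
        {a, c} \<notin> E \<and> {b, d} \<notin> E}"

definition hyperplanes :: "'v set set \<Rightarrow> 'v set set set" where
  "hyperplanes E = E // (elementary_parallel E)\<^sup>*"

definition dual_to :: "'v set \<Rightarrow> 'v set set \<Rightarrow> bool" where
  "dual_to C J \<longleftrightarrow> (\<forall>u\<in>C. \<forall>v\<in>C. u \<noteq> v \<longrightarrow> {u, v} \<in> J)"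

text \<open>A sector is represented by its set of vertices.\<close>

definition sectors :: "'v set \<Rightarrow> 'v set set \<Rightarrow> 'v set set \<Rightarrow> 'v set set" where
  "sectors V E J = connected_components V (E - J)"


section \<open>Group actions on graphs\<close>

definition acts_on_graph ::
    "('g, 'm) monoid_scheme \<Rightarrow> 'v set \<Rightarrow> 'v set set \<Rightarrow> ('g \<Rightarrow> 'v \<Rightarrow> 'v) \<Rightarrow> bool" where
  "acts_on_graph G V E \<phi> \<longleftrightarrow>
     group_action G V \<phi> \<and> (\<forall>g\<in>carrier G. (\<lambda>e. \<phi> g ` e) ` E = E)"

definition set_stab :: "('g, 'm) monoid_scheme \<Rightarrow> ('g \<Rightarrow> 'v \<Rightarrow> 'v) \<Rightarrow> 'v set \<Rightarrow> 'g set" where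
  "set_stab G \<phi> C = {g \<in> carrier G. \<phi> g ` C = C}"

definition set_fix :: "('g, 'm) monoid_scheme \<Rightarrow> ('g \<Rightarrow> 'v \<Rightarrow> 'v) \<Rightarrow> 'v set \<Rightarrow> 'g set" where
  "set_fix G \<phi> C = {g \<in> carrier G. \<forall>x\<in>C. \<phi> g x = x}"

definition hyperplane_stab ::
    "('g, 'm) monoid_scheme \<Rightarrow> ('g \<Rightarrow> 'v \<Rightarrow> 'v) \<Rightarrow> 'v set set \<Rightarrow> 'g set" where
  "hyperplane_stab G \<phi> J = {g \<in> carrier G. (\<lambda>e. \<phi> g ` e) ` J = J}"

definition topical_action ::
    "('g, 'm) monoid_scheme \<Rightarrow> 'v set \<Rightarrow> 'v set set \<Rightarrow> ('g \<Rightarrow> 'v \<Rightarrow> 'v) \<Rightarrow> bool" where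
  "topical_action G V E \<phi> \<longleftrightarrow>
     (\<forall>J\<in>hyperplanes E. \<forall>C. is_clique V E C \<and> dual_to C J \<longrightarrow>
        (\<forall>g\<in>hyperplane_stab G \<phi> J. \<exists>h\<in>set_stab G \<phi> C.
           \<forall>S\<in>sectors V E J. \<phi> g ` S = \<phi> h ` S))"

definition topical_transitive_action ::
    "('g, 'm) monoid_scheme \<Rightarrow> 'v set \<Rightarrow> 'v set set \<Rightarrow> ('g \<Rightarrow> 'v \<Rightarrow> 'v) \<Rightarrow> bool" where
  "topical_transitive_action G V E \<phi> \<longleftrightarrow>
     topical_action G V E \<phi> \<and>
     (\<forall>C. is_clique V E C \<and> (infinite C \<or> set_stab G \<phi> C \<noteq> set_fix G \<phi> C) \<longrightarrow>
        (\<forall>g\<in>set_stab G \<phi> C. \<forall>x\<in>C. \<phi> g x = x \<longrightarrow> g = \<one>\<^bsub>G\<^esub>) \<and>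
        (\<forall>x\<in>C. \<forall>y\<in>C. \<exists>g\<in>set_stab G \<phi> C. \<phi> g x = y))"


section \<open>CAT(0) cube complexes\<close>

text \<open>
  A cube complex is encoded by the family \<open>K\<close> of the vertex sets of its cubes.  The vertices of
  the standard \<open>n\<close>-cube are the subsets of \<open>{..<n}\<close>, and its faces are the intervals
  \<open>{A..B}\<close> for inclusion.  Every member \<open>c\<close> of \<open>K\<close> is required to be, together with the
  members of \<open>K\<close> contained in it, a copy of a standard cube with its faces, and two cubes meet
  in the empty set or in a common face.  These are the cubical complexes of Bridson and Haefliger
  (cubes of arbitrary finite dimension glued by isometries of faces, every cube embedded, two
  cubes meeting in at most one face); every CAT(0) cube complex has these properties.  Neither
  finite dimension nor local finiteness is assumed.
\<close>

definition standard_faces :: "nat \<Rightarrow> nat set set set" where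
  "standard_faces n = {{A..B} | A B. A \<subseteq> B \<and> B \<subseteq> {..<n}}"

definition cube_chart :: "'z set set \<Rightarrow> 'z set \<Rightarrow> nat \<Rightarrow> (nat set \<Rightarrow> 'z) \<Rightarrow> bool" where
  "cube_chart K c n f \<longleftrightarrow>
     bij_betw f (Pow {..<n}) c \<and> {d \<in> K. d \<subseteq> c} = (\<lambda>F. f ` F) ` standard_faces n"

definition cube_complex :: "'z set set \<Rightarrow> bool" where
  "cube_complex K \<longleftrightarrow>
     (\<forall>c\<in>K. \<exists>n f. cube_chart K c n f) \<and>
     (\<forall>c\<in>K. \<forall>d\<in>K. c \<inter> d = {} \<or> c \<inter> d \<in> K)"

abbreviation cc_verts :: "'z set set \<Rightarrow> 'z set" where
  "cc_verts K \<equiv> \<Union>K"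

definition cc_edges :: "'z set set \<Rightarrow> 'z set set" where
  "cc_edges K = {e \<in> K. card e = 2}"

text \<open>
  The link of \<open>v\<close>: its vertices are identified with the neighbours of \<open>v\<close>, and a cube
  containing \<open>v\<close> contributes the simplex spanned by the neighbours of \<open>v\<close> in that cube.
\<close>

definition link :: "'z set set \<Rightarrow> 'z \<Rightarrow> 'z set set" where
  "link K v = {{w \<in> c. {v, w} \<in> cc_edges K} | c. c \<in> K \<and> v \<in> c}"

definition flag :: "'z set set \<Rightarrow> bool" where
  "flag L \<longleftrightarrow>
     (\<forall>A. finite A \<and> A \<noteq> {} \<and> (\<forall>a\<in>A. \<forall>b\<in>A. {a, b} \<in> L) \<longrightarrow> A \<in> L)"

text \<open>
  Simple connectivity is triviality of the edge-path group: every closed path in the one-skeleton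
  can be reduced to a constant path by inserting or deleting backtracks and by pushing a pair of
  consecutive edges across a square.  These moves fix the endpoints of a path.
\<close>

inductive elementary_homotopy :: "'z set set \<Rightarrow> 'z list \<Rightarrow> 'z list \<Rightarrow> bool" for K where
  backtrack: "{u, v} \<in> cc_edges K \<Longrightarrow>
    elementary_homotopy K (p @ [u, v, u] @ q) (p @ [u] @ q)"
| square: "distinct [a, b, c, d] \<Longrightarrow> {a, b, c, d} \<in> K \<Longrightarrow>
    {a, b} \<in> cc_edges K \<Longrightarrow> {b, c} \<in> cc_edges K \<Longrightarrow>
    {c, d} \<in> cc_edges K \<Longrightarrow> {d, a} \<in> cc_edges K \<Longrightarrow>
    elementary_homotopy K (p @ [a, b, c] @ q) (p @ [a, d, c] @ q)"

definition simply_connected_cc :: "'z set set \<Rightarrow> bool" where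
  "simply_connected_cc K \<longleftrightarrow>
     connected_graph (cc_verts K) (cc_edges K) \<and>
     (\<forall>p. walk (cc_verts K) (cc_edges K) p \<and> hd p = last p \<longrightarrow>
          equivclp (elementary_homotopy K) p [hd p])"

definition CAT0_cube_complex :: "'z set set \<Rightarrow> bool" where
  "CAT0_cube_complex K \<longleftrightarrow>
     cube_complex K \<and> simply_connected_cc K \<and> (\<forall>v\<in>cc_verts K. flag (link K v))"

definition acts_on_cube_complex ::
    "('g, 'm) monoid_scheme \<Rightarrow> 'z set set \<Rightarrow> ('g \<Rightarrow> 'z \<Rightarrow> 'z) \<Rightarrow> bool" where
  "acts_on_cube_complex H K \<psi> \<longleftrightarrow>
     group_action H (cc_verts K) \<psi> \<and> (\<forall>h\<in>carrier H. (\<lambda>c. \<psi> h ` c) ` K = K)"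

definition metrically_proper ::
    "('g, 'm) monoid_scheme \<Rightarrow> 'z set set \<Rightarrow> ('g \<Rightarrow> 'z \<Rightarrow> 'z) \<Rightarrow> bool" where
  "metrically_proper H K \<psi> \<longleftrightarrow>
     (\<exists>z\<in>cc_verts K. \<forall>R::nat.
        finite {h \<in> carrier H. graph_dist (cc_verts K) (cc_edges K) z (\<psi> h z) \<le> R})"

definition acts_properly_on_CAT0 ::
    "('g, 'm) monoid_scheme \<Rightarrow> 'z set set \<Rightarrow> ('g \<Rightarrow> 'z \<Rightarrow> 'z) \<Rightarrow> bool" where
  "acts_properly_on_CAT0 H K \<psi> \<longleftrightarrow>
     CAT0_cube_complex K \<and> acts_on_cube_complex H K \<psi> \<and> metrically_proper H K \<psi>"

text \<open>
  HOL cannot quantify existentially over the type of the vertices of a cube complex.  A statement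
  \<open>\<exists>(K :: nat set set) \<psi>. acts_properly_on_CAT0 H K \<psi>\<close> says that \<open>H\<close> acts metrically properly
  on some CAT(0) cube complex, of any cardinality: if it does, then \<open>H\<close> is countable, and
  the convex hull of an orbit of vertices is an invariant CAT(0) subcomplex which has countably
  many vertices, so that these can be taken to be natural numbers.
\<close>

end

theory Submission
  imports Defs "HOL-Library.Countable_Set"
begin

text \<open>
  A CAT(0) cube complex is used only through its halfspaces, and built only from a cocycle. If a
  group acts on a set of weighted cuts such that any two points are separated by finitely many of
  them, then it acts by affine isometries on the infinite cube whose vertices are the finite sets
  of cuts, and the displacement of a vertex is the number of cuts separating a point from its
  image. Conversely, in a CAT(0) cube complex any two vertices are separated by at least as many
  halfspaces as their distance; this rests on the word problem for edge paths: reduced paths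
  with the same endpoints differ by square moves.

  In a quasi-median graph the sectors of a hyperplane are the fibres of the gate map to any clique
  dual to it. Choose one clique in each orbit of hyperplanes, and cuts of it which separate its
  vertices properly. Their preimages under the gate map are cuts of the graph. Topicality makes
  the weights of the translated cuts well defined. Along a geodesic every edge crosses a new
  hyperplane, so that a bound on the weight between two vertices bounds their distance
  and leaves, by local finiteness, finitely many choices for every next vertex of the geodesic.
\<close>

section \<open>Graph distance\<close>

text \<open>Cliques may be infinite, so vertices may have infinite valency and a bound on the
  distance alone does not leave finitely many vertices. The weights must be proper inside each
  clique; on an infinite clique, simple transitivity turns properness of the clique stabiliser into
  properness on the vertices. The obstacle to equivariance is that an element preserving a
  hyperplane may move the chosen clique to another one dual to it. Topicality replaces it by an
  element of the clique stabiliser with the same effect on the sectors, and the weight on the clique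
  is invariant under such elements. The full cube of finite sets of cuts is used instead of a
  complex dual to a wall space because it is CAT(0) for simple reasons: any finite set of directions
  spans a cube, and a closed path toggles every cut an even number of times. With symmetric
  difference as addition, a cocycle is just the translation part of an affine action. Naming the
  vertices by natural numbers is possible because properness makes the group countable and only cuts
  between points of one orbit are kept.\<close>

lemma walk_single [simp]: "walk V E [x] \<longleftrightarrow> x \<in> V"
  by (auto simp: walk_def)

lemma walk_Cons_Cons [simp]:
  "walk V E (x # y # p) \<longleftrightarrow> x \<in> V \<and> {x, y} \<in> E \<and> walk V E (y # p)"
  by (auto simp: walk_def)

lemma not_walk_Nil [simp]: "\<not> walk V E []"
  by (simp add: walk_def)

lemma walk_append:
  assumes "p \<noteq> []" "q \<noteq> []"
  shows "walk V E (p @ q) \<longleftrightarrow> walk V E p \<and> {last p, hd q} \<in> E \<and> walk V E q"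
  using assms by (auto simp: walk_def successively_append_iff)

lemma walk_rev: "walk V E (rev p) \<longleftrightarrow> walk V E p"
  by (simp add: walk_def successively_rev insert_commute)

lemma walk_map:
  assumes "walk V E p" "f ` V \<subseteq> V'" "\<And>e. e \<in> E \<Longrightarrow> f ` e \<in> E'"
  shows "walk V' E' (map f p)"
  using assms(1)
proof (induction p rule: induct_list012)
  case (3 x y zs)
  then show ?case using assms(2) assms(3)[of "{x, y}"] by auto
qed (use assms in auto)

lemma walk_join:
  assumes "walk V E p" "walk V E q" "last p = hd q"
  shows "walk V E (p @ tl q)"
proof (cases "tl q = []")
  case False
  have q: "q = hd q # tl q" using assms(2) by (cases q) auto
  have "walk V E (hd q # tl q)" using q assms(2) by simp
  then have "{hd q, hd (tl q)} \<in> E" "walk V E (tl q)" using False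
    by (cases "tl q"; simp)+
  then show ?thesis using assms False walk_append[where p = p and q = "tl q"] by (auto simp: walk_def)
qed (use assms in auto)

lemma last_join:
  assumes "p \<noteq> []" "q \<noteq> []" "last p = hd q"
  shows "last (p @ tl q) = last q"
  using assms by (cases q) auto

lemma joined_refl: "v \<in> V \<Longrightarrow> joined V E v v"
  unfolding joined_def by (rule exI[of _ "[v]"]) simp

lemma joined_trans:
  assumes "joined V E u v" "joined V E v w"
  shows "joined V E u w"
proof -
  obtain p q where pq: "walk V E p" "hd p = u" "last p = v" "walk V E q" "hd q = v" "last q = w"
    using assms by (auto simp: joined_def)
  then have "p \<noteq> []" "q \<noteq> []" by auto
  then show ?thesis using pq walk_join[of V E p q] last_join[of p q]
    by (auto simp: joined_def intro!: exI[of _ "p @ tl q"])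
qed

lemma joined_edge: "{u, v} \<in> E \<Longrightarrow> u \<in> V \<Longrightarrow> v \<in> V \<Longrightarrow> joined V E u v"
  unfolding joined_def by (rule exI[of _ "[u, v]"]) simp

lemma joined_invariant:
  assumes "joined V E u v" "P u" "\<And>x y. {x, y} \<in> E \<Longrightarrow> x \<in> V \<Longrightarrow> y \<in> V \<Longrightarrow> P x \<Longrightarrow> P y"
  shows "P v"
proof -
  obtain p where "walk V E p" "hd p = u" "last p = v" using assms(1) by (auto simp: joined_def)
  then show ?thesis using assms(2)
  proof (induction p arbitrary: u rule: induct_list012)
    case (3 x y zs)
    have "y \<in> V" using 3 by (cases zs) auto
    then show ?case using 3 assms(3)[of x y] by auto
  qed auto
qed

locale conn_graph =
  fixes V :: "'v set" and E :: "'v set set"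
  assumes conn: "connected_graph V E"
begin

abbreviation dst where "dst \<equiv> graph_dist V E"

lemma edge_V: "{u, v} \<in> E \<Longrightarrow> u \<in> V \<and> v \<in> V"
  using conn by (auto simp: connected_graph_def simple_graph_def)

lemma edge_neq: "{u, v} \<in> E \<Longrightarrow> u \<noteq> v"
  using conn by (auto simp: connected_graph_def simple_graph_def)

lemma edge_ex: "e \<in> E \<Longrightarrow> \<exists>u v. e = {u, v} \<and> u \<noteq> v"
  using conn by (auto simp: connected_graph_def simple_graph_def card_2_iff)

lemma geodesic_ex:
  assumes "u \<in> V" "v \<in> V"
  shows "\<exists>p. walk V E p \<and> hd p = u \<and> last p = v \<and> length p = Suc (dst u v)"
proof -
  obtain p where p: "walk V E p" "hd p = u" "last p = v"
    using conn assms by (auto simp: connected_graph_def joined_def)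
  then have "length p = Suc (length p - 1)" by (cases p) auto
  with p have "\<exists>n. \<exists>p. walk V E p \<and> hd p = u \<and> last p = v \<and> length p = Suc n" by blast
  then show ?thesis unfolding graph_dist_def by (rule LeastI_ex)
qed

text \<open>A separating set between two points lies in the union of those between consecutive
  vertices of a path, so finiteness need only be checked on edges. This serves both the halfspaces
  of a cube complex and the weighted cuts of a graph.\<close>

lemma finite_by_edges:
  assumes "x \<in> V" "y \<in> V" and refl: "\<And>x. S x x = {}"
    and trans: "\<And>x y z. S x z \<subseteq> S x y \<union> S y z" and edge: "\<And>x y. {x, y} \<in> E \<Longrightarrow> finite (S x y)"
  shows "finite (S x y)"
proof -
  obtain p where "walk V E p" "hd p = x" "last p = y" using geodesic_ex[OF assms(1,2)] by blast
  then show ?thesis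
  proof (induction p arbitrary: x rule: induct_list012)
    case (2 a)
    then show ?case using refl by simp
  next
    case (3 a b p)
    then have "finite (S a b)" "finite (S b y)" using edge by auto
    then show ?case using finite_subset[OF trans[of x y b]] 3 by auto
  qed auto
qed

lemma dist_le_walk:
  assumes "walk V E p" "length p \<le> Suc n"
  shows "dst (hd p) (last p) \<le> n"
proof -
  have "length p = Suc (length p - 1)" using assms by (cases p) auto
  then have "dst (hd p) (last p) \<le> length p - 1"
    unfolding graph_dist_def using assms(1) by (intro Least_le) blast
  then show ?thesis using assms by linarith
qed

lemma dist_self [simp]: "u \<in> V \<Longrightarrow> dst u u = 0"
  using dist_le_walk[of "[u]" 0] by simp

lemma dist_eq_0: "u \<in> V \<Longrightarrow> v \<in> V \<Longrightarrow> dst u v = 0 \<longleftrightarrow> u = v"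
  using geodesic_ex[of u v] by (auto simp: length_Suc_conv)

lemma dist_triangle:
  assumes "u \<in> V" "v \<in> V" "w \<in> V"
  shows "dst u w \<le> dst u v + dst v w"
proof -
  obtain p q where pq: "walk V E p" "hd p = u" "last p = v" "length p = Suc (dst u v)"
    "walk V E q" "hd q = v" "last q = w" "length q = Suc (dst v w)"
    using geodesic_ex assms by meson
  then have ne: "p \<noteq> []" "q \<noteq> []" by auto
  have "dst (hd (p @ tl q)) (last (p @ tl q)) \<le> dst u v + dst v w"
    using pq by (intro dist_le_walk walk_join) auto
  then show ?thesis using pq ne last_join[OF ne] by simp
qed

lemma dist_sym:
  assumes "u \<in> V" "v \<in> V"
  shows "dst u v = dst v u"
proof -
  have "dst u v \<le> dst v u" if "u \<in> V" "v \<in> V" for u v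
  proof -
    obtain p where "walk V E p" "hd p = v" "last p = u" "length p = Suc (dst v u)"
      using geodesic_ex \<open>u \<in> V\<close> \<open>v \<in> V\<close> by meson
    then show ?thesis using dist_le_walk[of "rev p" "dst v u"]
      by (simp add: walk_rev hd_rev last_rev)
  qed
  then show ?thesis using assms by (simp add: antisym)
qed

lemma dist_edge: "{u, v} \<in> E \<Longrightarrow> dst u v = 1"
  using dist_le_walk[of "[u, v]" 1] edge_V[of u v] edge_neq[of u v] dist_eq_0[of u v]
  by (simp add: le_Suc_eq)

lemma dist_step: "{v, w} \<in> E \<Longrightarrow> u \<in> V \<Longrightarrow> dst u v \<le> dst u w + 1"
  using dist_triangle[of u w v] edge_V[of v w] dist_edge[of w v] by (simp add: insert_commute)

lemma dist_step': "{v, w} \<in> E \<Longrightarrow> u \<in> V \<Longrightarrow> dst v u \<le> dst w u + 1"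
  using dist_step[of v w u] edge_V[of v w] dist_sym by simp

lemma dist_first:
  assumes "u \<in> V" "v \<in> V" "dst u v = Suc k"
  shows "\<exists>w\<in>V. {u, w} \<in> E \<and> dst w v = k"
proof -
  obtain p where p: "walk V E p" "hd p = u" "last p = v" "length p = Suc (Suc k)"
    using geodesic_ex assms by metis
  then obtain w q where q: "p = u # w # q" by (cases p; cases "tl p") auto
  with p have e: "{u, w} \<in> E" "w \<in> V" using edge_V by auto
  moreover have "dst w v \<le> k" using p q dist_le_walk[of "w # q" k] by auto
  moreover have "dst u v \<le> dst w v + 1" using e assms by (intro dist_step') auto
  ultimately show ?thesis using assms by (intro bexI[of _ w]) auto
qed

lemma dist_map_le:
  assumes "f ` V \<subseteq> V" "\<And>e. e \<in> E \<Longrightarrow> f ` e \<in> E" "u \<in> V" "v \<in> V"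
  shows "dst (f u) (f v) \<le> dst u v"
proof -
  obtain p where p: "walk V E p" "hd p = u" "last p = v" "length p = Suc (dst u v)"
    using geodesic_ex assms by metis
  then have "p \<noteq> []" by auto
  then show ?thesis using dist_le_walk[OF walk_map[OF p(1) assms(1,2)], of "dst u v"] p
    by (simp add: hd_map last_map)
qed

end

section \<open>Group actions\<close>

context group_action
begin

lemma group: "group G"
  using group_hom group_hom.axioms(1) by blast

lemma act_closed: "g \<in> carrier G \<Longrightarrow> x \<in> E \<Longrightarrow> \<phi> g x \<in> E"
  using element_image by blast

lemma act_one: "x \<in> E \<Longrightarrow> \<phi> \<one> x = x"
  using id_eq_one by (metis restrict_apply')

lemma act_inv: "g \<in> carrier G \<Longrightarrow> x \<in> E \<Longrightarrow> \<phi> (inv g) (\<phi> g x) = x"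
  using orbit_sym_aux by blast

lemma act_inv': "g \<in> carrier G \<Longrightarrow> x \<in> E \<Longrightarrow> \<phi> g (\<phi> (inv g) x) = x"
  using act_inv[of "inv g" x] group by (simp add: group.inv_inv group.inv_closed)

lemma act_eq_iff: "g \<in> carrier G \<Longrightarrow> x \<in> E \<Longrightarrow> y \<in> E \<Longrightarrow> \<phi> g x = \<phi> g y \<longleftrightarrow> x = y"
  using inj_prop by (auto dest: inj_onD)

lemma act_image_one: "P \<subseteq> E \<Longrightarrow> \<phi> \<one> ` P = P"
  using act_one by force

lemma act_image_comp:
  "g \<in> carrier G \<Longrightarrow> h \<in> carrier G \<Longrightarrow> P \<subseteq> E \<Longrightarrow> \<phi> (g \<otimes> h) ` P = \<phi> g ` \<phi> h ` P"
  using composition_rule by (force simp: image_image)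

lemma act_image_subset: "g \<in> carrier G \<Longrightarrow> P \<subseteq> E \<Longrightarrow> \<phi> g ` P \<subseteq> E"
  using act_closed by blast

lemma act_image_inv: "g \<in> carrier G \<Longrightarrow> P \<subseteq> E \<Longrightarrow> \<phi> (inv g) ` \<phi> g ` P = P"
  using act_inv by (force simp: image_image)

lemma act_image_inv': "g \<in> carrier G \<Longrightarrow> P \<subseteq> E \<Longrightarrow> \<phi> g ` \<phi> (inv g) ` P = P"
  using act_inv' by (force simp: image_image)

lemma act_image_mem: "g \<in> carrier G \<Longrightarrow> P \<subseteq> E \<Longrightarrow> x \<in> E \<Longrightarrow> \<phi> g x \<in> \<phi> g ` P \<longleftrightarrow> x \<in> P"
  using inj_on_image_mem_iff[OF inj_prop] by blast

end

text \<open>\<open>BijGroup X\<close> consists of extensional permutations, so an action given by a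
  formula \<open>a g\<close> must be restricted to \<open>X\<close>. The map
  \<open>a (inv g)\<close> witnesses bijectivity.\<close>

lemma group_action_restrictI:
  fixes G (structure)
  assumes "group G"
    and cl: "\<And>g x. g \<in> carrier G \<Longrightarrow> x \<in> X \<Longrightarrow> a g x \<in> X"
    and one: "\<And>x. x \<in> X \<Longrightarrow> a \<one> x = x"
    and mult: "\<And>g h x. g \<in> carrier G \<Longrightarrow> h \<in> carrier G \<Longrightarrow> x \<in> X \<Longrightarrow> a (g \<otimes> h) x = a g (a h x)"
  shows "group_action G X (\<lambda>g. restrict (a g) X)"
proof -
  interpret group G by fact
  have inv: "a g (a (inv g) x) = x" "a (inv g) (a g x) = x"
    if "g \<in> carrier G" "x \<in> X" for g x
    using that mult[of g "inv g" x] mult[of "inv g" g x] one by simp_all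
  have bij: "restrict (a g) X \<in> Bij X" if g: "g \<in> carrier G" for g
  proof -
    have "bij_betw (a g) X X"
      by (rule bij_betw_byWitness[where f' = "a (inv g)"]) (use inv g cl in auto)
    then show ?thesis by (simp add: Bij_def cong: bij_betw_cong)
  qed
  show ?thesis
    unfolding group_action_def group_hom_def group_hom_axioms_def
  proof (intro conjI)
    show "(\<lambda>g. restrict (a g) X) \<in> hom G (BijGroup X)"
    proof (rule homI)
      fix g assume "g \<in> carrier G"
      then show "restrict (a g) X \<in> carrier (BijGroup X)" using bij by (simp add: BijGroup_def)
    next
      fix g h assume "g \<in> carrier G" "h \<in> carrier G"
      then show "restrict (a (g \<otimes> h)) X = restrict (a g) X \<otimes>\<^bsub>BijGroup X\<^esub> restrict (a h) X"
        using bij cl mult by (auto simp: BijGroup_def compose_def restrict_def)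
    qed
  qed (rule group_axioms, rule group_BijGroup)
qed

section \<open>Squares and cubes in a CAT(0) cube complex\<close>

text \<open>Toggling subsets of \<open>S\<close> sweeps out the same interval whichever of its
  corners \<open>U\<close> is taken. Faces of a standard cube thereby lose their dependence on a
  smallest vertex.\<close>

lemma interval_conv_image: "{U - S..U \<union> S} = (\<lambda>Y. sym_diff U Y) ` Pow S"
proof (intro equalityI subsetI)
  fix B assume "B \<in> {U - S..U \<union> S}"
  then have "sym_diff U B \<in> Pow S" by auto
  moreover have "B = sym_diff U (sym_diff U B)" by blast
  ultimately show "B \<in> (\<lambda>Y. sym_diff U Y) ` Pow S" by (rule rev_image_eqI)
qed auto

lemma homotopy_context:
  assumes "equivclp (elementary_homotopy K) p q"
  shows "equivclp (elementary_homotopy K) (l @ p @ r) (l @ q @ r)"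
  using assms
proof (induction rule: equivclp_induct)
  case (step y z)
  have "elementary_homotopy K (l @ p @ r) (l @ q @ r)" if "elementary_homotopy K p q" for p q
    using that
  proof cases
    case (backtrack u v p' q')
    then show ?thesis using elementary_homotopy.backtrack[of u v K "l @ p'" "q' @ r"] by simp
  next
    case (square a' b c d p' q')
    then show ?thesis using elementary_homotopy.square[of a' b c d K "l @ p'" "q' @ r"] by simp
  qed
  then show ?case using step by (metis equivclp_into_equivclp)
qed simp

locale cat0 =
  fixes K :: "'z set set"
  assumes CAT0: "CAT0_cube_complex K"
begin

sublocale conn_graph "\<Union>K" "cc_edges K"
  using CAT0 by unfold_locales (simp add: CAT0_cube_complex_def simply_connected_cc_def)

abbreviation edge where "edge u v \<equiv> {u, v} \<in> cc_edges K"

text \<open>Corners are listed in cyclic order. Membership of the vertex set in \<open>K\<close>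
  says that the square is filled; a 4-cycle of edges would not license a homotopy move.\<close>

definition sq :: "'z \<Rightarrow> 'z \<Rightarrow> 'z \<Rightarrow> 'z \<Rightarrow> bool" where
  "sq a b c d \<longleftrightarrow> distinct [a, b, c, d] \<and> {a, b, c, d} \<in> K \<and>
    edge a b \<and> edge b c \<and> edge c d \<and> edge d a"

lemma sq_rot: "sq a b c d \<Longrightarrow> sq b c d a"
  unfolding sq_def by (auto simp: insert_commute)

lemma sq_flip: "sq a b c d \<Longrightarrow> sq a d c b"
  unfolding sq_def by (auto simp: insert_commute)

lemma sq_corner: "sq u p x q \<Longrightarrow> sq p u q x"
  by (rule sq_rot[OF sq_rot[OF sq_rot[OF sq_flip]]])

lemma chart_ex: "c \<in> K \<Longrightarrow> \<exists>n f. cube_chart K c n f"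
  using CAT0 unfolding CAT0_cube_complex_def cube_complex_def by blast

lemma chart_card: "cube_chart K c n f \<Longrightarrow> card c = 2 ^ n"
  unfolding cube_chart_def using bij_betw_same_card[of f "Pow {..<n}" c] by (simp add: card_Pow)

lemma chart_eq_iff:
  "cube_chart K c n f \<Longrightarrow> U \<subseteq> {..<n} \<Longrightarrow> W \<subseteq> {..<n} \<Longrightarrow> f U = f W \<longleftrightarrow> U = W"
  unfolding cube_chart_def bij_betw_def by (auto dest: inj_onD)

lemma chart_face:
  assumes "cube_chart K c n f" "U \<subseteq> {..<n}" "S \<subseteq> {..<n}"
  shows "f ` (\<lambda>Y. sym_diff U Y) ` Pow S \<in> K"
proof -
  have "{U - S..U \<union> S} \<in> standard_faces n"
    unfolding standard_faces_def using assms by blast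
  then have "f ` {U - S..U \<union> S} \<in> {d \<in> K. d \<subseteq> c}"
    using assms(1) unfolding cube_chart_def by blast
  then show ?thesis by (simp only: interval_conv_image) simp
qed

text \<open>An edge inside the cube is one of its faces, hence an interval with exactly two
  elements, and the ends of such an interval differ in one coordinate.\<close>

lemma chart_edge:
  assumes ch: "cube_chart K c n f" and U: "U \<subseteq> {..<n}" and w: "w \<in> c"
    and e: "{f U, w} \<in> cc_edges K"
  shows "\<exists>i<n. w = f (sym_diff U {i})"
proof -
  obtain W where W: "W \<subseteq> {..<n}" "w = f W"
    using ch w unfolding cube_chart_def bij_betw_def by auto
  have "f U \<in> c" using ch U unfolding cube_chart_def bij_betw_def by auto
  then have "{f U, w} \<in> {d \<in> K. d \<subseteq> c}" using e w by (auto simp: cc_edges_def)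
  then obtain A B where AB: "{f U, f W} = f ` {A..B}" "A \<subseteq> B" "B \<subseteq> {..<n}"
    using ch W unfolding cube_chart_def standard_faces_def by auto
  have inj: "inj_on f (Pow {..<n})" using ch unfolding cube_chart_def bij_betw_def by blast
  have "f ` {U, W} = f ` {A..B}" using AB by simp
  moreover have "{U, W} \<subseteq> Pow {..<n}" using U W by auto
  moreover have "{A..B} \<subseteq> Pow {..<n}"
    using AB(3) by (meson PowI atLeastAtMost_iff order_trans subsetI)
  ultimately have eq: "{U, W} = {A..B}" by (simp only: inj_on_image_eq_iff[OF inj])
  have UW: "U \<noteq> W" using edge_neq[OF e] W(2) by blast
  have "A \<noteq> B"
  proof
    assume "A = B"
    then have "{A} = {U, W}" using eq by simp
    then have "U = A" "W = A" by blast+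
    then show False using UW by simp
  qed
  then obtain i where i: "i \<in> B" "i \<notin> A" using AB by blast
  \<comment> \<open>\<open>insert i A\<close> lies between \<open>A\<close> and \<open>B\<close>, so
    in a two-element interval it is an end; being different from \<open>A\<close>, it is the other
    one.\<close>
  have mem: "A \<in> {U, W}" "B \<in> {U, W}" "insert i A \<in> {U, W}"
    using AB i unfolding eq by auto
  moreover have "insert i A \<noteq> A" using i(2) by blast
  ultimately have "U = A \<and> W = insert i A \<or> U = insert i A \<and> W = A" by blast
  moreover have "insert i A = sym_diff A {i}" "A = sym_diff (insert i A) {i}" using i(2) by blast+
  ultimately have "W = sym_diff U {i}" by metis
  then show ?thesis using W i AB by blast
qed

lemma chart_edge_toggle:
  assumes "cube_chart K c n f" "U \<subseteq> {..<n}" "i < n"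
  shows "{f U, f (sym_diff U {i})} \<in> cc_edges K"
proof -
  have "f ` (\<lambda>Y. sym_diff U Y) ` Pow {i} \<in> K"
    using assms by (intro chart_face) auto
  moreover have "Pow {i} = {{}, {i}}" by auto
  ultimately have "{f U, f (sym_diff U {i})} \<in> K" by simp
  moreover have "sym_diff U {i} \<subseteq> {..<n}" "U \<noteq> sym_diff U {i}" using assms by auto
  ultimately show ?thesis using chart_eq_iff[OF assms(1,2)] by (simp add: cc_edges_def)
qed

lemma chart_sq:
  assumes ch: "cube_chart K c n f" and U: "U \<subseteq> {..<n}" and ij: "i < n" "j < n" "i \<noteq> j"
  shows "sq (f U) (f (sym_diff U {i})) (f (sym_diff U {i, j})) (f (sym_diff U {j}))"
proof -
  let ?i = "sym_diff U {i}" and ?j = "sym_diff U {j}" and ?ij = "sym_diff U {i, j}"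
  have s: "?i \<subseteq> {..<n}" "?j \<subseteq> {..<n}" "?ij \<subseteq> {..<n}" using U ij by auto
  have ne: "U \<noteq> ?i" "U \<noteq> ?j" "U \<noteq> ?ij" "?i \<noteq> ?ij" "?i \<noteq> ?j" "?ij \<noteq> ?j"
    using ij(3) by blast+
  have dist: "distinct [f U, f ?i, f ?ij, f ?j]"
    using ne by (simp only: distinct.simps list.set insert_iff empty_iff
        chart_eq_iff[OF ch] U s simp_thms)
  have c1: "sym_diff ?i {j} = ?ij" "sym_diff ?j {i} = ?ij" using ij(3) by blast+
  have e: "{f U, f ?i} \<in> cc_edges K" "{f U, f ?j} \<in> cc_edges K"
    "{f ?i, f ?ij} \<in> cc_edges K" "{f ?j, f ?ij} \<in> cc_edges K"
    using chart_edge_toggle[OF ch U ij(1)] chart_edge_toggle[OF ch U ij(2)]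
      chart_edge_toggle[OF ch s(1) ij(2)] chart_edge_toggle[OF ch s(2) ij(1)]
    unfolding c1 by blast+
  have "f ` (\<lambda>Y. sym_diff U Y) ` Pow {i, j} \<in> K"
    using ij by (intro chart_face[OF ch U]) auto
  moreover have "Pow {i, j} = {{}, {i}, {i, j}, {j}}" by auto
  moreover have "sym_diff U {} = U" by simp
  ultimately have "{f U, f ?i, f ?ij, f ?j} \<in> K" by (simp only: image_insert image_empty)
  then show ?thesis using dist e unfolding sq_def by (simp only: insert_commute simp_thms)
qed

text \<open>Two filled squares sharing three corners would otherwise meet in exactly three vertices.
  Their intersection is a cube of \<open>K\<close>, and three is not a power of two.\<close>

lemma sq_unique:
  assumes "sq a b c d" "sq a b c d'"
  shows "d = d'"
proof (rule ccontr)
  assume "d \<noteq> d'"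
  have I: "{a, b, c, d} \<inter> {a, b, c, d'} = {a, b, c}"
    using assms \<open>d \<noteq> d'\<close> by (auto simp: sq_def)
  have "c \<inter> c' = {} \<or> c \<inter> c' \<in> K" if "c \<in> K" "c' \<in> K" for c c'
    using that CAT0 unfolding CAT0_cube_complex_def cube_complex_def by simp
  moreover have "{a, b, c, d} \<in> K" "{a, b, c, d'} \<in> K" using assms by (simp_all add: sq_def)
  ultimately have "{a, b, c, d} \<inter> {a, b, c, d'} = {} \<or> {a, b, c, d} \<inter> {a, b, c, d'} \<in> K"
    by metis
  then have "{a, b, c} \<in> K" unfolding I by simp
  then obtain n f where "cube_chart K {a, b, c} n f" using chart_ex by metis
  then have "(2::nat) ^ n = card {a, b, c}" using chart_card by metis
  also have "\<dots> = 3" using assms by (simp add: sq_def)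
  finally have "(2::nat) ^ n = 3" .
  moreover have "(2::nat) ^ n = 1 \<or> even ((2::nat) ^ n)" by (cases n) auto
  ultimately show False by auto
qed

text \<open>A square has two coordinates, so a corner has at most two neighbours inside it; a
  diagonal would add a third.\<close>

lemma sq_no_diagonal:
  assumes "sq p u q x"
  shows "{u, x} \<notin> cc_edges K"
proof
  assume e: "edge u x"
  define c where "c = {p, u, q, x}"
  have "c \<in> K" using assms by (simp add: sq_def c_def)
  then obtain n f where ch: "cube_chart K c n f" using chart_ex by blast
  have "card c = 4" using assms by (simp add: sq_def c_def)
  then have "(2::nat) ^ n = 2 ^ 2" using chart_card[OF ch] by simp
  then have n: "n = 2" by (subst (asm) power_inject_exp) auto
  obtain U where U: "U \<subseteq> {..<n}" "u = f U"
    using ch unfolding cube_chart_def bij_betw_def c_def by blast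
  have "w \<in> (\<lambda>i. f (sym_diff U {i})) ` {..<n}" if "w \<in> {p, q, x}" for w
  proof -
    have "{f U, w} \<in> cc_edges K" "w \<in> c"
      using that e assms U(2) by (auto simp: sq_def c_def insert_commute)
    then show ?thesis using chart_edge[OF ch U(1)] by blast
  qed
  then have "card {p, q, x} \<le> card ((\<lambda>i. f (sym_diff U {i})) ` {..<n})"
    by (intro card_mono) auto
  also have "\<dots> \<le> card {..<n}" by (rule card_image_le) simp
  finally show False using assms n by (simp add: sq_def)
qed

lemma link_edge: "edge u a \<Longrightarrow> {a} \<in> link K u"
proof -
  assume e: "edge u a"
  have "{w \<in> {u, a}. edge u w} = {a}" using e edge_neq[of u u] by auto
  then show ?thesis using e unfolding link_def cc_edges_def
    by (intro CollectI exI[of _ "{u, a}"]) auto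
qed

text \<open>Since diagonals are absent, the neighbours of \<open>u\<close> in the square are just
  \<open>p\<close> and \<open>q\<close>, and the square contributes precisely this edge of the
  link.\<close>

lemma link_sq: "sq p u q x \<Longrightarrow> {p, q} \<in> link K u"
proof -
  assume s: "sq p u q x"
  have "{w \<in> {p, u, q, x}. edge u w} = {p, q}"
    using s sq_no_diagonal[OF s] edge_neq[of u u] by (auto simp: sq_def insert_commute)
  then show ?thesis using s unfolding link_def sq_def
    by (intro CollectI exI[of _ "{p, u, q, x}"]) auto
qed

text \<open>This is the only place where the flag condition enters.\<close>

lemma cube_corner:
  assumes s: "sq p u q x" "sq q u r y" "sq p u r w" and ne: "p \<noteq> q" "q \<noteq> r" "p \<noteq> r"
  shows "\<exists>t. sq p x t w \<and> sq q x t y \<and> sq r y t w"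
proof -
  have u: "u \<in> \<Union>K" using s(1) edge_V[of p u] by (simp add: sq_def)
  have E: "edge u p" "edge u q" "edge u r"
    using s by (auto simp: sq_def insert_commute)
  have "\<forall>a\<in>{p, q, r}. \<forall>b\<in>{p, q, r}. {a, b} \<in> link K u"
    using link_sq[OF s(1)] link_sq[OF s(2)] link_sq[OF s(3)]
      link_edge[OF E(1)] link_edge[OF E(2)] link_edge[OF E(3)]
    by (simp add: insert_commute)
  moreover have "flag (link K u)" using CAT0 u unfolding CAT0_cube_complex_def by blast
  ultimately have "{p, q, r} \<in> link K u"
    unfolding flag_def by (elim allE[of _ "{p, q, r}"]) simp
  then obtain c where c: "c \<in> K" "u \<in> c" "{p, q, r} = {w \<in> c. edge u w}"
    unfolding link_def by blast
  obtain n f where ch: "cube_chart K c n f" using chart_ex[OF c(1)] by blast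
  obtain U where U: "U \<subseteq> {..<n}" "u = f U"
    using ch c(2) unfolding cube_chart_def bij_betw_def by blast
  have "p \<in> c" "q \<in> c" "r \<in> c" using c(3) by auto
  then obtain i j k where ijk: "i < n" "p = f (sym_diff U {i})" "j < n" "q = f (sym_diff U {j})"
    "k < n" "r = f (sym_diff U {k})"
    using chart_edge[OF ch U(1)] E unfolding U(2) by meson
  have d: "i \<noteq> j" "j \<noteq> k" "i \<noteq> k" using ne ijk by auto
  \<comment> \<open>The cube given by the flag condition has its own fourth corner over each pair of
    neighbours of \<open>u\<close>; uniqueness identifies these corners with the given
    \<open>x\<close>, \<open>y\<close> and \<open>w\<close>.\<close>
  have "sq p u q (f (sym_diff U {i, j}))"
    unfolding ijk(2,4) U(2) by (rule sq_corner[OF chart_sq[OF ch U(1) ijk(1,3) d(1)]])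
  then have x: "x = f (sym_diff U {i, j})" by (rule sq_unique[OF s(1)])
  have "sq q u r (f (sym_diff U {j, k}))"
    unfolding ijk(4,6) U(2) by (rule sq_corner[OF chart_sq[OF ch U(1) ijk(3,5) d(2)]])
  then have y: "y = f (sym_diff U {j, k})" by (rule sq_unique[OF s(2)])
  have "sq p u r (f (sym_diff U {i, k}))"
    unfolding ijk(2,6) U(2) by (rule sq_corner[OF chart_sq[OF ch U(1) ijk(1,5) d(3)]])
  then have w: "w = f (sym_diff U {i, k})" by (rule sq_unique[OF s(3)])
  define t where "t = f (sym_diff U {i, j, k})"
  \<comment> \<open>The faces of the cube that avoid \<open>u\<close>; each contains the corner
    \<open>t\<close> antipodal to \<open>u\<close>.\<close>
  have face: "sq (f (sym_diff U {a})) (f (sym_diff U {a, b})) (f (sym_diff U {a, b, e})) (f (sym_diff U {a, e}))"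
    if "a < n" "b < n" "e < n" "a \<noteq> b" "b \<noteq> e" "a \<noteq> e" for a b e
  proof -
    have "sym_diff U {a} \<subseteq> {..<n}" using U that by auto
    moreover have "sym_diff (sym_diff U {a}) {b} = sym_diff U {a, b}"
      "sym_diff (sym_diff U {a}) {e} = sym_diff U {a, e}"
      "sym_diff (sym_diff U {a}) {b, e} = sym_diff U {a, b, e}"
      using that by blast+
    ultimately show ?thesis using chart_sq[OF ch, of "sym_diff U {a}" b e] that by metis
  qed
  have "sq p x t w" unfolding ijk x w t_def using face[of i j k] ijk d by simp
  moreover have "sq q x t y"
    unfolding ijk x y t_def using face[of j i k] ijk d by (simp add: insert_commute)
  moreover have "sq r y t w"
    unfolding ijk w y t_def using face[of k j i] ijk d by (simp add: insert_commute)
  ultimately show ?thesis by blast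
qed

end

section \<open>Paths up to square moves\<close>

text \<open>Lists are read from their head, which is the end at which a path is extended.\<close>

context cat0
begin

abbreviation path where "path \<equiv> walk (\<Union>K) (cc_edges K)"

text \<open>\<open>swap\<close> has an arbitrary tail and \<open>keep\<close> adds a prefix, so a
  square move may occur anywhere in the path. Backtracks are neither inserted nor deleted, hence the
  length is an invariant as well as both ends.\<close>

inductive sw :: "'z list \<Rightarrow> 'z list \<Rightarrow> bool" where
  swap: "sq a b c d \<Longrightarrow> sw (c # b # a # q) (c # d # a # q)"
| keep: "sw p q \<Longrightarrow> sw (x # p) (x # q)"

abbreviation sweq :: "'z list \<Rightarrow> 'z list \<Rightarrow> bool" (infix "\<approx>" 50) where
  "p \<approx> q \<equiv> sw\<^sup>*\<^sup>* p q"

lemma sw_sym: "sw p q \<Longrightarrow> sw q p"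
  by (induction rule: sw.induct) (auto intro: sw.intros sq_flip)

lemma sweq_sym: "p \<approx> q \<Longrightarrow> q \<approx> p"
  by (metis sw_sym symp_def symp_rtranclp)

lemma sweq_trans [trans]: "p \<approx> q \<Longrightarrow> q \<approx> r \<Longrightarrow> p \<approx> r"
  by (rule rtranclp_trans)

lemma sweq_Cons: "p \<approx> q \<Longrightarrow> x # p \<approx> x # q"
  by (induction rule: rtranclp_induct) (auto intro: sw.keep rtranclp.rtrancl_into_rtrancl)

lemma sweq_swap: "sq a b c d \<Longrightarrow> c # b # a # q \<approx> c # d # a # q"
  by (simp add: sw.swap r_into_rtranclp)

lemma sw_invariants:
  "sw p q \<Longrightarrow> length p = length q \<and> hd p = hd q \<and> last p = last q \<and> p \<noteq> [] \<and> q \<noteq> []"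
  by (induction rule: sw.induct) auto

lemma sw_walk: "sw p q \<Longrightarrow> path p \<Longrightarrow> path q"
proof (induction rule: sw.induct)
  case (swap a b c d q)
  then have "edge c d" "edge d a" by (auto simp: sq_def)
  then show ?case using swap edge_V[of c d] by auto
next
  case (keep p q x)
  have "hd p = hd q" "p \<noteq> []" "q \<noteq> []" using sw_invariants[OF keep(1)] by auto
  then show ?case using keep by (cases p; cases q) auto
qed

lemma sweq_length: "p \<approx> q \<Longrightarrow> length p = length q"
  by (induction rule: rtranclp_induct) (auto dest: sw_invariants)

lemma sweq_hd: "p \<approx> q \<Longrightarrow> hd p = hd q"
  by (induction rule: rtranclp_induct) (auto dest: sw_invariants)

lemma sweq_last: "p \<approx> q \<Longrightarrow> last p = last q"
  by (induction rule: rtranclp_induct) (auto dest: sw_invariants)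

lemma sweq_walk: "p \<approx> q \<Longrightarrow> path p \<Longrightarrow> path q"
  by (induction rule: rtranclp_induct) (auto dest: sw_walk)

lemma sweq_nonempty: "p \<approx> q \<Longrightarrow> p \<noteq> [] \<Longrightarrow> q \<noteq> []"
  by (auto dest: sweq_length)

text \<open>As in a right-angled Artin group, where two words for the same element with different
  leading letters have commuting leading letters and a common remainder; here the remainder starts
  at the far corner \<open>a\<close>. The vertex \<open>v\<close> is left off both lists.\<close>

definition exch :: "'z \<Rightarrow> 'z list \<Rightarrow> 'z list \<Rightarrow> bool" where
  "exch v p q \<longleftrightarrow> hd p = hd q \<and> p \<approx> q \<or>
     (\<exists>a s. sq a (hd p) v (hd q) \<and> p \<approx> hd p # a # s \<and> q \<approx> hd q # a # s)"

text \<open>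
  Two equivalent paths ending with different edges end, up to equivalence, with the two halves
  of a square.  Three consecutive last edges produce by induction three squares around a vertex,
  hence a 3-cube.
\<close>

lemma exchange: "v # p \<approx> v # q \<Longrightarrow> exch v p q"
proof (induction "length p" arbitrary: v p q rule: less_induct)
  case less
  have "\<exists>q. Y = v # q \<and> exch v p q" if "v # p \<approx> Y" for Y
    using that
  proof (induction rule: rtranclp_induct)
    case base
    show ?case by (auto simp: exch_def)
  next
    case (step Y Z)
    then obtain p' where Y: "Y = v # p'" "exch v p p'" by blast
    from \<open>sw Y Z\<close> show ?case
    proof cases
      case (keep r q x)
      then have q: "Z = v # q" "sw p' q" using Y by auto
      then have "p' \<approx> q" "hd p' = hd q" using sw_invariants by (blast, blast)
      then have "exch v p q" using Y(2) unfolding exch_def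
        by (metis rtranclp_trans sweq_sym)
      then show ?thesis using q by blast
    next
      case (swap a b c d q)
      then have sqv: "sq a b v d" and p': "p' = b # a # q" and Z: "Z = v # d # a # q"
        using Y by auto
      from Y(2) consider "hd p = b" "p \<approx> p'"
        | a' s where "sq a' (hd p) v b" "p \<approx> hd p # a' # s" "p' \<approx> b # a' # s"
        unfolding exch_def p' by auto
      then have "exch v p (d # a # q)"
      proof cases
        case 1
        then show ?thesis using sqv unfolding exch_def p' by (intro disjI2 exI[of _ a] exI[of _ q]) auto
      next
        case (2 a' s)
        \<comment> \<open>The tail \<open>a # q\<close> of \<open>p'\<close> is shorter than
          \<open>p\<close>, so the induction hypothesis compares the two continuations after
          \<open>b\<close>.\<close>
        have "length p = length p'" using step(1) Y sweq_length by fastforce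
        then have "exch b (a # q) (a' # s)" using less(1)[of "a # q" b "a' # s"] 2(3) unfolding p' by simp
        then consider "a = a'" "a # q \<approx> a' # s"
          | g s' where "sq g a b a'" "a # q \<approx> a # g # s'" "a' # s \<approx> a' # g # s'"
          unfolding exch_def by auto
        then show ?thesis
        proof cases
          case 1
          \<comment> \<open>The earlier square and the new one share the corners \<open>v\<close>,
            \<open>b\<close>, \<open>a\<close>, so the swap undoes the earlier exchange.\<close>
          have "sq v b a (hd p)" using sq_flip sq_rot 2(1) 1 by metis
          moreover have "sq v b a d" using sq_flip sq_rot sqv by metis
          ultimately have "hd p = d" using sq_unique by blast
          moreover have "d # a' # s \<approx> d # a # q" using 1 sweq_Cons sweq_sym by metis
          ultimately show ?thesis using 2(2) unfolding exch_def by (auto intro: sweq_trans)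
        next
          case g: (2 g s')
          \<comment> \<open>Three squares meet at \<open>b\<close>, one for each pair of the
            neighbours \<open>v\<close>, \<open>a\<close>, \<open>a'\<close>. In the resulting cube
            both paths can be rerouted through the corner \<open>t\<close> opposite to
            \<open>b\<close>.\<close>
          have "sq v b a d" using sq_flip sq_rot sqv by metis
          moreover have "sq a b a' g" using sq_flip sq_rot g(1) by metis
          moreover have "sq v b a' (hd p)" using sq_flip sq_rot 2(1) by metis
          moreover have "v \<noteq> a" "a \<noteq> a'" "v \<noteq> a'" using sqv g(1) 2(1) by (auto simp: sq_def)
          ultimately obtain t where t: "sq v d t (hd p)" "sq a d t g" "sq a' g t (hd p)"
            using cube_corner by blast
          have "p \<approx> hd p # a' # g # s'" using 2(2) g(3) sweq_Cons sweq_trans by metis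
          also have "\<dots> \<approx> hd p # t # g # s'"
            using t(3) sq_flip sq_rot by (metis sweq_swap)
          finally have "p \<approx> hd p # t # g # s'" .
          moreover have "d # a # q \<approx> d # a # g # s'" using g(2) sweq_Cons by metis
          then have "d # a # q \<approx> d # t # g # s'"
            using t(2) sq_flip sq_rot sweq_swap sweq_trans by metis
          moreover have "sq t (hd p) v d" using t(1) sq_rot by metis
          ultimately show ?thesis unfolding exch_def by auto
        qed
      qed
      then show ?thesis using Z by blast
    qed
  qed
  then show ?case using less(2) by blast
qed

end

section \<open>Reduced paths and the word problem\<close>

context cat0
begin

text \<open>The square alternative of the exchange would put \<open>x\<close> at two different
  corners.\<close>

lemma sweq_cancel: "v # x # p \<approx> v # x # q \<Longrightarrow> x # p \<approx> x # q"
  by (drule exchange) (auto simp: exch_def sq_def)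

definition backtracks :: "'z list \<Rightarrow> bool" where
  "backtracks p \<longleftrightarrow> (\<exists>l u v r. p = l @ u # v # u # r)"

text \<open>Quantifying over the whole class makes the property invariant under square moves: a path
  without a visible backtrack may acquire one after some of them.\<close>

definition reduced :: "'z list \<Rightarrow> bool" where
  "reduced p \<longleftrightarrow> (\<forall>q. p \<approx> q \<longrightarrow> \<not> backtracks q)"

lemma backtracks_Cons:
  "backtracks (w # q) \<longleftrightarrow> backtracks q \<or> (\<exists>v r. q = v # w # r)"
proof
  assume "backtracks (w # q)"
  then obtain l u v r where "w # q = l @ u # v # u # r" unfolding backtracks_def by blast
  then show "backtracks q \<or> (\<exists>v r. q = v # w # r)"
    unfolding backtracks_def by (cases l) auto
next
  assume "backtracks q \<or> (\<exists>v r. q = v # w # r)"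
  then show "backtracks (w # q)" unfolding backtracks_def by (metis append_Cons append_Nil)
qed

lemma reduced_sweq: "reduced p \<Longrightarrow> p \<approx> q \<Longrightarrow> reduced q"
  unfolding reduced_def by (meson sweq_trans)

lemma reduced_tl: "reduced (x # p) \<Longrightarrow> reduced p"
  unfolding reduced_def using backtracks_Cons sweq_Cons by blast

lemma not_reduced_backtrack: "\<not> reduced (u # v # u # r)"
  unfolding reduced_def using backtracks_Cons by blast

lemma reduced_single: "reduced [x]"
proof -
  have "q = [x]" if "[x] \<approx> q" for q
    using sweq_length[OF that] sweq_hd[OF that] by (cases q) auto
  moreover have "\<not> backtracks [x]" by (auto simp: backtracks_def Cons_eq_append_conv)
  ultimately show ?thesis unfolding reduced_def by blast
qed

text \<open>A backtrack appearing after square moves either lies beyond the first vertex or uses the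
  new edge. The exchange traces both cases back to a form of \<open>r\<close> that starts with the
  edge to \<open>w\<close>, or that backtracks itself.\<close>

lemma reduced_Cons:
  "r \<noteq> [] \<Longrightarrow> reduced r \<Longrightarrow> \<nexists>p. r \<approx> hd r # w # p \<Longrightarrow> reduced (w # r)"
proof (induction "length r" arbitrary: r w rule: less_induct)
  case less
  show ?case unfolding reduced_def
  proof (intro allI impI notI)
    fix q0 assume q0: "w # r \<approx> q0" "backtracks q0"
    then obtain q where q: "q0 = w # q"
      using sweq_hd sweq_nonempty by (metis hd_Cons_tl list.discI list.sel(1))
    have ex: "exch w r q" using q0(1) unfolding q by (rule exchange)
    have "backtracks q \<or> (\<exists>v r'. q = v # w # r')" using q0 q backtracks_Cons by simp
    then show False
    proof
      assume bt: "backtracks q"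
      then have "\<not> r \<approx> q" using less.prems by (auto simp: reduced_def)
      then obtain a s where as: "sq a (hd r) w (hd q)" "r \<approx> hd r # a # s" "q \<approx> hd q # a # s"
        using ex unfolding exch_def by blast
      have "\<not> reduced q" using bt unfolding reduced_def by blast
      then have nr: "\<not> reduced (hd q # a # s)" using as(3) reduced_sweq sweq_sym by blast
      \<comment> \<open>Prolonging the shorter reduced path \<open>a # s\<close> by
        \<open>hd q\<close> is not reduced, so the induction hypothesis lets \<open>a # s\<close>
        pass through \<open>hd q\<close>; the square then turns this into a form of \<open>r\<close>
        through \<open>w\<close>.\<close>
      have "reduced (a # s)" using as(2) less.prems reduced_sweq reduced_tl by blast
      moreover have "length (a # s) < length r" using sweq_length[OF as(2)] by simp
      ultimately obtain p where "a # s \<approx> a # hd q # p"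
        using less.hyps[of "a # s" "hd q"] nr by auto
      then have "r \<approx> hd r # a # hd q # p" using as(2) sweq_Cons sweq_trans by blast
      also have "\<dots> \<approx> hd r # w # hd q # p"
        using as(1) sq_flip sq_rot by (metis sweq_swap)
      finally show False using less.prems by blast
    next
      assume "\<exists>v r'. q = v # w # r'"
      then obtain v r' where q': "q = v # w # r'" by blast
      from ex have "hd r = v \<and> r \<approx> q \<or>
          (\<exists>a s. sq a (hd r) w v \<and> r \<approx> hd r # a # s \<and> v # w # r' \<approx> v # a # s)"
        unfolding exch_def q' by simp
      then show False
      proof
        assume "hd r = v \<and> r \<approx> q"
        then show False using less.prems q' by blast
      next
        assume "\<exists>a s. sq a (hd r) w v \<and> r \<approx> hd r # a # s \<and> v # w # r' \<approx> v # a # s"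
        then obtain a s where as: "sq a (hd r) w v" "r \<approx> hd r # a # s" "v # w # r' \<approx> v # a # s"
          by blast
        \<comment> \<open>As \<open>w\<close> and \<open>a\<close> are distinct corners, a second
          exchange at \<open>v\<close> yields a square with the same corners \<open>w\<close>,
          \<open>v\<close>, \<open>a\<close>. Its fourth corner must be \<open>hd r\<close>, so
          \<open>r\<close> backtracks.\<close>
        have "w \<noteq> a" using as(1) by (auto simp: sq_def)
        then obtain g s' where g: "sq g w v a" "a # s \<approx> a # g # s'"
          using exchange[OF as(3)] unfolding exch_def by auto
        have "sq w v a g" "sq w v a (hd r)" using g(1) as(1) sq_rot by metis+
        then have "g = hd r" using sq_unique by blast
        then have "r \<approx> hd r # a # hd r # s'" using g(2) as(2) sweq_Cons sweq_trans by blast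
        then show False using less.prems reduced_sweq not_reduced_backtrack by blast
      qed
    qed
  qed
qed

text \<open>The trick of van der Waerden for free groups: edges act on classes of reduced paths, by
  cancellation if the class contains a path whose head edge already leads to \<open>w\<close>, and
  by prolongation otherwise.\<close>

definition step :: "'z list \<Rightarrow> 'z \<Rightarrow> 'z list" where
  "step r w = (if \<exists>p. r \<approx> hd r # w # p then w # (SOME p. r \<approx> hd r # w # p) else w # r)"

lemma hd_step [simp]: "hd (step r w) = w"
  by (simp add: step_def)

lemma step_nonempty [simp]: "step r w \<noteq> []"
  by (simp add: step_def)

text \<open>The arbitrary choice made by \<open>SOME\<close> has no effect up to square moves, since
  a common first vertex can be cancelled.\<close>

lemma step_cancel:
  assumes "r \<approx> hd r # w # p"
  shows "step r w \<approx> w # p"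
proof -
  have "r \<approx> hd r # w # (SOME p. r \<approx> hd r # w # p)" using assms by (rule someI)
  then have "hd r # w # (SOME p. r \<approx> hd r # w # p) \<approx> hd r # w # p"
    using assms sweq_sym sweq_trans by blast
  then show ?thesis using assms sweq_cancel unfolding step_def by auto
qed

lemma step_new: "\<nexists>p. r \<approx> hd r # w # p \<Longrightarrow> step r w = w # r"
  by (simp add: step_def)

lemma step_cong:
  assumes "r \<approx> r'"
  shows "step r w \<approx> step r' w"
proof -
  have hd: "hd r = hd r'" using assms by (rule sweq_hd)
  show ?thesis
  proof (cases "\<exists>p. r \<approx> hd r # w # p")
    case True
    then obtain p where "r \<approx> hd r # w # p" by blast
    moreover from this have "r' \<approx> hd r' # w # p" using assms hd sweq_sym sweq_trans by metis
    ultimately show ?thesis using step_cancel sweq_sym sweq_trans by meson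
  next
    case False
    then have "\<nexists>p. r' \<approx> hd r' # w # p" using assms hd sweq_trans by metis
    then show ?thesis using False assms by (simp add: step_new sweq_Cons)
  qed
qed

lemma step_reduced:
  assumes "r \<noteq> []" "reduced r"
  shows "reduced (step r w)"
proof (cases "\<exists>p. r \<approx> hd r # w # p")
  case True
  then obtain p where p: "r \<approx> hd r # w # p" by blast
  then have "reduced (w # p)" using assms(2) reduced_sweq reduced_tl by blast
  then show ?thesis using step_cancel[OF p] reduced_sweq sweq_sym by blast
next
  case False
  then show ?thesis using step_new reduced_Cons[OF assms] by simp
qed

text \<open>Invariance under the backtracking move. After a cancellation the return cannot cancel
  too, since \<open>r\<close> would then backtrack.\<close>

lemma step_back:
  assumes "r \<noteq> []" "reduced r"
  shows "step (step r w) (hd r) \<approx> r"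
proof (cases "\<exists>p. r \<approx> hd r # w # p")
  case True
  then obtain p where p: "r \<approx> hd r # w # p" by blast
  have "\<nexists>p'. w # p \<approx> w # hd r # p'"
  proof
    assume "\<exists>p'. w # p \<approx> w # hd r # p'"
    then obtain p' where "w # p \<approx> w # hd r # p'" by blast
    then have "r \<approx> hd r # w # hd r # p'" using p sweq_Cons sweq_trans by blast
    then show False using assms reduced_sweq not_reduced_backtrack by blast
  qed
  then have "step (w # p) (hd r) = hd r # w # p" by (simp add: step_new)
  then show ?thesis using step_cong[OF step_cancel[OF p], of "hd r"] p sweq_sym sweq_trans by metis
next
  case False
  then have "step r w = w # hd r # tl r" using assms by (simp add: step_new)
  moreover have "step (w # hd r # tl r) (hd r) \<approx> hd r # tl r" by (rule step_cancel) simp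
  ultimately show ?thesis using assms by simp
qed

text \<open>Invariance under the square move. The cases record which of the two edges of the square
  at \<open>hd r\<close> can be cancelled.\<close>

lemma step_square:
  assumes r: "r \<noteq> []" "reduced r" and s: "sq (hd r) b c d"
  shows "step (step r b) c \<approx> step (step r d) c"
proof -
  let ?v = "hd r"
  \<comment> \<open>\<open>b\<close> cancels and \<open>d\<close> does not: through \<open>b\<close>
    the second step prolongs to \<open>c # b # p\<close>, while through \<open>d\<close> the square
    exposes \<open>c\<close> and the second step cancels to the same path.\<close>
  have one: "step (step r b) c \<approx> step (step r d) c"
    if s: "sq (hd r) b c d" and yes: "r \<approx> hd r # b # p" and no: "\<nexists>p. r \<approx> hd r # d # p" for b d p
  proof -
    have "\<nexists>p'. b # p \<approx> b # c # p'"
    proof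
      assume "\<exists>p'. b # p \<approx> b # c # p'"
      then obtain p' where "b # p \<approx> b # c # p'" by blast
      then have "r \<approx> hd r # b # c # p'" using yes sweq_Cons sweq_trans by blast
      also have "\<dots> \<approx> hd r # d # c # p'" using s sq_rot sq_flip by (metis sweq_swap)
      finally show False using no by blast
    qed
    then have "step (b # p) c = c # b # p" by (simp add: step_new)
    then have l: "step (step r b) c \<approx> c # b # p"
      using step_cong[OF step_cancel[OF yes], of c] by simp
    have "step r d = d # r" using no by (rule step_new)
    moreover have "d # r \<approx> d # hd r # b # p" using yes by (rule sweq_Cons)
    moreover have "d # hd r # b # p \<approx> d # c # b # p"
      using s sq_rot sq_flip by (metis sweq_swap)
    ultimately have "step r d \<approx> d # c # b # p" using sweq_trans by metis
    then have "step (step r d) c \<approx> c # b # p" using step_cancel[of "step r d" c "b # p"] by simp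
    then show ?thesis using l sweq_sym sweq_trans by blast
  qed
  \<comment> \<open>Neither edge cancels: a cancellation of \<open>c\<close> after \<open>b\<close>
    would, by the exchange, produce a square that forces \<open>d\<close> to be cancellable.\<close>
  have new: "step (step r b) c = c # b # r"
    if s: "sq (hd r) b c d" and no: "\<nexists>p. r \<approx> hd r # b # p" "\<nexists>p. r \<approx> hd r # d # p" for b d
  proof -
    have "\<nexists>p. b # r \<approx> b # c # p"
    proof
      assume "\<exists>p. b # r \<approx> b # c # p"
      then obtain p where "exch b r (c # p)" using exchange by blast
      moreover have "hd r \<noteq> c" using s by (auto simp: sq_def)
      ultimately obtain g s' where g: "sq g (hd r) b c" "r \<approx> hd r # g # s'"
        unfolding exch_def by auto
      have "sq (hd r) b c g" using g(1) by (rule sq_rot)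
      then have "g = d" using s sq_unique by blast
      then show False using g(2) no(2) by blast
    qed
    then show ?thesis using no(1) by (simp add: step_new)
  qed
  have s': "sq (hd r) d c b" using s by (rule sq_flip)
  show ?thesis
  proof (cases "\<exists>p. r \<approx> hd r # b # p"; cases "\<exists>p. r \<approx> hd r # d # p")
    assume "\<exists>p. r \<approx> hd r # b # p" "\<exists>p. r \<approx> hd r # d # p"
    then obtain p p' where p: "r \<approx> hd r # b # p" "r \<approx> hd r # d # p'" by blast
    \<comment> \<open>Both edges cancel: the exchange puts \<open>b\<close> and \<open>d\<close> on
      one square with \<open>hd r\<close>, whose far corner is \<open>c\<close>, so both routes
      continue from \<open>c\<close> with the same tail.\<close>
    then have "hd r # b # p \<approx> hd r # d # p'" using sweq_sym sweq_trans by blast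
    then have "exch (hd r) (b # p) (d # p')" by (rule exchange)
    moreover have "b \<noteq> d" using s by (auto simp: sq_def)
    ultimately obtain a t where a: "sq a b (hd r) d" "b # p \<approx> b # a # t" "d # p' \<approx> d # a # t"
      unfolding exch_def by auto
    have "sq b (hd r) d a" "sq b (hd r) d c" using a(1) s sq_rot sq_flip by metis+
    then have "a = c" using sq_unique by blast
    then have "step r b \<approx> b # c # t" "step r d \<approx> d # c # t"
      using step_cancel[OF p(1)] step_cancel[OF p(2)] a sweq_trans by blast+
    then have "step (step r b) c \<approx> c # t" "step (step r d) c \<approx> c # t"
      using step_cancel[of "step r b" c t] step_cancel[of "step r d" c t] by simp_all
    then show ?thesis using sweq_sym sweq_trans by blast
  next
    assume "\<exists>p. r \<approx> hd r # b # p" "\<nexists>p. r \<approx> hd r # d # p"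
    then show ?thesis using one[OF s] by blast
  next
    assume "\<nexists>p. r \<approx> hd r # b # p" "\<exists>p. r \<approx> hd r # d # p"
    then show ?thesis using one[OF s'] sweq_sym by blast
  next
    assume no: "\<nexists>p. r \<approx> hd r # b # p" "\<nexists>p. r \<approx> hd r # d # p"
    have "r = hd r # tl r" using r by simp
    then have "c # b # r \<approx> c # d # r" using sweq_swap[OF s, of "tl r"] by simp
    then show ?thesis using new[OF s no] new[OF s' no(2,1)] by simp
  qed
qed

text \<open>The path is fed to \<open>step\<close> from its last vertex upwards, starting with the
  constant path there. Up to square moves the result depends on the homotopy class of the path
  alone.\<close>

fun normal_form :: "'z list \<Rightarrow> 'z list" where
  "normal_form [] = []"
| "normal_form [x] = [x]"
| "normal_form (x # y # p) = step (normal_form (y # p)) x"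

lemma normal_form_props:
  "p \<noteq> [] \<Longrightarrow> normal_form p \<noteq> [] \<and> hd (normal_form p) = hd p \<and> reduced (normal_form p)"
  by (induction p rule: normal_form.induct) (auto simp: reduced_single step_reduced)

lemma normal_form_Cons: "p \<noteq> [] \<Longrightarrow> normal_form (x # p) = step (normal_form p) x"
  by (cases p) auto

lemma normal_form_append:
  "p \<noteq> [] \<Longrightarrow> q \<noteq> [] \<Longrightarrow> normal_form p \<approx> normal_form q \<Longrightarrow>
    normal_form (l @ p) \<approx> normal_form (l @ q)"
  by (induction l) (auto simp: normal_form_Cons step_cong)

lemma normal_form_homotopy:
  assumes "elementary_homotopy K p q"
  shows "normal_form p \<approx> normal_form q"
  using assms
proof cases
  case (backtrack u v l q')
  have "normal_form (u # v # u # q') \<approx> normal_form (u # q')"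
    using step_back[of "normal_form (u # q')" v] normal_form_props[of "u # q'"] by simp
  then show ?thesis using normal_form_append[of "u # v # u # q'" "u # q'" l] backtrack by simp
next
  case (square a b c d l q')
  then have "sq c b a d" by (auto simp: sq_def insert_commute)
  then have "normal_form (a # b # c # q') \<approx> normal_form (a # d # c # q')"
    using step_square[of "normal_form (c # q')" b a d] normal_form_props[of "c # q'"] by simp
  then show ?thesis
    using normal_form_append[of "a # b # c # q'" "a # d # c # q'" l] square by simp
qed

lemma normal_form_equivclp:
  "equivclp (elementary_homotopy K) p q \<Longrightarrow> normal_form p \<approx> normal_form q"
proof (induction rule: equivclp_induct)
  case (step y z)
  then show ?case using normal_form_homotopy sweq_sym sweq_trans by meson
qed simp

text \<open>Along a reduced path no step can cancel, since a cancellable edge would exhibit a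
  backtrack; so every step merely prolongs.\<close>

lemma normal_form_reduced: "reduced p \<Longrightarrow> normal_form p \<approx> p"
proof (induction p rule: normal_form.induct)
  case (3 x y p)
  have "normal_form (y # p) \<approx> y # p" using 3 reduced_tl by blast
  then have "normal_form (x # y # p) \<approx> step (y # p) x" using step_cong by simp
  moreover have "\<nexists>p'. y # p \<approx> y # x # p'"
    using 3(2) sweq_Cons reduced_sweq not_reduced_backtrack by blast
  then have "step (y # p) x = x # y # p" by (simp add: step_new)
  ultimately show ?case by simp
qed auto

lemma homotopy_rev_self:
  "path q \<Longrightarrow> equivclp (elementary_homotopy K) (rev q @ tl q) [last q]"
proof (induction q rule: induct_list012)
  case (3 x z q)
  then have "elementary_homotopy K (rev q @ [z, x, z] @ q) (rev q @ [z] @ q)"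
    by (intro elementary_homotopy.backtrack) (auto simp: insert_commute)
  then have "equivclp (elementary_homotopy K) (rev (x # z # q) @ tl (x # z # q)) (rev (z # q) @ tl (z # q))"
    by (simp add: r_into_equivclp)
  then show ?case using 3 equivclp_trans by fastforce
qed auto

text \<open>Simple connectivity speaks of closed paths. The path \<open>p\<close> followed by the
  reverse of \<open>q\<close> and then by \<open>q\<close> reduces to \<open>q\<close> by
  contracting the loop in front, and to \<open>p\<close> by contracting the back-and-forth along
  \<open>q\<close>.\<close>

lemma homotopic:
  assumes p: "path p" and q: "path q"
    and ends: "hd p = hd q" "last p = last q"
  shows "equivclp (elementary_homotopy K) p q"
proof -
  have ne: "p \<noteq> []" "q \<noteq> []" using p q by auto
  define c where "c = p @ tl (rev q)"
  have "path c"
    unfolding c_def using ends p q by (intro walk_join) (auto simp: walk_rev hd_rev)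
  moreover have "hd c = last c"
    using last_join[of p "rev q"] ne ends unfolding c_def by (simp add: hd_rev last_rev)
  ultimately have "equivclp (elementary_homotopy K) c [hd c]"
    using CAT0 unfolding CAT0_cube_complex_def simply_connected_cc_def by blast
  then have "equivclp (elementary_homotopy K) ([] @ c @ tl q) ([] @ [hd c] @ tl q)"
    by (rule homotopy_context)
  moreover have "hd c = hd q" using ne ends unfolding c_def by simp
  ultimately have 1: "equivclp (elementary_homotopy K) (p @ tl (rev q) @ tl q) q"
    using ne unfolding c_def by simp
  have "equivclp (elementary_homotopy K) (butlast p @ (rev q @ tl q) @ []) (butlast p @ [last q] @ [])"
    by (rule homotopy_context[OF homotopy_rev_self[OF q]])
  moreover have "rev q = last q # tl (rev q)" using ne by (metis hd_rev list.exhaust_sel rev_is_Nil_conv)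
  moreover have "butlast p @ [last q] = p" using ne ends by (metis append_butlast_last_id)
  ultimately have "equivclp (elementary_homotopy K) (p @ tl (rev q) @ tl q) p"
    by (metis append.assoc append_Cons append_Nil append_Nil2)
  then show ?thesis using 1 by (metis equivclp_sym equivclp_trans)
qed

text \<open>This solves the word problem: the normal form is a homotopy invariant, and a reduced
  path is its own normal form up to square moves.\<close>

lemma reduced_unique:
  assumes "path p" "path q" "hd p = hd q" "last p = last q"
    "reduced p" "reduced q"
  shows "p \<approx> q"
  using normal_form_equivclp[OF homotopic[OF assms(1-4)]] normal_form_reduced[OF assms(5)]
    normal_form_reduced[OF assms(6)] sweq_sym sweq_trans by meson

section \<open>Geodesics, the quadrangle condition and parity\<close>

lemma geodesic_reduced:
  assumes p: "path p" "length p = Suc (dst (hd p) (last p))"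
  shows "reduced p"
  unfolding reduced_def
proof (intro allI impI notI)
  fix q assume q: "p \<approx> q" "backtracks q"
  then obtain l u v r where luvr: "q = l @ u # v # u # r" unfolding backtracks_def by blast
  have w: "path q" using q p sweq_walk by blast
  have ends: "hd q = hd p" "last q = last p" "length q = length p"
    using sweq_hd[OF q(1)] sweq_last[OF q(1)] sweq_length[OF q(1)] by auto
  \<comment> \<open>Dropping the backtrack keeps both ends and removes two vertices, which a
    geodesic does not permit.\<close>
  define q' where "q' = l @ u # r"
  have "path q'"
    using w walk_append[of l "u # v # u # r"] walk_append[of l "u # r"]
    unfolding luvr q'_def by (cases "l = []"; cases r) auto
  moreover have "hd q' = hd p" "last q' = last p" "length p = length q' + 2"
    using ends unfolding luvr q'_def by (cases l; auto)+
  ultimately show False using dist_le_walk[of q' "length q' - 1"] p(2) by (auto simp: q'_def)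
qed

text \<open>Prolonging geodesics from \<open>v\<close> and \<open>w\<close> by \<open>z\<close>
  gives two geodesics with common ends. They differ by square moves, and the exchange at
  \<open>z\<close> produces the square.\<close>

lemma quadrangle:
  assumes z: "u \<in> \<Union>K" "edge z v" "edge z w" "v \<noteq> w"
    and d: "dst z u = Suc k" "dst v u = k" "dst w u = k"
  shows "\<exists>a. sq a v z w \<and> Suc (dst a u) = k"
proof -
  have V: "z \<in> \<Union>K" "v \<in> \<Union>K" "w \<in> \<Union>K" using edge_V z by auto
  obtain p where p: "path p" "hd p = v" "last p = u" "length p = Suc k"
    using geodesic_ex[OF V(2) z(1)] d by metis
  obtain q where q: "path q" "hd q = w" "last q = u" "length q = Suc k"
    using geodesic_ex[OF V(3) z(1)] d by metis
  have pz: "path (z # p)" "last (z # p) = u"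
    using p z V by (cases p; auto)+
  have qz: "path (z # q)" "last (z # q) = u"
    using q z V by (cases q; auto)+
  have "reduced (z # p)" "reduced (z # q)"
    using geodesic_reduced[OF pz(1)] geodesic_reduced[OF qz(1)] pz qz p q d by simp_all
  then have "z # p \<approx> z # q" using reduced_unique pz qz by simp
  then obtain a s where a: "sq a v z w" "p \<approx> v # a # s"
    using exchange z(4) p(2) q(2) unfolding exch_def by metis
  have wk: "path (v # a # s)" using a p sweq_walk by blast
  moreover have "last (a # s) = u" "length (v # a # s) = Suc k"
    using sweq_last[OF a(2)] sweq_length[OF a(2)] p by auto
  ultimately have "dst a u \<le> k - 1" "k \<ge> 1" using dist_le_walk[of "a # s" "k - 1"] by auto
  moreover have "dst v u \<le> dst a u + 1" using wk z(1) by (intro dist_step') auto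
  ultimately show ?thesis using a(1) d by (intro exI[of _ a]) auto
qed

lemma homotopy_parity:
  "equivclp (elementary_homotopy K) p q \<Longrightarrow> even (length p) \<longleftrightarrow> even (length q)"
proof (induction rule: equivclp_induct)
  case (step y z)
  have "even (length p) \<longleftrightarrow> even (length q)" if "elementary_homotopy K p q" for p q
    using that by cases auto
  then show ?case using step by blast
qed simp

text \<open>Both homotopy moves preserve the parity of the length. If the distances were equal, a
  geodesic from \<open>v\<close> and a detour through \<open>w\<close> would be homotopic with
  lengths of different parity.\<close>

lemma bipartite:
  assumes e: "edge v w" and u: "u \<in> \<Union>K"
  shows "dst v u \<noteq> dst w u"
proof
  assume eq: "dst v u = dst w u"
  have V: "v \<in> \<Union>K" "w \<in> \<Union>K" using edge_V e by auto
  obtain p where p: "path p" "hd p = v" "last p = u" "length p = Suc (dst v u)"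
    using geodesic_ex[OF V(1) u] by metis
  obtain q where q: "path q" "hd q = w" "last q = u" "length q = Suc (dst v u)"
    using geodesic_ex[OF V(2) u] eq by metis
  have "path (v # q)" "last (v # q) = u" using q e V by (cases q; auto)+
  then have "equivclp (elementary_homotopy K) p (v # q)" using p by (intro homotopic) auto
  then show False using homotopy_parity p q by fastforce
qed

end

section \<open>Halfspaces\<close>

context cat0
begin

text \<open>Distances to the ends of an edge are never equal, so for an edge the sets
  \<open>halfspace u v\<close> and \<open>halfspace v u\<close> are complementary.\<close>

definition halfspace :: "'z \<Rightarrow> 'z \<Rightarrow> 'z set" where
  "halfspace u v = {x \<in> \<Union>K. dst u x < dst v x}"

definition halfspaces :: "'z set set" where
  "halfspaces = {halfspace u v | u v. edge u v}"

definition separating :: "'z \<Rightarrow> 'z \<Rightarrow> 'z set set" where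
  "separating x y = {W \<in> halfspaces. (x \<in> W) \<noteq> (y \<in> W)}"

lemma dist_edge_cases:
  assumes "edge u v" "x \<in> \<Union>K"
  shows "dst u x = Suc (dst v x) \<or> dst v x = Suc (dst u x)"
  using bipartite[OF assms] dist_step'[of u v x] dist_step'[of v u x] assms
  by (auto simp: insert_commute)

text \<open>Otherwise \<open>a\<close> and \<open>c\<close> both lie one step below \<open>b\<close>
  as seen from \<open>x\<close>. The quadrangle condition closes this downwards to a corner still
  nearer to \<open>x\<close>; by uniqueness that corner is \<open>d\<close>, which is
  farther.\<close>

lemma halfspace_square_le:
  assumes s: "sq a b c d" and x: "x \<in> \<Union>K" and lt: "dst a x < dst b x"
  shows "dst d x < dst c x"
proof (rule ccontr)
  assume n: "\<not> dst d x < dst c x"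
  have e: "edge a b" "edge b c" "edge c d" "edge d a"
    and ac: "a \<noteq> c" using s by (auto simp: sq_def)
  obtain k where k: "dst a x = k" "dst b x = Suc k" using dist_edge_cases[OF e(1) x] lt by auto
  have "dst d x = Suc (dst c x)" using dist_edge_cases[OF e(3) x] n by auto
  then have c: "dst c x = k" "dst d x = Suc k"
    using dist_edge_cases[OF e(2) x] dist_edge_cases[OF e(4) x] k by linarith+
  have "edge b a" using e(1) by (simp add: insert_commute)
  then obtain w where w: "sq w a b c" "Suc (dst w x) = k"
    using quadrangle[OF x _ e(2) ac k(2,1) c(1)] by blast
  have "w = d" using sq_unique[OF s sq_rot[OF w(1)]] by simp
  then show False using w c by simp
qed

lemma halfspace_square:
  assumes "sq a b c d"
  shows "halfspace a b = halfspace d c"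
proof -
  have "sq d c b a" by (rule sq_rot[OF sq_flip[OF assms]])
  then have "dst a x < dst b x \<longleftrightarrow> dst d x < dst c x" if "x \<in> \<Union>K" for x
    using halfspace_square_le[OF assms that] halfspace_square_le[OF _ that, of d c b a] by argo
  then show ?thesis unfolding halfspace_def by (intro Collect_cong) (simp only: cong: conj_cong)
qed

text \<open>Induction on the distance from \<open>a\<close> to \<open>u\<close> builds a ladder of
  squares between the two edges, and opposite sides of a square define the same halfspace.\<close>

lemma halfspace_crossing:
  assumes "edge u v" "edge a b" "a \<in> halfspace u v" "b \<notin> halfspace u v"
  shows "halfspace a b = halfspace u v"
  using assms(2-4)
proof (induction "dst a u" arbitrary: a b)
  case 0
  have V: "u \<in> \<Union>K" "v \<in> \<Union>K" "a \<in> \<Union>K" "b \<in> \<Union>K" using edge_V assms 0 by blast+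
  have a: "a = u" using 0 V dist_eq_0[of a u] by simp
  have "dst v b < dst u b"
    using 0(4) dist_edge_cases[OF assms(1) V(4)] V by (auto simp: halfspace_def)
  moreover have "dst u b = 1" using dist_edge 0(2) a by simp
  ultimately have "b = v" using dist_eq_0[of v b] V by simp
  then show ?case using a by simp
next
  case (Suc k)
  have V: "u \<in> \<Union>K" "v \<in> \<Union>K" "a \<in> \<Union>K" "b \<in> \<Union>K" using edge_V assms Suc(3) by blast+
  have au: "dst a u = Suc k" "dst a v = Suc (Suc k)"
    using Suc(2,4) dist_edge_cases[OF assms(1) V(3)] dist_sym V by (auto simp: halfspace_def)
  have "dst u b = Suc (dst v b)"
    using Suc(5) dist_edge_cases[OF assms(1) V(4)] V by (auto simp: halfspace_def)
  then have ub: "dst b u = Suc (dst b v)" using dist_sym V by simp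
  have e': "edge b a" using Suc(3) by (simp add: insert_commute)
  have "dst a v \<le> dst b v + 1" "dst b u \<le> dst a u + 1"
    using dist_step'[OF Suc(3) V(2)] dist_step'[OF e' V(1)] .
  then have bv: "dst b v = Suc k" "dst b u = Suc (Suc k)" using ub au by auto
  \<comment> \<open>The next vertex \<open>b'\<close> is chosen towards \<open>v\<close>, yet it
    also lies one step below \<open>b\<close> as seen from \<open>u\<close>, just like
    \<open>a\<close>. This is the configuration of the quadrangle condition.\<close>
  obtain b' where b': "b' \<in> \<Union>K" "edge b b'" "dst b' v = k"
    using dist_first[OF V(4,2) bv(1)] by blast
  have "dst b' u \<le> dst b' v + dst v u" by (rule dist_triangle[OF b'(1) V(2,1)])
  moreover have "dst v u = 1" using dist_edge[OF assms(1)] dist_sym V by simp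
  moreover have "dst b u \<le> dst b' u + 1" by (rule dist_step'[OF b'(2) V(1)])
  ultimately have b'u: "dst b' u = Suc k" using b'(3) bv(2) by linarith
  have "a \<noteq> b'" using au b' by auto
  then obtain a' where a': "sq a' a b b'" "Suc (dst a' u) = Suc k"
    using quadrangle[OF V(1) e' b'(2)] bv(2) au(1) b'u by blast
  have ea: "edge a' a" "edge a' b'" "a' \<in> \<Union>K"
    using a' edge_V[of a' a] by (auto simp: sq_def insert_commute)
  have "edge a a'" using ea(1) by (simp add: insert_commute)
  then have "dst a v \<le> dst a' v + 1" using V(2) by (rule dist_step')
  then have "a' \<in> halfspace u v" using a'(2) au(2) ea(3) dist_sym V by (auto simp: halfspace_def)
  moreover have "b' \<notin> halfspace u v" using b' b'u dist_sym V by (auto simp: halfspace_def)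
  ultimately have "halfspace a' b' = halfspace u v" using Suc(1)[of a' b'] a'(2) ea(2) by simp
  moreover have "halfspace a b = halfspace a' b'"
    using halfspace_square[OF sq_rot[OF a'(1)]] .
  ultimately show ?case by simp
qed

text \<open>Each wall contributes both of its halfspaces. Which end of the edge lies inside decides
  the orientation in which \<open>halfspace_crossing\<close> applies.\<close>

lemma separating_edge:
  assumes e: "edge x y"
  shows "separating x y \<subseteq> {halfspace x y, halfspace y x}"
proof
  fix W assume W: "W \<in> separating x y"
  then obtain u v where uv: "edge u v" "W = halfspace u v"
    by (auto simp: separating_def halfspaces_def)
  have "edge y x" using e by (simp add: insert_commute)
  then show "W \<in> {halfspace x y, halfspace y x}"
    using halfspace_crossing[OF uv(1) e] halfspace_crossing[OF uv(1), of y x] W uv(2)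
    by (auto simp: separating_def)
qed

lemma finite_separating:
  assumes "x \<in> \<Union>K" "y \<in> \<Union>K"
  shows "finite (separating x y)"
proof (rule finite_by_edges[OF assms])
  show "finite (separating u v)" if "edge u v" for u v
    by (rule finite_subset[OF separating_edge[OF that]]) simp
qed (auto simp: separating_def)

text \<open>Along a geodesic, the halfspace at the first edge contains \<open>x\<close> but neither
  \<open>x'\<close> nor \<open>y\<close>. So it leaves the separating set at the next vertex, while
  no new halfspace enters.\<close>

lemma dist_le_separating:
  assumes "x \<in> \<Union>K" "y \<in> \<Union>K"
  shows "dst x y \<le> card (separating x y)"
  using assms
proof (induction "dst x y" arbitrary: x)
  case (Suc k)
  obtain x' where x': "x' \<in> \<Union>K" "edge x x'" "dst x' y = k"
    using dist_first[OF Suc(3,4) Suc(2)[symmetric]] by blast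
  have e: "dst x x' = 1" "dst x' x = 1" using dist_edge x'(2) by (simp_all add: insert_commute)
  have mem: "x \<in> halfspace x x'" "x' \<notin> halfspace x x'" "y \<notin> halfspace x x'"
    "x \<notin> halfspace x' x" "x' \<in> halfspace x' x" "y \<in> halfspace x' x"
    using Suc(2-4) x' e by (auto simp: halfspace_def)
  have "separating x' y \<subset> separating x y"
  proof
    show "separating x' y \<subseteq> separating x y"
    proof
      fix W assume W: "W \<in> separating x' y"
      then have "W \<noteq> halfspace x x'" "W \<noteq> halfspace x' x" using mem by (auto simp: separating_def)
      then have "W \<notin> separating x x'" using separating_edge[OF x'(2)] by blast
      then show "W \<in> separating x y" using W by (auto simp: separating_def)
    qed
    have "halfspace x x' \<in> halfspaces" using x'(2) by (auto simp: halfspaces_def)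
    then have "halfspace x x' \<in> separating x y" "halfspace x x' \<notin> separating x' y"
      using mem by (auto simp: separating_def)
    then show "separating x' y \<noteq> separating x y" by blast
  qed
  then have "card (separating x' y) < card (separating x y)"
    using finite_separating[OF Suc(3,4)] by (rule psubset_card_mono[rotated])
  moreover have "k \<le> card (separating x' y)" using Suc(1)[of x'] x' Suc(4) by simp
  ultimately show ?case using Suc(2) by linarith
qed simp

end

text \<open>All that is kept of a cube complex. Group elements permute the halfspaces because they
  preserve distances, and metric properness passes to the number of separating halfspaces because
  that number dominates the distance.\<close>

lemma CAT0_imp_halfspaces:
  fixes G (structure)
  assumes "acts_properly_on_CAT0 G K \<psi>"
  shows "\<exists>\<H> z. z \<in> \<Union>K \<and> (\<forall>W\<in>\<H>. W \<subseteq> \<Union>K) \<and>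
    (\<forall>g\<in>carrier G. \<forall>W\<in>\<H>. \<psi> g ` W \<in> \<H>) \<and>
    (\<forall>x\<in>\<Union>K. \<forall>y\<in>\<Union>K. finite {W \<in> \<H>. (x \<in> W) \<noteq> (y \<in> W)}) \<and>
    (\<forall>R. finite {g \<in> carrier G. card {W \<in> \<H>. (z \<in> W) \<noteq> (\<psi> g z \<in> W)} \<le> R})"
proof -
  interpret cat0 K using assms by unfold_locales (simp add: acts_properly_on_CAT0_def)
  have act: "group_action G (\<Union>K) \<psi>" and im: "\<And>g. g \<in> carrier G \<Longrightarrow> (\<lambda>c. \<psi> g ` c) ` K = K"
    using assms by (auto simp: acts_properly_on_CAT0_def acts_on_cube_complex_def)
  interpret A: group_action G "\<Union>K" \<psi> by fact
  have edge: "\<psi> g ` e \<in> cc_edges K" if g: "g \<in> carrier G" and e: "e \<in> cc_edges K" for g e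
  proof -
    have "e \<in> K" "card e = 2" using e by (auto simp: cc_edges_def)
    moreover have "card (\<psi> g ` e) = card e"
      using A.inj_prop[OF g] \<open>e \<in> K\<close> by (intro card_image) (rule inj_on_subset, auto)
    moreover have "\<psi> g ` e \<in> K" using im[OF g] \<open>e \<in> K\<close> by blast
    ultimately show ?thesis by (simp add: cc_edges_def)
  qed
  have le: "dst (\<psi> g x) (\<psi> g y) \<le> dst x y" if "g \<in> carrier G" "x \<in> \<Union>K" "y \<in> \<Union>K" for g x y
    using that A.surj_prop edge by (intro dist_map_le) auto
  have iso: "dst (\<psi> g x) (\<psi> g y) = dst x y" if "g \<in> carrier G" "x \<in> \<Union>K" "y \<in> \<Union>K" for g x y
  proof (rule antisym)
    have "inv g \<in> carrier G" using A.group that by (simp add: group.inv_closed)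
    then have "dst (\<psi> (inv g) (\<psi> g x)) (\<psi> (inv g) (\<psi> g y)) \<le> dst (\<psi> g x) (\<psi> g y)"
      using that A.act_closed by (intro le) auto
    then show "dst x y \<le> dst (\<psi> g x) (\<psi> g y)"
      using A.act_inv[OF that(1,2)] A.act_inv[OF that(1,3)] by simp
  qed (rule le[OF that])
  have half: "\<psi> g ` halfspace u v = halfspace (\<psi> g u) (\<psi> g v)"
    if g: "g \<in> carrier G" and uv: "u \<in> \<Union>K" "v \<in> \<Union>K" for g u v
  proof (intro equalityI subsetI)
    fix x assume "x \<in> \<psi> g ` halfspace u v"
    then obtain y where y: "y \<in> \<Union>K" "x = \<psi> g y" "dst u y < dst v y"
      unfolding halfspace_def by blast
    then show "x \<in> halfspace (\<psi> g u) (\<psi> g v)"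
      unfolding halfspace_def y(2) using iso[OF g uv(1) y(1)] iso[OF g uv(2) y(1)]
      by (intro CollectI conjI A.act_closed[OF g y(1)]) simp
  next
    fix x assume x: "x \<in> halfspace (\<psi> g u) (\<psi> g v)"
    then have "x \<in> \<psi> g ` \<Union>K" using A.surj_prop[OF g] by (simp add: halfspace_def)
    then obtain y where y: "y \<in> \<Union>K" "x = \<psi> g y" by blast
    then have "dst u y < dst v y"
      using x iso[OF g uv(1) y(1)] iso[OF g uv(2) y(1)] by (simp add: halfspace_def)
    then show "x \<in> \<psi> g ` halfspace u v" using y unfolding halfspace_def by blast
  qed
  obtain z where z: "z \<in> \<Union>K"
    and proper: "\<And>R. finite {h \<in> carrier G. dst z (\<psi> h z) \<le> R}"
    using assms unfolding acts_properly_on_CAT0_def metrically_proper_def by blast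
  show ?thesis
  proof (intro exI[of _ halfspaces] exI[of _ z] conjI ballI allI)
    show "z \<in> \<Union>K" by (rule z)
    show "W \<subseteq> \<Union>K" if "W \<in> halfspaces" for W using that by (auto simp: halfspaces_def halfspace_def)
    show "\<psi> g ` W \<in> halfspaces" if g: "g \<in> carrier G" and W: "W \<in> halfspaces" for g W
    proof -
      obtain u v where uv: "{u, v} \<in> cc_edges K" "W = halfspace u v" using W by (auto simp: halfspaces_def)
      have "u \<in> \<Union>K" "v \<in> \<Union>K" using edge_V[OF uv(1)] by simp_all
      then have "\<psi> g ` W = halfspace (\<psi> g u) (\<psi> g v)" unfolding uv(2) by (rule half[OF g])
      moreover have "{\<psi> g u, \<psi> g v} \<in> cc_edges K" using edge[OF g uv(1)] by simp
      ultimately show ?thesis unfolding halfspaces_def by blast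
    qed
    show "finite {W \<in> halfspaces. (x \<in> W) \<noteq> (y \<in> W)}" if "x \<in> \<Union>K" "y \<in> \<Union>K" for x y
      using finite_separating[OF that] by (simp add: separating_def)
    show "finite {g \<in> carrier G. card {W \<in> halfspaces. (z \<in> W) \<noteq> (\<psi> g z \<in> W)} \<le> R}" for R
    proof (rule finite_subset[OF _ proper[of R]])
      have "dst z (\<psi> g z) \<le> card {W \<in> halfspaces. (z \<in> W) \<noteq> (\<psi> g z \<in> W)}" if "g \<in> carrier G" for g
        using dist_le_separating[OF z A.act_closed[OF that z]] by (simp add: separating_def)
      then show "{g \<in> carrier G. card {W \<in> halfspaces. (z \<in> W) \<noteq> (\<psi> g z \<in> W)} \<le> R}
        \<subseteq> {h \<in> carrier G. dst z (\<psi> h z) \<le> R}" by force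
    qed
  qed
qed

section \<open>The cube of finite subsets\<close>

text \<open>The cube with corner \<open>D\<close> and directions \<open>X\<close>: with symmetric
  difference as addition, the coset of \<open>Pow X\<close> through \<open>D\<close>.\<close>

definition face :: "'s set \<Rightarrow> 's set \<Rightarrow> 's set set" where
  "face D X = {B. sym_diff D B \<subseteq> X}"

fun toggle_path :: "'s set \<Rightarrow> 's list \<Rightarrow> 's set list" where
  "toggle_path B [] = [B]"
| "toggle_path B (x # w) = B # toggle_path (sym_diff B {x}) w"

lemma face_base: "B \<in> face D X \<Longrightarrow> face D X = face B X"
  unfolding face_def by blast

lemma face_mono_iff: "face D' X' \<subseteq> face D X \<longleftrightarrow> D' \<in> face D X \<and> X' \<subseteq> X"
proof
  assume sub: "face D' X' \<subseteq> face D X"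
  have D': "D' \<in> face D X" using sub by (auto simp: face_def)
  moreover have "x \<in> X" if "x \<in> X'" for x
  proof -
    have "sym_diff D' {x} \<in> face D' X'" using that by (auto simp: face_def)
    then have "sym_diff D' {x} \<in> face D X" using sub by blast
    then show ?thesis using D' unfolding face_def by blast
  qed
  ultimately show "D' \<in> face D X \<and> X' \<subseteq> X" by blast
next
  assume "D' \<in> face D X \<and> X' \<subseteq> X"
  then show "face D' X' \<subseteq> face D X" unfolding face_def by blast
qed

lemma face_conv_image: "face D X = (\<lambda>Y. sym_diff D Y) ` Pow X"
proof -
  have "B \<in> (\<lambda>Y. sym_diff D Y) ` Pow X" if "sym_diff D B \<subseteq> X" for B
    using that by (intro image_eqI[of _ _ "sym_diff D B"]) auto
  then show ?thesis unfolding face_def by auto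
qed

lemma sym_diff_self: "sym_diff D (sym_diff D Y) = Y"
  by blast

lemma toggle_in_face: "sym_diff D {x} \<in> face D X \<longleftrightarrow> x \<in> X"
  unfolding face_def mem_Collect_eq sym_diff_self by simp

lemma inj_sym_diff: "inj (sym_diff D)"
  by (rule inj_on_inverseI) (rule sym_diff_self)

lemma sym_diff_cancel: "sym_diff D Y = sym_diff D Z \<longleftrightarrow> Y = Z"
  using inj_sym_diff by (rule inj_eq)

text \<open>The injective naming \<open>f\<close> is a parameter so that the vertices can later be
  natural numbers.\<close>

locale finite_subset_cube =
  fixes N :: "'s set" and f :: "'s set \<Rightarrow> 'z"
  assumes inj: "inj_on f (Fpow N)"
begin

definition K where "K = {f ` face D X | D X. D \<in> Fpow N \<and> X \<in> Fpow N}"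

abbreviation path where "path \<equiv> walk (\<Union>K) (cc_edges K)"

lemma face_Fpow: "D \<in> Fpow N \<Longrightarrow> X \<in> Fpow N \<Longrightarrow> face D X \<subseteq> Fpow N"
  unfolding face_conv_image Fpow_def by (auto dest: finite_subset)

lemma f_eq_iff: "A \<in> Fpow N \<Longrightarrow> B \<in> Fpow N \<Longrightarrow> f A = f B \<longleftrightarrow> A = B"
  using inj by (auto dest: inj_onD)

lemma toggle_Fpow: "B \<in> Fpow N \<Longrightarrow> x \<in> N \<Longrightarrow> sym_diff B {x} \<in> Fpow N"
  by (auto simp: Fpow_def)

lemma K_I: "D \<in> Fpow N \<Longrightarrow> X \<in> Fpow N \<Longrightarrow> f ` face D X \<in> K"
  by (auto simp: K_def)

lemma K_E:
  assumes "c \<in> K" "f B \<in> c" "B \<in> Fpow N"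
  obtains X where "X \<in> Fpow N" "c = f ` face B X"
proof -
  obtain D X where DX: "c = f ` face D X" "D \<in> Fpow N" "X \<in> Fpow N"
    using assms by (auto simp: K_def)
  then obtain B' where B': "B' \<in> face D X" "f B' = f B" using assms(2) by auto
  then have "B' = B" using face_Fpow[OF DX(2,3)] assms(3) f_eq_iff by blast
  then have "c = f ` face B X" using DX B' face_base by metis
  then show ?thesis using that DX by blast
qed

lemma verts: "\<Union>K = f ` Fpow N"
proof
  show "\<Union>K \<subseteq> f ` Fpow N" using face_Fpow by (fastforce simp: K_def)
  have "f B \<in> \<Union>K" if "B \<in> Fpow N" for B
  proof
    show "f ` face B {} \<in> K" using K_I[OF that, of "{}"] empty_in_Fpow by blast
    show "f B \<in> f ` face B {}" by (auto simp: face_def)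
  qed
  then show "f ` Fpow N \<subseteq> \<Union>K" by blast
qed

lemma image_face_subset:
  assumes "D \<in> Fpow N" "X \<in> Fpow N" "D' \<in> Fpow N" "X' \<in> Fpow N"
  shows "f ` face D' X' \<subseteq> f ` face D X \<longleftrightarrow> D' \<in> face D X \<and> X' \<subseteq> X"
proof -
  have "f ` A \<subseteq> f ` B \<longleftrightarrow> A \<subseteq> B" if "A \<subseteq> Fpow N" "B \<subseteq> Fpow N" for A B
    using inj_on_image_mem_iff[OF inj] that by blast
  then show ?thesis using face_Fpow[OF assms(1,2)] face_Fpow[OF assms(3,4)] face_mono_iff by simp
qed

lemma card_face: "D \<in> Fpow N \<Longrightarrow> X \<in> Fpow N \<Longrightarrow> card (f ` face D X) = 2 ^ card X"
proof -
  assume DX: "D \<in> Fpow N" "X \<in> Fpow N"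
  have "card (f ` face D X) = card (face D X)"
    by (rule card_image[OF inj_on_subset[OF inj face_Fpow[OF DX]]])
  also have "\<dots> = card (Pow X)"
    unfolding face_conv_image by (rule card_image[OF inj_on_subset[OF inj_sym_diff subset_UNIV]])
  also have "\<dots> = 2 ^ card X" using DX(2) card_Pow[of X] unfolding Fpow_def by blast
  finally show ?thesis .
qed

lemma edge_iff:
  assumes "B \<in> Fpow N" "B' \<in> Fpow N"
  shows "{f B, f B'} \<in> cc_edges K \<longleftrightarrow> (\<exists>x\<in>N. B' = sym_diff B {x})"
proof
  assume "{f B, f B'} \<in> cc_edges K"
  then have e: "{f B, f B'} \<in> K" "card {f B, f B'} = 2" by (simp_all add: cc_edges_def)
  obtain X where X: "X \<in> Fpow N" "{f B, f B'} = f ` face B X"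
    by (rule K_E[OF e(1) insertI1 assms(1)])
  then have "(2::nat) ^ card X = 2 ^ 1" using card_face[OF assms(1) X(1)] e(2) by simp
  then have "card X = 1" by (subst (asm) power_inject_exp) auto
  then obtain x where x: "X = {x}" by (rule card_1_singletonE)
  have "x \<in> N" using x X by (simp add: Fpow_def)
  have "f B' \<in> f ` face B X" using X(2) by blast
  then have "B' \<in> face B X"
    using inj_on_image_mem_iff[OF inj assms(2) face_Fpow[OF assms(1) X(1)]] by blast
  moreover have "face B X = {B, sym_diff B {x}}" by (simp add: x face_conv_image Pow_insert insert_commute)
  moreover have "B \<noteq> B'" using e(2) by auto
  ultimately have "B' = sym_diff B {x}" by blast
  then show "\<exists>x\<in>N. B' = sym_diff B {x}" using \<open>x \<in> N\<close> by blast
next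
  assume "\<exists>x\<in>N. B' = sym_diff B {x}"
  then obtain x where x: "x \<in> N" "B' = sym_diff B {x}" by blast
  have "{x} \<in> Fpow N" using x by (auto simp: Fpow_def)
  moreover have "face B {x} = {B, B'}" by (simp add: x(2) face_conv_image Pow_insert insert_commute)
  ultimately have "{f B, f B'} \<in> K" using K_I[OF assms(1), of "{x}"] by simp
  moreover have "f B \<noteq> f B'" using f_eq_iff[OF assms] x by auto
  ultimately show "{f B, f B'} \<in> cc_edges K" by (simp add: cc_edges_def)
qed

lemma edge_toggle:
  "B \<in> Fpow N \<Longrightarrow> x \<in> N \<Longrightarrow> {f B, f (sym_diff B {x})} \<in> cc_edges K"
  unfolding edge_iff[OF _ toggle_Fpow] by (intro bexI[of _ x] refl)

text \<open>An enumeration \<open>g\<close> of the directions provides coordinates. The interval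
  from \<open>A\<close> to \<open>B\<close> becomes the face whose corner is \<open>D\<close>
  toggled along \<open>A\<close> and whose free directions come from \<open>B - A\<close>.\<close>

lemma chart:
  assumes "D \<in> Fpow N" "X \<in> Fpow N"
  shows "\<exists>n g. cube_chart K (f ` face D X) n g"
proof -
  have finX: "finite X" using assms by (simp add: Fpow_def)
  obtain g where g: "bij_betw g {..<card X} X"
    using finX ex_bij_betw_nat_finite[of X] by (auto simp: atLeast0LessThan)
  have gX: "g ` {..<card X} = X" and injg: "inj_on g {..<card X}"
    using g by (auto simp: bij_betw_def)
  define h where "h S = f (sym_diff D (g ` S))" for S
  have imPow: "(\<lambda>S. g ` S) ` Pow {..<card X} = Pow X"
    using gX image_Pow_surj by blast
  have h_Fpow: "sym_diff D (g ` S) \<in> Fpow N" if "S \<subseteq> {..<card X}" for S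
    using that assms gX finite_subset[OF that] by (auto simp: Fpow_def)
  have "inj_on h (Pow {..<card X})"
  proof (rule inj_onI)
    fix S T assume ST: "S \<in> Pow {..<card X}" "T \<in> Pow {..<card X}" "h S = h T"
    then have "sym_diff D (g ` S) = sym_diff D (g ` T)"
      using f_eq_iff h_Fpow unfolding h_def by auto
    then have "g ` S = g ` T" by (simp only: sym_diff_cancel)
    then show "S = T" using inj_on_image_eq_iff[OF injg] ST by auto
  qed
  moreover have "h ` Pow {..<card X} = f ` face D X"
    unfolding h_def face_conv_image imPow[symmetric] by (simp add: image_image)
  ultimately have bij: "bij_betw h (Pow {..<card X}) (f ` face D X)"
    by (simp add: bij_betw_def)
  have face_img: "h ` {A..B} = f ` face (sym_diff D (g ` A)) (g ` (B - A))"
    if "A \<subseteq> B" "B \<subseteq> {..<card X}" for A B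
  proof -
    have "h ` {A..B} = f ` (\<lambda>S. sym_diff D (g ` S)) ` {A..B}"
      by (simp add: h_def image_image)
    also have "(\<lambda>S. sym_diff D (g ` S)) ` {A..B} = face (sym_diff D (g ` A)) (g ` (B - A))"
    proof (intro equalityI subsetI)
      fix Z assume "Z \<in> (\<lambda>S. sym_diff D (g ` S)) ` {A..B}"
      then obtain S where S: "Z = sym_diff D (g ` S)" "A \<subseteq> S" "S \<subseteq> B" by auto
      have "g ` A \<subseteq> g ` S" "g ` S - g ` A \<subseteq> g ` (B - A)" using S by blast+
      then show "Z \<in> face (sym_diff D (g ` A)) (g ` (B - A))"
        unfolding S(1) face_def by blast
    next
      fix Z assume Z: "Z \<in> face (sym_diff D (g ` A)) (g ` (B - A))"
      define Y where "Y = sym_diff (sym_diff D (g ` A)) Z"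
      have Y: "Y \<subseteq> g ` (B - A)" using Z by (auto simp: face_def Y_def)
      then obtain S where S: "S \<subseteq> B - A" "Y = g ` S" by (auto simp: subset_image_iff)
      have "g ` A \<inter> g ` S = {}"
        using S that injg by (subst inj_on_image_Int[symmetric, of _ "{..<card X}"]) auto
      then have "sym_diff D (g ` (A \<union> S)) = Z" using S unfolding Y_def image_Un by blast
      moreover have "A \<union> S \<in> {A..B}" using S that by auto
      ultimately show "Z \<in> (\<lambda>S. sym_diff D (g ` S)) ` {A..B}" by blast
    qed
    finally show ?thesis .
  qed
  have "{d \<in> K. d \<subseteq> f ` face D X} = (\<lambda>F. h ` F) ` standard_faces (card X)"
  proof (intro equalityI subsetI)
    fix d assume "d \<in> (\<lambda>F. h ` F) ` standard_faces (card X)"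
    then obtain A B where AB: "A \<subseteq> B" "B \<subseteq> {..<card X}" "d = h ` {A..B}"
      by (auto simp: standard_faces_def)
    have "g ` (B - A) \<subseteq> X" "g ` A \<subseteq> X" using AB gX by blast+
    then have B: "g ` (B - A) \<in> Fpow N" "g ` (B - A) \<subseteq> X"
      using assms(2) finite_subset[OF AB(2)] by (simp_all add: Fpow_def subset_trans)
    have A: "sym_diff D (g ` A) \<in> Fpow N" by (rule h_Fpow) (use AB in blast)
    have A': "sym_diff D (g ` A) \<in> face D X"
      unfolding face_def mem_Collect_eq sym_diff_self by fact
    have d: "d = f ` face (sym_diff D (g ` A)) (g ` (B - A))"
      using face_img[OF AB(1,2)] AB(3) by simp
    have "d \<in> K" unfolding d by (rule K_I[OF A B(1)])
    moreover have "d \<subseteq> f ` face D X"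
      unfolding d image_face_subset[OF assms A B(1)] using A' B(2) by blast
    ultimately show "d \<in> {d \<in> K. d \<subseteq> f ` face D X}" by blast
  next
    fix d assume "d \<in> {d \<in> K. d \<subseteq> f ` face D X}"
    then obtain D' X' where d: "d = f ` face D' X'" "D' \<in> Fpow N" "X' \<in> Fpow N"
      "d \<subseteq> f ` face D X" unfolding K_def by blast
    have sub: "sym_diff D D' \<subseteq> X" "X' \<subseteq> X"
      using d(4) unfolding d(1) image_face_subset[OF assms d(2,3)] by (simp_all add: face_def)
    \<comment> \<open>Relative to \<open>D\<close>, a vertex of the face has toggled all of
      \<open>sym_diff D D' - X'\<close> and an arbitrary part of \<open>X'\<close>; these give the
      least and the greatest coordinate set.\<close>
    define A where "A = {i \<in> {..<card X}. g i \<in> sym_diff D D' - X'}"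
    define B where "B = {i \<in> {..<card X}. g i \<in> sym_diff D D' \<union> X'}"
    have AB: "A \<subseteq> B" "B \<subseteq> {..<card X}" by (auto simp: A_def B_def)
    have img: "g ` {i \<in> {..<card X}. g i \<in> Z} = Z" if "Z \<subseteq> X" for Z
    proof -
      have "Z \<subseteq> g ` {..<card X}" using that gX by simp
      then show ?thesis by auto
    qed
    have gA: "g ` A = sym_diff D D' - X'" unfolding A_def by (rule img) (use sub in blast)
    have "B - A = {i \<in> {..<card X}. g i \<in> X'}" by (auto simp: A_def B_def)
    then have gBA: "g ` (B - A) = X'" using img[OF sub(2)] by simp
    have "sym_diff (sym_diff D (sym_diff D D' - X')) D' \<subseteq> X'" by blast
    then have "D' \<in> face (sym_diff D (sym_diff D D' - X')) X'" by (simp add: face_def)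
    then have "face (sym_diff D (g ` A)) (g ` (B - A)) = face D' X'"
      unfolding gA gBA by (rule face_base)
    then have "d = h ` {A..B}" using face_img[OF AB] d by simp
    then show "d \<in> (\<lambda>F. h ` F) ` standard_faces (card X)"
      using AB by (auto simp: standard_faces_def)
  qed
  then show ?thesis using bij unfolding cube_chart_def by blast
qed

lemma cube_complex: "cube_complex K"
  unfolding cube_complex_def
proof (intro conjI ballI)
  fix c assume "c \<in> K"
  then show "\<exists>n g. cube_chart K c n g" using chart by (auto simp: K_def)
next
  fix c d assume cd: "c \<in> K" "d \<in> K"
  show "c \<inter> d = {} \<or> c \<inter> d \<in> K"
  proof (cases "c \<inter> d = {}")
    case False
    then obtain z where z: "z \<in> c" "z \<in> d" by auto
    then have "z \<in> f ` Fpow N" using cd verts by auto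
    then obtain B where "B \<in> Fpow N" "z = f B" by auto
    with z have B: "B \<in> Fpow N" "f B \<in> c" "f B \<in> d" by simp_all
    obtain X where X: "X \<in> Fpow N" "c = f ` face B X" by (rule K_E[OF cd(1) B(2,1)])
    obtain Y where Y: "Y \<in> Fpow N" "d = f ` face B Y" by (rule K_E[OF cd(2) B(3,1)])
    have "c \<inter> d = f ` (face B X \<inter> face B Y)"
      unfolding X(2) Y(2) using inj_on_image_Int[OF inj face_Fpow face_Fpow] B X(1) Y(1) by simp
    also have "face B X \<inter> face B Y = face B (X \<inter> Y)" by (auto simp: face_def)
    finally show ?thesis using K_I[OF B(1), of "X \<inter> Y"] X Y by (auto simp: Fpow_def)
  qed simp
qed

text \<open>Neighbours of \<open>f B\<close> correspond to directions in \<open>N\<close>, and every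
  finite set of directions spans a cube at \<open>f B\<close>. The link is thus a full simplex,
  possibly of infinite dimension.\<close>

lemma link:
  assumes "B \<in> Fpow N"
  shows "link K (f B) = {(\<lambda>x. f (sym_diff B {x})) ` X | X. X \<in> Fpow N}"
proof -
  have nb: "{w \<in> f ` face B X. {f B, w} \<in> cc_edges K} = (\<lambda>x. f (sym_diff B {x})) ` X"
    if X: "X \<in> Fpow N" for X
  proof (intro equalityI subsetI)
    fix w assume "w \<in> {w \<in> f ` face B X. {f B, w} \<in> cc_edges K}"
    then have w: "w \<in> f ` face B X" "{f B, w} \<in> cc_edges K" by simp_all
    obtain Z where Z: "w = f Z" "Z \<in> face B X" by (rule imageE[OF w(1)])
    have "Z \<in> Fpow N" using face_Fpow[OF assms X] Z(2) by (rule subsetD)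
    then obtain x where x: "x \<in> N" "Z = sym_diff B {x}"
      using w(2) unfolding Z(1) by (auto simp only: edge_iff[OF assms])
    then have "x \<in> X" using Z(2) by (simp only: toggle_in_face)
    then show "w \<in> (\<lambda>x. f (sym_diff B {x})) ` X" unfolding Z(1) x(2) by (rule imageI)
  next
    fix w assume "w \<in> (\<lambda>x. f (sym_diff B {x})) ` X"
    then obtain x where x: "x \<in> X" "w = f (sym_diff B {x})" by blast
    then have "x \<in> N" using X by (auto simp: Fpow_def)
    then have "{f B, w} \<in> cc_edges K"
      unfolding x(2) edge_iff[OF assms toggle_Fpow[OF assms \<open>x \<in> N\<close>]] by (intro bexI[of _ x] refl)
    moreover have "w \<in> f ` face B X" unfolding x(2) by (rule imageI) (simp only: toggle_in_face x(1))
    ultimately show "w \<in> {w \<in> f ` face B X. {f B, w} \<in> cc_edges K}" by simp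
  qed
  show ?thesis
  proof (intro equalityI subsetI)
    fix s assume "s \<in> link K (f B)"
    then obtain c where c: "c \<in> K" "f B \<in> c" "s = {w \<in> c. {f B, w} \<in> cc_edges K}"
      by (auto simp: link_def)
    obtain X where X: "X \<in> Fpow N" "c = f ` face B X" by (rule K_E[OF c(1,2) assms])
    have "s = (\<lambda>x. f (sym_diff B {x})) ` X" unfolding c(3) X(2) by (rule nb[OF X(1)])
    then show "s \<in> {(\<lambda>x. f (sym_diff B {x})) ` X | X. X \<in> Fpow N}" using X(1) by blast
  next
    fix s assume "s \<in> {(\<lambda>x. f (sym_diff B {x})) ` X | X. X \<in> Fpow N}"
    then obtain X where X: "X \<in> Fpow N" "s = (\<lambda>x. f (sym_diff B {x})) ` X" by blast
    have "f B \<in> f ` face B X" by (auto simp: face_def)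
    then show "s \<in> link K (f B)" unfolding X(2) nb[OF X(1), symmetric] link_def
      by (intro CollectI exI[of _ "f ` face B X"] conjI refl K_I[OF assms X(1)])
  qed
qed

lemma flag_link:
  assumes "B \<in> Fpow N"
  shows "flag (link K (f B))"
  unfolding flag_def
proof (intro allI impI)
  fix A assume A: "finite A \<and> A \<noteq> {} \<and> (\<forall>a\<in>A. \<forall>b\<in>A. {a, b} \<in> link K (f B))"
  let ?t = "\<lambda>x. f (sym_diff B {x})"
  have "a \<in> ?t ` N" if "a \<in> A" for a
  proof -
    have "{a, a} \<in> link K (f B)" using A that by blast
    then have "{a} \<in> link K (f B)" by simp
    then obtain X where X: "X \<in> Fpow N" "{a} = ?t ` X"
      unfolding link[OF assms] by (elim CollectE exE conjE)
    then have "X \<subseteq> N" by (simp add: Fpow_def)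
    then show ?thesis using X(2) by blast
  qed
  then have "A \<subseteq> ?t ` N" by blast
  with A obtain X where X: "X \<subseteq> N" "finite X" "A = ?t ` X"
    using finite_subset_image[of A ?t N] by (elim conjE) metis
  then have "X \<in> Fpow N" by (simp add: Fpow_def)
  then show "A \<in> link K (f B)" unfolding link[OF assms] X(3)
    by (intro CollectI exI[of _ X] conjI refl)
qed

section \<open>Paths in the cube as words of toggles\<close>

lemma toggle_path_Cons: "\<exists>q. toggle_path B w = B # q"
  by (cases w) auto

lemma last_toggle_path: "last (toggle_path B w) = sym_diff B {x. odd (count_list w x)}"
proof (induction w arbitrary: B)
  case (Cons y w)
  have "toggle_path (sym_diff B {y}) w \<noteq> []" using toggle_path_Cons by (metis list.distinct(1))
  then show ?case using Cons by (auto split: if_splits)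
qed simp

lemma walk_toggle_path:
  "B \<in> Fpow N \<Longrightarrow> set w \<subseteq> N \<Longrightarrow> path (map f (toggle_path B w))"
proof (induction w arbitrary: B)
  case Nil
  then show ?case using verts by auto
next
  case (Cons x w)
  obtain q where q: "toggle_path (sym_diff B {x}) w = sym_diff B {x} # q"
    using toggle_path_Cons by blast
  have "path (map f (toggle_path (sym_diff B {x}) w))"
    using Cons toggle_Fpow by simp
  moreover have "{f B, f (sym_diff B {x})} \<in> cc_edges K"
    using edge_iff[OF Cons(2) toggle_Fpow[OF Cons(2)]] Cons by auto
  ultimately show ?case using q Cons verts by auto
qed

lemma walk_is_toggle_path:
  "path p \<Longrightarrow>
    \<exists>B w. B \<in> Fpow N \<and> set w \<subseteq> N \<and> p = map f (toggle_path B w)"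
proof (induction p rule: induct_list012)
  case (2 v)
  then obtain B where "B \<in> Fpow N" "v = f B" using verts by auto
  then show ?case by (intro exI[of _ B] exI[of _ "[]"]) simp
next
  case (3 u v p)
  then obtain B w where Bw: "B \<in> Fpow N" "set w \<subseteq> N" "v # p = map f (toggle_path B w)"
    by auto
  then have v: "v = f B" using toggle_path_Cons[of B w] by auto
  obtain A where A: "A \<in> Fpow N" "u = f A" using 3 verts by auto
  then obtain x where x: "x \<in> N" "B = sym_diff A {x}" using edge_iff[OF A(1) Bw(1)] v 3 by auto
  show ?case using A x Bw by (intro exI[of _ A] exI[of _ "x # w"]) simp
qed simp

text \<open>The first \<open>x\<close> moves to the right, crossing one square for each letter of
  \<open>u\<close>, until it meets the second \<open>x\<close> and both vanish as a
  backtrack.\<close>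

lemma slide:
  assumes "B \<in> Fpow N" "x \<in> N" "set u \<subseteq> N" "x \<notin> set u"
  shows "equivclp (elementary_homotopy K)
    (map f (toggle_path B (x # u @ x # v))) (map f (toggle_path B (u @ v)))"
  using assms
proof (induction u arbitrary: B)
  case Nil
  obtain q where q: "toggle_path B v = B # q" using toggle_path_Cons by blast
  have "sym_diff (sym_diff B {x}) {x} = B" by blast
  then have "map f (toggle_path B (x # [] @ x # v)) = [] @ [f B, f (sym_diff B {x}), f B] @ map f q"
    using q by simp
  moreover have "{f B, f (sym_diff B {x})} \<in> cc_edges K"
    using edge_iff[OF Nil(1) toggle_Fpow[OF Nil(1)]] Nil by auto
  ultimately show ?case
    using elementary_homotopy.backtrack[of "f B" "f (sym_diff B {x})" K "[]" "map f q"] q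
    by (simp add: r_into_equivclp)
next
  case (Cons y u)
  let ?a = "B" and ?b = "sym_diff B {x}" and ?d = "sym_diff B {y}"
  let ?c = "sym_diff ?b {y}"
  have xy: "x \<noteq> y" "y \<in> N" "B \<in> Fpow N" "x \<in> N" using Cons.prems by auto
  have swap: "sym_diff ?d {x} = ?c" by blast
  obtain q where q: "toggle_path ?c (u @ x # v) = ?c # q" using toggle_path_Cons by blast
  have F: "?b \<in> Fpow N" "?d \<in> Fpow N" "?c \<in> Fpow N" by (intro toggle_Fpow xy)+
  have "{f ?d, f ?c} \<in> cc_edges K" using edge_toggle[OF F(2) xy(4)] unfolding swap .
  then have e: "{f ?a, f ?b} \<in> cc_edges K" "{f ?b, f ?c} \<in> cc_edges K"
    "{f ?c, f ?d} \<in> cc_edges K" "{f ?d, f ?a} \<in> cc_edges K"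
    using edge_toggle[OF xy(3,4)] edge_toggle[OF F(1) xy(2)] edge_toggle[OF xy(3,2)]
    by (simp_all only: insert_commute)
  have "?a \<noteq> ?b" "?a \<noteq> ?c" "?a \<noteq> ?d" "?b \<noteq> ?c" "?b \<noteq> ?d" "?c \<noteq> ?d"
    using xy(1) by blast+
  then have dist: "distinct [f ?a, f ?b, f ?c, f ?d]"
    by (simp only: distinct.simps list.set insert_iff empty_iff f_eq_iff xy(3) F simp_thms)
  have "Pow {x, y} = {{}, {x}, {x, y}, {y}}" by auto
  moreover have "sym_diff B {x, y} = ?c" using xy(1) by blast
  moreover have "sym_diff B {} = B" by simp
  ultimately have "face B {x, y} = {?a, ?b, ?c, ?d}"
    by (simp only: face_conv_image image_insert image_empty)
  then have sq: "{f ?a, f ?b, f ?c, f ?d} \<in> K"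
    using K_I[OF xy(3), of "{x, y}"] xy(2,4) by (simp add: Fpow_def)
  have "elementary_homotopy K ([] @ [f ?a, f ?b, f ?c] @ map f q) ([] @ [f ?a, f ?d, f ?c] @ map f q)"
    by (rule elementary_homotopy.square[OF dist sq e])
  then have "equivclp (elementary_homotopy K) (map f (toggle_path B (x # (y # u) @ x # v)))
     (f B # map f (toggle_path ?d (x # u @ x # v)))"
    using q swap by (simp add: r_into_equivclp)
  moreover have "equivclp (elementary_homotopy K) (f B # map f (toggle_path ?d (x # u @ x # v)))
     (f B # map f (toggle_path ?d (u @ v)))"
    using Cons.prems by (intro homotopy_context[where l = "[f B]" and r = "[]", simplified] Cons.IH F) simp_all
  ultimately show ?case by (metis append_Cons equivclp_trans list.simps(9) toggle_path.simps(2))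
qed

text \<open>Even counts express that the path is closed. The first letter therefore recurs, and
  sliding it to its next occurrence removes both.\<close>

lemma closed_path_contractible:
  "B \<in> Fpow N \<Longrightarrow> set w \<subseteq> N \<Longrightarrow> \<forall>x. even (count_list w x) \<Longrightarrow>
    equivclp (elementary_homotopy K) (map f (toggle_path B w)) [f B]"
proof (induction "length w" arbitrary: w rule: less_induct)
  case less
  show ?case
  proof (cases w)
    case (Cons x w')
    have "even (count_list w x)" using less by blast
    then have "x \<in> set w'" using Cons by (cases "x \<in> set w'") auto
    then obtain u v where uv: "w' = u @ x # v" "x \<notin> set u" by (meson split_list_first)
    have "even (count_list (u @ v) y)" for y
      using less(4)[rule_format, of y] Cons uv by (auto split: if_splits)
    then have "equivclp (elementary_homotopy K) (map f (toggle_path B (u @ v))) [f B]"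
      using less Cons uv by (intro less(1)) auto
    moreover have "equivclp (elementary_homotopy K)
        (map f (toggle_path B (x # u @ x # v))) (map f (toggle_path B (u @ v)))"
      using less Cons uv by (intro slide) auto
    ultimately show ?thesis using Cons uv by (metis equivclp_trans)
  qed simp
qed

lemma connected: "connected_graph (\<Union>K) (cc_edges K)"
proof -
  have "joined (\<Union>K) (cc_edges K) (f A) (f B)" if AB: "A \<in> Fpow N" "B \<in> Fpow N" for A B
  proof -
    have "finite (sym_diff A B)" using AB by (auto simp: Fpow_def)
    then have "\<exists>w. set w = sym_diff A B \<and> distinct w" by (rule finite_distinct_list)
    then obtain w where w: "set w = sym_diff A B" "distinct w" by (elim exE conjE)
    have "count_list w x = (if x \<in> set w then 1 else 0)" for x
      using w(2) by (induction w) auto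
    then have "{x. odd (count_list w x)} = set w" by auto
    then have last: "last (toggle_path A w) = B"
      unfolding last_toggle_path w(1) by (simp only: sym_diff_self)
    have "set w \<subseteq> N" unfolding w(1) using AB by (auto simp: Fpow_def)
    then have walk: "path (map f (toggle_path A w))"
      using walk_toggle_path[OF AB(1)] by blast
    obtain q where "toggle_path A w = A # q" using toggle_path_Cons by blast
    then show ?thesis using walk last
      unfolding joined_def by (intro exI[of _ "map f (toggle_path A w)"]) (auto simp: last_map)
  qed
  moreover have "\<Union>K \<noteq> {}" using verts empty_in_Fpow by blast
  moreover have "simple_graph (\<Union>K) (cc_edges K)"
    by (auto simp: simple_graph_def cc_edges_def)
  ultimately show ?thesis using verts by (auto simp: connected_graph_def)
qed

lemma odd_Fpow:
  assumes "B \<in> Fpow N" "set w \<subseteq> N"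
  shows "sym_diff B {x. odd (count_list w x)} \<in> Fpow N"
proof -
  have sub: "{x. odd (count_list w x)} \<subseteq> set w"
    using count_notin[of _ w] odd_pos by fastforce
  then have "finite {x. odd (count_list w x)}" by (rule finite_subset) simp
  then show ?thesis using sub assms by (auto simp: Fpow_def)
qed

lemma CAT0: "CAT0_cube_complex K"
  unfolding CAT0_cube_complex_def simply_connected_cc_def
proof (intro conjI allI impI)
  fix p assume p: "path p \<and> hd p = last p"
  then obtain B w where Bw: "B \<in> Fpow N" "set w \<subseteq> N" "p = map f (toggle_path B w)"
    using walk_is_toggle_path by blast
  obtain q where q: "toggle_path B w = B # q" using toggle_path_Cons by blast
  have "f (last (toggle_path B w)) = f B" using p Bw q by (simp add: last_map split: if_splits)
  then have "sym_diff B {x. odd (count_list w x)} = B"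
    unfolding last_toggle_path using f_eq_iff[OF odd_Fpow[OF Bw(1,2)] Bw(1)] by blast
  then have "\<forall>x. even (count_list w x)" by blast
  then show "equivclp (elementary_homotopy K) p [hd p]"
    using closed_path_contractible[OF Bw(1,2)] Bw(3) q by simp
next
  show "\<forall>v\<in>\<Union>K. flag (link K v)" using flag_link verts by auto
qed (rule cube_complex connected)+

text \<open>An edge toggles a single element, so a path needs at least one edge for every element in
  which its ends differ.\<close>

lemma card_sym_diff_le_dist:
  assumes "A \<in> Fpow N" "B \<in> Fpow N"
  shows "card (sym_diff A B) \<le> graph_dist (\<Union>K) (cc_edges K) (f A) (f B)"
proof -
  interpret conn_graph "\<Union>K" "cc_edges K" by unfold_locales (rule connected)
  obtain p where p: "path p" "hd p = f A" "last p = f B"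
    "length p = Suc (dst (f A) (f B))"
    using geodesic_ex[of "f A" "f B"] assms verts by blast
  obtain C w where C: "C \<in> Fpow N" "set w \<subseteq> N" "p = map f (toggle_path C w)"
    using walk_is_toggle_path p(1) by blast
  obtain q where q: "toggle_path C w = C # q" using toggle_path_Cons by blast
  have "C = A" using p(2) C q f_eq_iff assms by auto
  have sub: "{x. odd (count_list w x)} \<subseteq> set w"
    using count_notin[of _ w] odd_pos by fastforce
  have "f (last (toggle_path A w)) = f B"
    using p(3) C(3) q \<open>C = A\<close> by (metis last_map list.distinct(1))
  then have "sym_diff A {x. odd (count_list w x)} = B"
    unfolding last_toggle_path using f_eq_iff[OF odd_Fpow[OF assms(1) C(2)] assms(2)] by blast
  then have "sym_diff A B = {x. odd (count_list w x)}" by blast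
  then have "card (sym_diff A B) \<le> card (set w)" using sub by (simp add: card_mono)
  also have "\<dots> \<le> length w" by (rule card_length)
  also have "length w = dst (f A) (f B)"
  proof -
    have "length (toggle_path B w) = Suc (length w)" for B by (induction w arbitrary: B) auto
    then show ?thesis using p(4) C by simp
  qed
  finally show ?thesis .
qed

end

section \<open>Affine actions over the field with two elements\<close>

context finite_subset_cube
begin

text \<open>With symmetric difference as addition, \<open>T g\<close> is the affine map with linear
  part \<open>t g\<close> and translation \<open>b g\<close>; the cocycle identity makes
  \<open>T\<close> multiplicative. The empty set is moved to \<open>b g\<close>, so its displacement
  is at least the size of \<open>b g\<close>.\<close>

lemma affine_action:
  fixes G :: "('g, 'm) monoid_scheme" (structure)
  assumes "group G"
    and cl: "\<And>g s. g \<in> carrier G \<Longrightarrow> s \<in> N \<Longrightarrow> t g s \<in> N"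
    and one: "\<And>s. s \<in> N \<Longrightarrow> t \<one> s = s"
    and mult: "\<And>g h s. g \<in> carrier G \<Longrightarrow> h \<in> carrier G \<Longrightarrow> s \<in> N \<Longrightarrow> t (g \<otimes> h) s = t g (t h s)"
    and b: "\<And>g. g \<in> carrier G \<Longrightarrow> b g \<in> Fpow N"
    and cocycle: "\<And>g h. g \<in> carrier G \<Longrightarrow> h \<in> carrier G \<Longrightarrow>
      b (g \<otimes> h) = sym_diff (t g ` b h) (b g)"
    and proper: "\<And>R. finite {g \<in> carrier G. card (b g) \<le> R}"
  shows "\<exists>\<psi>. acts_properly_on_CAT0 G K \<psi>"
proof -
  interpret group G by fact
  define T where "T g D = sym_diff (t g ` D) (b g)" for g D
  define a where "a g z = f (T g (inv_into (Fpow N) f z))" for g z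
  define \<psi> where "\<psi> g = restrict (a g) (f ` Fpow N)" for g
  have t_Fpow: "t g ` D \<in> Fpow N" if "g \<in> carrier G" "D \<in> Fpow N" for g D
    using that cl by (auto simp: Fpow_def)
  have T_Fpow: "T g D \<in> Fpow N" if "g \<in> carrier G" "D \<in> Fpow N" for g D
    using t_Fpow[OF that] b[OF that(1)] unfolding T_def by (auto simp: Fpow_def)
  have inj_t: "inj_on (t g) N" if "g \<in> carrier G" for g
  proof (rule inj_on_inverseI)
    show "t (inv g) (t g s) = s" if "s \<in> N" for s
      using mult[of "inv g" g s] one that \<open>g \<in> carrier G\<close> by simp
  qed
  have t_sd: "t g ` sym_diff D D' = sym_diff (t g ` D) (t g ` D')"
    if "g \<in> carrier G" "D \<in> Fpow N" "D' \<in> Fpow N" for g D D'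
  proof -
    have "D \<subseteq> N" "D' \<subseteq> N" using that by (auto simp: Fpow_def)
    then show ?thesis
      using inj_on_image_set_diff[OF inj_t[OF that(1)], of D D']
        inj_on_image_set_diff[OF inj_t[OF that(1)], of D' D]
      by (simp add: image_Un Diff_subset subset_trans[OF Diff_subset])
  qed
  have t_comp: "t (g \<otimes> h) ` D = t g ` t h ` D"
    if "g \<in> carrier G" "h \<in> carrier G" "D \<in> Fpow N" for g h D
    using mult[OF that(1,2)] that(3) unfolding image_image Fpow_def by (intro image_cong refl) auto
  have T_mult: "T (g \<otimes> h) D = T g (T h D)"
    if "g \<in> carrier G" "h \<in> carrier G" "D \<in> Fpow N" for g h D
    unfolding T_def t_sd[OF that(1) t_Fpow[OF that(2,3)] b[OF that(2)]]
      cocycle[OF that(1,2)] t_comp[OF that] by blast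
  have t_one: "t \<one> ` D = D" if "D \<in> Fpow N" for D
    using that one by (force simp: Fpow_def)
  have b_one: "b \<one> = {}"
    using cocycle[of "\<one>" "\<one>"] t_one[OF b] by simp
  have T_one: "T \<one> D = D" if "D \<in> Fpow N" for D
    unfolding T_def b_one t_one[OF that] by simp
  have a_f: "a g (f D) = f (T g D)" if "D \<in> Fpow N" for g D
    unfolding a_def using inv_into_f_f[OF inj that] by simp
  have act: "group_action G (f ` Fpow N) \<psi>"
    unfolding \<psi>_def
    by (rule group_action_restrictI) (auto simp: a_f T_Fpow T_one T_mult group_axioms)
  then interpret A: group_action G "f ` Fpow N" \<psi> .
  have \<psi>_f: "\<psi> g (f D) = f (T g D)" if "D \<in> Fpow N" for g D
    using that a_f unfolding \<psi>_def by simp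
  have \<psi>_face: "\<psi> g ` f ` face D X = f ` face (T g D) (t g ` X)"
    if "g \<in> carrier G" "D \<in> Fpow N" "X \<in> Fpow N" for g D X
  proof -
    have "\<psi> g ` f ` face D X = f ` T g ` face D X"
      unfolding image_image using \<psi>_f face_Fpow[OF that(2,3)] by (intro image_cong refl) auto
    also have "T g ` face D X = (\<lambda>Y. sym_diff (T g D) (t g ` Y)) ` Pow X"
      unfolding face_conv_image image_image
    proof (rule image_cong[OF refl])
      fix Y assume "Y \<in> Pow X"
      then have "Y \<in> Fpow N" using that(3) by (auto simp: Fpow_def intro: finite_subset)
      then show "T g (sym_diff D Y) = sym_diff (T g D) (t g ` Y)"
        unfolding T_def t_sd[OF that(1,2) \<open>Y \<in> Fpow N\<close>] by blast
    qed
    also have "\<dots> = sym_diff (T g D) ` (\<lambda>Y. t g ` Y) ` Pow X" by (simp only: image_image)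
    also have "(\<lambda>Y. t g ` Y) ` Pow X = Pow (t g ` X)" by (rule image_Pow_surj) simp
    finally show ?thesis by (simp only: face_conv_image)
  qed
  have sub: "(\<lambda>c. \<psi> g ` c) ` K \<subseteq> K" if "g \<in> carrier G" for g
  proof
    fix c assume "c \<in> (\<lambda>c. \<psi> g ` c) ` K"
    then obtain D X where "c = \<psi> g ` f ` face D X" "D \<in> Fpow N" "X \<in> Fpow N"
      by (auto simp: K_def)
    then show "c \<in> K" using \<psi>_face that K_I[OF T_Fpow t_Fpow] by simp
  qed
  have "(\<lambda>c. \<psi> g ` c) ` K = K" if "g \<in> carrier G" for g
  proof
    show "K \<subseteq> (\<lambda>c. \<psi> g ` c) ` K"
    proof
      fix c assume "c \<in> K"
      then have "\<psi> (inv g) ` c \<in> K" using sub[of "inv g"] that by blast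
      moreover have "c \<subseteq> f ` Fpow N" using \<open>c \<in> K\<close> verts by blast
      ultimately show "c \<in> (\<lambda>c. \<psi> g ` c) ` K"
        using A.act_image_inv'[OF that] by (metis imageI)
    qed
  qed (rule sub[OF that])
  then have acts: "acts_on_cube_complex G K \<psi>"
    unfolding acts_on_cube_complex_def verts using act by blast
  have "metrically_proper G K \<psi>"
    unfolding metrically_proper_def
  proof (intro bexI allI)
    show "f {} \<in> \<Union>K" unfolding verts using empty_in_Fpow by (rule imageI)
    fix R
    have "card (b g) \<le> R"
      if "g \<in> carrier G" "graph_dist (\<Union>K) (cc_edges K) (f {}) (\<psi> g (f {})) \<le> R" for g
      using card_sym_diff_le_dist[OF empty_in_Fpow b[OF that(1)]] that(2)
      by (simp add: \<psi>_f empty_in_Fpow T_def)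
    then show "finite {h \<in> carrier G. graph_dist (\<Union>K) (cc_edges K) (f {}) (\<psi> h (f {})) \<le> R}"
      by (intro finite_subset[OF _ proper[of R]]) auto
  qed
  then show ?thesis using CAT0 acts unfolding acts_properly_on_CAT0_def by blast
qed

end

section \<open>Weighted systems of cuts\<close>

text \<open>A subset of weight \<open>n P\<close> enters as \<open>n P\<close> labelled copies, so
  cardinalities of these sets are total weights.\<close>

definition cuts :: "('x set \<Rightarrow> nat) \<Rightarrow> 'x set \<Rightarrow> 'x \<Rightarrow> 'x \<Rightarrow> ('x set \<times> nat) set" where
  "cuts n X x y = {(P, i). P \<subseteq> X \<and> i < n P \<and> (x \<in> P) \<noteq> (y \<in> P)}"

text \<open>Lying on different sides of a cut is additive modulo two; this is the source of the
  cocycle.\<close>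

lemma cuts_sym_diff: "sym_diff (cuts n X x y) (cuts n X y z) = cuts n X x z"
  unfolding cuts_def by auto

theorem proper_cuts_imp_CAT0:
  fixes G :: "('g, 'm) monoid_scheme" (structure)
  assumes act: "group_action G X \<alpha>"
    and inv: "\<And>g P. g \<in> carrier G \<Longrightarrow> P \<subseteq> X \<Longrightarrow> n (\<alpha> g ` P) = n P"
    and fin: "\<And>x y. x \<in> X \<Longrightarrow> y \<in> X \<Longrightarrow> finite (cuts n X x y)"
    and x0: "x0 \<in> X"
    and proper: "\<And>R. finite {g \<in> carrier G. card (cuts n X x0 (\<alpha> g x0)) \<le> R}"
  shows "\<exists>(K :: nat set set) \<psi>. acts_properly_on_CAT0 G K \<psi>"
proof -
  interpret group_action G X \<alpha> by fact
  define t where "t g = map_prod (\<lambda>P. \<alpha> g ` P) (id :: nat \<Rightarrow> nat)" for g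
  define b where "b g = cuts n X x0 (\<alpha> g x0)" for g
  \<comment> \<open>The cuts between two points of the orbit of \<open>x0\<close>: they contain all
    values of the cocycle, are permuted by the group, and are countable once the group is.\<close>
  define N where "N = (\<Union>g\<in>carrier G. \<Union>h\<in>carrier G. cuts n X (\<alpha> g x0) (\<alpha> h x0))"
  have t_cuts: "t g ` cuts n X x y = cuts n X (\<alpha> g x) (\<alpha> g y)"
    if g: "g \<in> carrier G" and xy: "x \<in> X" "y \<in> X" for g x y
  proof -
    have sub: "t g ` cuts n X x y \<subseteq> cuts n X (\<alpha> g x) (\<alpha> g y)"
      if g: "g \<in> carrier G" and xy: "x \<in> X" "y \<in> X" for g x y
      using act_image_mem[OF g] inv[OF g] act_closed[OF g] xy
      unfolding t_def cuts_def by auto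
    have g': "inv g \<in> carrier G" using g group by (simp add: group.inv_closed)
    have "s \<in> t g ` cuts n X x y" if s: "s \<in> cuts n X (\<alpha> g x) (\<alpha> g y)" for s
    proof -
      have "t (inv g) s \<in> cuts n X x y"
        using sub[OF g' act_closed[OF g xy(1)] act_closed[OF g xy(2)]] s
        unfolding act_inv[OF g xy(1)] act_inv[OF g xy(2)] by blast
      moreover have "t g (t (inv g) s) = s"
        using act_image_inv'[OF g] s unfolding t_def cuts_def by auto
      ultimately show ?thesis by (metis imageI)
    qed
    then show ?thesis using sub[OF g xy] by blast
  qed
  have N_sub: "P \<subseteq> X" if "(P, i) \<in> N" for P i
    using that unfolding N_def cuts_def by auto
  \<comment> \<open>Properness exhibits the group as a countable union of finite sets, which makes
    natural numbers available as names.\<close>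
  have eq: "carrier G = (\<Union>R. {g \<in> carrier G. card (cuts n X x0 (\<alpha> g x0)) \<le> R})" by auto
  have "countable (\<Union>R. {g \<in> carrier G. card (cuts n X x0 (\<alpha> g x0)) \<le> R})"
    by (rule countable_UN[OF countableI_type countable_finite[OF proper]])
  then have "countable (carrier G)" unfolding eq[symmetric] .
  then have "countable N"
    unfolding N_def by (intro countable_UN) (simp_all add: countable_finite fin x0 act_closed)
  then have "inj_on (to_nat_on (Fpow N)) (Fpow N)"
    by (intro inj_on_to_nat_on countable_Fpow)
  then interpret finite_subset_cube N "to_nat_on (Fpow N)" by unfold_locales
  have "\<exists>\<psi>. acts_properly_on_CAT0 G K \<psi>"
  proof (rule affine_action[of G t b])
    show "group G" by (rule group)
  next
    fix g s assume g: "g \<in> carrier G" and "s \<in> N"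
    then obtain h k where hk: "h \<in> carrier G" "k \<in> carrier G" "s \<in> cuts n X (\<alpha> h x0) (\<alpha> k x0)"
      by (auto simp: N_def)
    then have "t g s \<in> cuts n X (\<alpha> g (\<alpha> h x0)) (\<alpha> g (\<alpha> k x0))"
      using t_cuts[OF g act_closed act_closed] x0 by blast
    then have "t g s \<in> cuts n X (\<alpha> (g \<otimes> h) x0) (\<alpha> (g \<otimes> k) x0)"
      using composition_rule[OF x0 g] hk by simp
    moreover have "g \<otimes> h \<in> carrier G" "g \<otimes> k \<in> carrier G"
      using group g hk by (simp_all add: group.is_monoid monoid.m_closed)
    ultimately show "t g s \<in> N" unfolding N_def by blast
  next
    fix s assume "s \<in> N"
    then show "t \<one> s = s" using N_sub act_image_one unfolding t_def by (cases s) auto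
  next
    fix g h s assume "g \<in> carrier G" "h \<in> carrier G" "s \<in> N"
    then show "t (g \<otimes> h) s = t g (t h s)"
      using N_sub act_image_comp unfolding t_def by (cases s) auto
  next
    fix g assume g: "g \<in> carrier G"
    have "\<one> \<in> carrier G" using group by (simp add: group.is_monoid)
    then have "b g \<subseteq> N" using g act_one[OF x0] unfolding b_def N_def by force
    then show "b g \<in> Fpow N" using fin[OF x0 act_closed[OF g x0]] unfolding b_def Fpow_def by simp
  next
    fix g h assume g: "g \<in> carrier G" and h: "h \<in> carrier G"
    have "b (g \<otimes> h) = cuts n X x0 (\<alpha> g (\<alpha> h x0))"
      unfolding b_def using composition_rule[OF x0 g h] by simp
    also have "\<dots> = sym_diff (b g) (t g ` b h)"
      unfolding b_def t_cuts[OF g x0 act_closed[OF h x0]] cuts_sym_diff ..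
    finally show "b (g \<otimes> h) = sym_diff (t g ` b h) (b g)" by (simp only: Un_commute)
  next
    fix R show "finite {g \<in> carrier G. card (b g) \<le> R}" unfolding b_def by (rule proper)
  qed
  then show ?thesis by blast
qed

section \<open>Cliques, gates and sectors in quasi-median graphs\<close>

lemma joined_sym: "joined V E u v \<Longrightarrow> joined V E v u"
proof -
  assume "joined V E u v"
  then obtain p where "walk V E p" "hd p = u" "last p = v" by (auto simp: joined_def)
  then show ?thesis unfolding joined_def
    by (intro exI[of _ "rev p"]) (simp add: walk_rev hd_rev last_rev)
qed

locale quasi_median =
  fixes V :: "'v set" and E :: "'v set set"
  assumes qm: "quasi_median_graph V E"
begin

sublocale conn_graph V E
  using qm by unfold_locales (simp add: quasi_median_graph_def)

abbreviation adj where "adj u v \<equiv> {u, v} \<in> E"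

lemma adj_sym: "adj u v \<Longrightarrow> adj v u"
  by (simp add: insert_commute)

lemma triangle:
  assumes "x \<in> V" "adj v w" "dst x v = dst x w"
  obtains y where "y \<in> V" "adj y v" "adj y w" "dst x v = Suc (dst x y)"
  using qm assms edge_V[of v w] unfolding quasi_median_graph_def triangle_condition_def
  by (metis Suc_eq_plus1)

lemma quadrangle:
  assumes "x \<in> V" "adj v z" "adj w z" "v \<noteq> w" "dst x z = Suc (dst x v)" "dst x w = dst x v"
  obtains y where "y \<in> V" "adj y v" "adj y w" "dst x v = Suc (dst x y)"
proof -
  have "\<exists>y\<in>V. adj y v \<and> adj y w \<and> dst x y + 2 = Suc (dst x v)"
    using qm assms edge_V[of v z] edge_V[of w z]
    unfolding quasi_median_graph_def quadrangle_condition_def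
    by (metis Suc_eq_plus1)
  then show ?thesis using that by auto
qed

lemma K4_minus_mem: "i < 4 \<Longrightarrow> j < 4 \<Longrightarrow>
    {i, j} \<in> K4_minus_edges \<longleftrightarrow> i \<noteq> j \<and> \<not> (i < 2 \<and> j < 2)"
  unfolding K4_minus_edges_def by (auto simp: doubleton_eq_iff less_2_cases_iff)

lemma K32_mem: "i < 5 \<Longrightarrow> j < 5 \<Longrightarrow>
    {i, j} \<in> K32_edges \<longleftrightarrow> (i < 3 \<longleftrightarrow> 3 \<le> j)"
  unfolding K32_edges_def by (auto simp: doubleton_eq_iff) (metis insert_commute not_le)+

lemma no_K4_minus:
  assumes "adj a c" "adj a e" "adj b c" "adj b e" "adj c e" "a \<noteq> b" "\<not> adj a b"
  shows False
proof -
  define f where "f i = [a, b, c, e] ! i" for i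
  have lt4: "i < 4 \<longleftrightarrow> i = 0 \<or> i = Suc 0 \<or> i = 2 \<or> i = 3" for i :: nat by auto
  have f: "f 0 = a" "f (Suc 0) = b" "f 2 = c" "f 3 = e" by (simp_all add: f_def)
  have ne: "distinct [a, b, c, e]" using assms edge_neq by auto
  have no: "\<not> adj x x" for x using edge_neq by blast
  have "has_induced V E {..<4} K4_minus_edges"
    unfolding has_induced_def
  proof (intro exI[of _ f] conjI ballI)
    show "inj_on f {..<4}" using ne by (auto simp: inj_on_def lt4 f)
    show "f ` {..<4} \<subseteq> V"
      using edge_V[of a c] edge_V[of b e] assms by (auto simp: lt4 f)
    fix i j :: nat assume "i \<in> {..<4}" "j \<in> {..<4}"
    then show "{f i, f j} \<in> E \<longleftrightarrow> {i, j} \<in> K4_minus_edges"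
      using assms no by (simp add: K4_minus_mem) (auto simp: lt4 f insert_commute)
  qed
  then show False using qm by (simp add: quasi_median_graph_def)
qed

lemma no_K32:
  assumes "adj x p" "adj x q" "adj y p" "adj y q" "adj z p" "adj z q"
    "x \<noteq> y" "y \<noteq> z" "x \<noteq> z" "p \<noteq> q" "\<not> adj x y" "\<not> adj y z" "\<not> adj x z" "\<not> adj p q"
  shows False
proof -
  define f where "f i = [x, y, z, p, q] ! i" for i
  have lt5: "i < 5 \<longleftrightarrow> i = 0 \<or> i = Suc 0 \<or> i = 2 \<or> i = 3 \<or> i = 4" for i :: nat by auto
  have f: "f 0 = x" "f (Suc 0) = y" "f 2 = z" "f 3 = p" "f 4 = q" by (simp_all add: f_def)
  have ne: "distinct [x, y, z, p, q]" using assms edge_neq by auto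
  have no: "\<not> adj x x" for x using edge_neq by blast
  have "has_induced V E {..<5} K32_edges"
    unfolding has_induced_def
  proof (intro exI[of _ f] conjI ballI)
    show "inj_on f {..<5}" using ne by (auto simp: inj_on_def lt5 f)
    show "f ` {..<5} \<subseteq> V"
      using edge_V[of x p] edge_V[of y q] edge_V[of z q] assms by (auto simp: lt5 f)
    fix i j :: nat assume "i \<in> {..<5}" "j \<in> {..<5}"
    then show "{f i, f j} \<in> E \<longleftrightarrow> {i, j} \<in> K32_edges"
      using assms no by (simp add: K32_mem) (auto simp: lt5 f insert_commute)
  qed
  then show False using qm by (simp add: quasi_median_graph_def)
qed

text \<open>For an edge this is the unique maximal clique containing it: by the exclusion of
  \<open>K4_minus_edges\<close>, two common neighbours of its ends are adjacent. Cliques with at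
  least two vertices are thus named by their edges.\<close>

definition clq :: "'v set \<Rightarrow> 'v set" where
  "clq e = {x \<in> V. \<forall>y\<in>e. x = y \<or> adj x y}"

lemma edge_subset_clq: "adj a b \<Longrightarrow> a \<in> clq {a, b} \<and> b \<in> clq {a, b}"
  using edge_V[of a b] by (auto simp: clq_def insert_commute)

lemma clq_adj:
  assumes "adj a b" "x \<in> clq {a, b}" "y \<in> clq {a, b}" "x \<noteq> y"
  shows "adj x y"
proof (rule ccontr)
  assume "\<not> adj x y"
  then show False
    using no_K4_minus[of x a b y] assms adj_sym[of a b] adj_sym[of a y] adj_sym[of b y]
    by (auto simp: clq_def insert_commute)
qed

lemma clq_is_clique:
  assumes "e \<in> E"
  shows "is_clique V E (clq e)"
proof -
  obtain a b where e: "e = {a, b}" using edge_ex assms by blast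
  have ab: "adj a b" using assms e by simp
  have "complete_in E (clq e)" unfolding complete_in_def e using clq_adj[OF ab] by blast
  moreover have "D = clq e" if "clq e \<subseteq> D" "D \<subseteq> V" "complete_in E D" for D
  proof
    have "a \<in> D" "b \<in> D" using edge_subset_clq[OF ab] that e by auto
    then show "D \<subseteq> clq e" using that unfolding e clq_def complete_in_def by blast
  qed (rule that)
  ultimately show ?thesis unfolding is_clique_def clq_def by blast
qed

lemma clique_eq_clq:
  assumes C: "is_clique V E C" and ab: "a \<in> C" "b \<in> C" "a \<noteq> b"
  shows "adj a b" "C = clq {a, b}"
proof -
  show adj: "adj a b" using assms by (auto simp: is_clique_def complete_in_def)
  have "C \<subseteq> clq {a, b}" using C ab unfolding is_clique_def complete_in_def clq_def by blast
  then show "C = clq {a, b}"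
    using C clq_is_clique[OF adj] unfolding is_clique_def by blast
qed

lemma clq_eq: "e \<in> E \<Longrightarrow> a \<in> clq e \<Longrightarrow> b \<in> clq e \<Longrightarrow> a \<noteq> b \<Longrightarrow> adj a b \<and> clq {a, b} = clq e"
  using clique_eq_clq[OF clq_is_clique] by metis

lemma clq_sub: "clq e \<subseteq> V"
  by (auto simp: clq_def)

text \<open>In a triangle, two vertices cannot be equally far from \<open>x\<close> with the third
  one farther: the triangle condition gives a common neighbour of the two that is nearer to
  \<open>x\<close>, and with the third vertex it forms the forbidden graph.\<close>

lemma triangle_side:
  assumes x: "x \<in> V" and e: "adj a b" "adj b c" "adj a c" and lt: "dst x a < dst x b"
  shows "dst x a < dst x c"
proof (rule ccontr)
  assume n: "\<not> dst x a < dst x c"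
  have b: "dst x b = Suc (dst x a)" using lt dist_step[OF adj_sym[OF e(1)] x] by simp
  have "dst x c = dst x a" using n b dist_step[OF e(2) x] by simp
  then obtain y where y: "y \<in> V" "adj y a" "adj y c" "dst x a = Suc (dst x y)"
    using triangle[OF x e(3)] by metis
  have "\<not> adj y b" using dist_step[of b y x] x b y(4) by (auto simp: insert_commute)
  moreover have "y \<noteq> b" using b y(4) by auto
  ultimately show False
    using no_K4_minus[of y a c b] y e by (auto simp: insert_commute)
qed

definition gate :: "'v set \<Rightarrow> 'v \<Rightarrow> 'v \<Rightarrow> bool" where
  "gate C x c \<longleftrightarrow> c \<in> C \<and> (\<forall>c'\<in>C. c' \<noteq> c \<longrightarrow> dst x c < dst x c')"

lemma gate_unique: "gate C x c \<Longrightarrow> gate C x c' \<Longrightarrow> c = c'"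
  unfolding gate_def by (metis order_less_asym)

lemma gate_clq:
  assumes "x \<in> V" "adj a b" "dst x a < dst x b"
  shows "gate (clq {a, b}) x a"
  unfolding gate_def
proof (intro conjI ballI impI)
  fix c assume c: "c \<in> clq {a, b}" "c \<noteq> a"
  show "dst x a < dst x c"
  proof (cases "c = b")
    case False
    then show ?thesis using triangle_side[of x a b c] c assms by (auto simp: clq_def insert_commute)
  qed (use assms in simp)
qed (use edge_subset_clq assms in blast)

text \<open>If one end of \<open>e\<close> is nearer, it is the gate. If both are equally far, the
  triangle condition yields a nearer common neighbour, which lies in the same clique and is its
  gate.\<close>

lemma gate_ex:
  assumes "x \<in> V" "e \<in> E"
  shows "\<exists>c. gate (clq e) x c"
proof -
  obtain a b where e: "e = {a, b}" using edge_ex assms by blast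
  have ab: "adj a b" using assms e by simp
  consider "dst x a < dst x b" | "dst x b < dst x a" | "dst x a = dst x b" by linarith
  then show ?thesis
  proof cases
    case 3
    then obtain y where y: "y \<in> V" "adj y a" "adj y b" "dst x a = Suc (dst x y)"
      using triangle[OF assms(1) ab] by blast
    then have "gate (clq {y, a}) x y" by (intro gate_clq assms) simp_all
    moreover have "y \<in> clq e" "a \<in> clq e" "y \<noteq> a"
      using y e edge_subset_clq[OF ab] edge_neq by (auto simp: clq_def)
    then have "clq {y, a} = clq e" using clq_eq[OF assms(2)] by blast
    ultimately show ?thesis by auto
  qed (use gate_clq[OF assms(1) ab] gate_clq[OF assms(1) adj_sym[OF ab]] e in
      \<open>auto simp: insert_commute\<close>)
qed

lemma gate_self: "e \<in> E \<Longrightarrow> c \<in> clq e \<Longrightarrow> gate (clq e) c c"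
  unfolding gate_def using clq_eq dist_edge clq_sub by fastforce

lemma gate_dist:
  assumes "e \<in> E" "x \<in> V" "gate (clq e) x c" "c' \<in> clq e" "c' \<noteq> c"
  shows "dst x c' = Suc (dst x c)"
proof -
  have "adj c' c" using clq_eq[OF assms(1) assms(4)] assms(3,5) by (simp add: gate_def)
  then have "dst x c' \<le> dst x c + 1" using assms(2) by (rule dist_step)
  then show ?thesis using assms unfolding gate_def by fastforce
qed

section \<open>Squares and their effect on gates\<close>

definition square :: "'v \<Rightarrow> 'v \<Rightarrow> 'v \<Rightarrow> 'v \<Rightarrow> bool" where
  "square a b c d \<longleftrightarrow> a \<noteq> c \<and> b \<noteq> d \<and> adj a b \<and> adj b c \<and> adj c d \<and> adj d a \<and>
    \<not> adj a c \<and> \<not> adj b d"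

lemma square_flip: "square a b c d \<Longrightarrow> square b a d c"
  unfolding square_def by (auto simp: insert_commute)

lemma square_rev: "square a b c d \<Longrightarrow> square d c b a"
  unfolding square_def by (auto simp: insert_commute)

lemma dist_1:
  assumes "u \<in> V" "v \<in> V" "dst u v = 1"
  shows "adj u v"
proof -
  obtain w where "w \<in> V" "adj u w" "dst w v = 0"
    using dist_first[OF assms(1,2), of 0] assms(3) by auto
  then show ?thesis using dist_eq_0[of w v] assms(2) by simp
qed

lemma dist_2:
  assumes "adj u v" "adj v w" "u \<noteq> w" "\<not> adj u w"
  shows "dst u w = 2"
proof -
  have V: "u \<in> V" "v \<in> V" "w \<in> V" using assms edge_V by blast+
  have "dst u w \<le> 2" using dist_triangle[OF V] dist_edge[OF assms(1)] dist_edge[OF assms(2)] by simp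
  moreover have "dst u w \<noteq> 0" using dist_eq_0[OF V(1,3)] assms by simp
  moreover have "dst u w \<noteq> 1" using dist_1[OF V(1,3)] assms(4) by blast
  ultimately show ?thesis by linarith
qed

lemma far_not_adj: "x \<in> V \<Longrightarrow> dst x v = Suc (Suc (dst x w)) \<Longrightarrow> \<not> adj v w"
  using dist_step[of v w x] by auto

text \<open>Opposite sides of a square point the same way as seen from any vertex; this is what
  makes hyperplanes separate. A violation leaves two distance patterns, each excluded by a forbidden
  subgraph.\<close>

lemma square_side:
  assumes s: "square a b c d" and x: "x \<in> V" and lt: "dst x a < dst x b"
  shows "dst x d < dst x c"
proof (rule ccontr)
  assume n: "\<not> dst x d < dst x c"
  have e: "adj a b" "adj b c" "adj c d" "adj d a" "adj b a" "adj c b" "adj d c" "adj a d"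
    and ne: "a \<noteq> c" "b \<noteq> d" "\<not> adj a c" "\<not> adj b d"
    using s by (auto simp: square_def insert_commute)
  define k where "k = dst x a"
  have b: "dst x b = Suc k" using lt dist_step[OF e(5) x] by (simp add: k_def)
  have bound: "dst x a \<le> dst x d + 1" "dst x d \<le> dst x a + 1" "dst x b \<le> dst x c + 1"
    "dst x c \<le> dst x b + 1" "dst x d \<le> dst x c + 1" "dst x c \<le> dst x d + 1"
    using dist_step[OF e(8) x] dist_step[OF e(4) x] dist_step[OF e(2) x] dist_step[OF e(6) x]
      dist_step[OF e(7) x] dist_step[OF e(3) x] .
  \<comment> \<open>\<open>a\<close> and \<open>c\<close> both lie below \<open>b\<close>, so there
    is a vertex \<open>y\<close> below them. If \<open>y\<close> and \<open>d\<close> are adjacent,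
    \<open>K4_minus_edges\<close> appears; otherwise \<open>b\<close>, \<open>d\<close>,
    \<open>y\<close> are three pairwise nonadjacent common neighbours of \<open>a\<close> and
    \<open>c\<close>.\<close>
  have low: False if ck: "dst x c = k"
  proof -
    obtain y where y: "y \<in> V" "adj y a" "adj y c" "dst x a = Suc (dst x y)"
      using quadrangle[OF x e(1) e(6) ne(1)] b ck by (auto simp: k_def)
    have yb: "\<not> adj b y" using far_not_adj[OF x] b y(4) by (simp add: k_def)
    have yd: "y \<noteq> d" using n ck y(4) by (auto simp: k_def)
    show False
    proof (cases "adj y d")
      case True
      then show False using no_K4_minus[of a y d c] y e ne by (auto simp: insert_commute)
    next
      case False
      have "y \<noteq> b" using b y(4) by (auto simp: k_def)
      then show False using no_K32[of b a c d y] False yb yd y e ne by (auto simp: insert_commute)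
    qed
  qed
  \<comment> \<open>\<open>b\<close>, \<open>c\<close>, \<open>d\<close> lie one level above
    \<open>a\<close>. Two triangles and a quadrangle provide \<open>y\<close>, \<open>t\<close>,
    \<open>z\<close> such that \<open>b\<close>, \<open>t\<close>, \<open>z\<close> are three
    pairwise nonadjacent common neighbours of \<open>a\<close> and \<open>y\<close>.\<close>
  have high: False if c: "dst x c = Suc k" and d: "dst x d = Suc k"
  proof -
    obtain y where y: "y \<in> V" "adj y b" "adj y c" "dst x b = Suc (dst x y)"
      using triangle[OF x e(2)] b c by metis
    have yk: "dst x y = k" using y(4) b by simp
    have ya: "y \<noteq> a" "\<not> adj a y"
      using y e ne no_K4_minus[of a b y c] by (auto simp: insert_commute)
    have yd: "y \<noteq> d" "\<not> adj d y"
      using y e ne no_K4_minus[of b c y d] by (auto simp: insert_commute)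
    have "dst y a = 2" using dist_2[OF y(2) e(5)] ya by (auto simp: insert_commute)
    moreover have "dst y d = 2" using dist_2[OF y(3) e(3)] yd by (auto simp: insert_commute)
    ultimately have y2: "dst y a = dst y d" "dst y a = 2" by simp_all
    obtain t where t: "t \<in> V" "adj t a" "adj t d" "dst y a = Suc (dst y t)"
      by (rule triangle[OF y(1) e(8) y2(1)])
    have yt: "adj y t" using dist_1[OF y(1) t(1)] t(4) y2(2) by simp
    have tb: "t \<noteq> b" "\<not> adj b t"
      using t e ne no_K4_minus[of b a t d] by (auto simp: insert_commute)
    have "dst x a < dst x t"
      using triangle_side[OF x e(8) adj_sym[OF t(3)] adj_sym[OF t(2)]] d by (simp add: k_def)
    moreover have "dst x t \<le> dst x a + 1" by (rule dist_step[OF t(2) x])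
    ultimately have tk: "dst x t = Suc k" by (simp add: k_def)
    obtain z where z: "z \<in> V" "adj z a" "adj z y" "dst x a = Suc (dst x z)"
      using quadrangle[OF x e(1) y(2) ya(1)[symmetric]] b yk by (auto simp: k_def)
    have zb: "\<not> adj b z" "\<not> adj t z"
      using far_not_adj[OF x] b tk z(4) by (simp_all add: k_def)
    have "z \<noteq> b" "z \<noteq> t" using b tk z(4) by (auto simp: k_def)
    then show False
      using no_K32[of b a y t z] zb tb z t yt y ya e by (auto simp: insert_commute)
  qed
  have "dst x c = k \<or> dst x c = Suc k \<and> dst x d = Suc k"
    using bound n b unfolding k_def by linarith
  then show False using low high by blast
qed

text \<open>A further vertex \<open>p\<close> of the clique is at distance two from both
  \<open>c\<close> and \<open>d\<close>, so the triangle condition carries it across the square. In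
  this way the whole clique of one side moves to the clique of the opposite side.\<close>

lemma square_prism:
  assumes s: "square a b c d" and p: "p \<in> clq {a, b}" "p \<noteq> a" "p \<noteq> b"
  shows "\<exists>t. t \<in> clq {d, c} \<and> t \<noteq> d \<and> square p a d t"
proof -
  have e: "adj a b" "adj b c" "adj c d" "adj d a" "adj b a" "adj c b" "adj d c" "adj a d"
    and ne: "a \<noteq> c" "b \<noteq> d" "\<not> adj a c" "\<not> adj b d"
    using s by (auto simp: square_def insert_commute)
  have pe: "p \<in> V" "adj p a" "adj p b" using p by (auto simp: clq_def)
  have pd: "p \<noteq> d" "\<not> adj p d"
    using pe e ne no_K4_minus[of b a p d] by (auto simp: insert_commute)
  have pc: "p \<noteq> c" "\<not> adj p c"
    using pe e ne no_K4_minus[of a b p c] by (auto simp: insert_commute)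
  have p2: "dst p d = 2" "dst p c = 2"
    using dist_2[OF pe(2) e(8) pd] dist_2[OF pe(3) e(2) pc] .
  then have "dst p d = dst p c" by simp
  then obtain t where t: "t \<in> V" "adj t d" "adj t c" "dst p d = Suc (dst p t)"
    by (rule triangle[OF pe(1) e(7)])
  have pt: "adj p t" using dist_1[OF pe(1) t(1)] t(4) p2(1) by simp
  have "a \<noteq> t" "\<not> adj a t"
    using t e ne no_K4_minus[of a t d c] by (auto simp: insert_commute)
  then have "square p a d t"
    using pd pe e t pt unfolding square_def by (auto simp: insert_commute)
  moreover have "t \<in> clq {d, c}" using t by (auto simp: clq_def)
  moreover have "t \<noteq> d" using t(2) edge_neq by blast
  ultimately show ?thesis by blast
qed

text \<open>This turns out to be the relation of lying in a common sector of the hyperplane of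
  \<open>e\<close>.\<close>

definition same_gate :: "'v set \<Rightarrow> 'v \<Rightarrow> 'v \<Rightarrow> bool" where
  "same_gate e x y \<longleftrightarrow> (\<exists>c. gate (clq e) x c \<and> gate (clq e) y c)"

text \<open>The witness \<open>t\<close> is chosen before \<open>x\<close>: a whole fibre over the
  clique of one side lies in a single fibre over the clique of the opposite side.\<close>

lemma square_gate:
  assumes s: "square a b c d" and p: "p \<in> clq {a, b}"
  shows "\<exists>t. \<forall>x\<in>V. gate (clq {a, b}) x p \<longrightarrow> gate (clq {d, c}) x t"
proof -
  have ab: "adj a b" "a \<noteq> b" and dc: "adj d c" using s edge_neq[of a b] by (auto simp: square_def insert_commute)
  have mem: "a \<in> clq {a, b}" "b \<in> clq {a, b}" "d \<in> clq {d, c}"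
    using edge_subset_clq ab dc by blast+
  consider "p = a" | "p = b" | "p \<noteq> a" "p \<noteq> b" by blast
  then show ?thesis
  proof cases
    case 1
    have "gate (clq {d, c}) x d" if "x \<in> V" "gate (clq {a, b}) x a" for x
    proof -
      have "dst x a < dst x b" using that mem ab by (simp add: gate_def)
      then show ?thesis using gate_clq[OF that(1) dc] square_side[OF s that(1)] by blast
    qed
    then show ?thesis using 1 by blast
  next
    case 2
    have "gate (clq {d, c}) x c" if "x \<in> V" "gate (clq {a, b}) x b" for x
    proof -
      have "dst x b < dst x a" using that mem ab by (simp add: gate_def)
      then show ?thesis
        using gate_clq[OF that(1) adj_sym[OF dc]] square_side[OF square_flip[OF s] that(1)]
        by (simp add: insert_commute)
    qed
    then show ?thesis using 2 by blast
  next
    case 3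
    then obtain t where t: "t \<in> clq {d, c}" "t \<noteq> d" "square p a d t" using square_prism[OF s p] by blast
    have td: "adj t d" "clq {t, d} = clq {d, c}" using clq_eq[OF dc t(1) mem(3) t(2)] by auto
    have "gate (clq {d, c}) x t" if "x \<in> V" "gate (clq {a, b}) x p" for x
    proof -
      have "dst x p < dst x a" using that mem 3 by (auto simp: gate_def)
      then show ?thesis using gate_clq[OF that(1) td(1)] square_side[OF t(3) that(1)] td(2) by simp
    qed
    then show ?thesis by blast
  qed
qed

lemma square_same_gate:
  assumes "square a b c d" "x \<in> V" "y \<in> V" "same_gate {a, b} x y"
  shows "same_gate {d, c} x y"
proof -
  obtain p where p: "gate (clq {a, b}) x p" "gate (clq {a, b}) y p"
    using assms(4) by (auto simp: same_gate_def)
  then have "p \<in> clq {a, b}" by (simp add: gate_def)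
  then show ?thesis using square_gate[OF assms(1)] p assms(2,3) unfolding same_gate_def by blast
qed

section \<open>Hyperplanes and the fibres of the gate map\<close>

abbreviation par :: "('v set \<times> 'v set) set" where "par \<equiv> (elementary_parallel E)\<^sup>*"

lemma elementary_parallel_cases:
  assumes "(e, e') \<in> elementary_parallel E"
  obtains (tri) a b c where "e = {a, b}" "e' = {a, c}" "adj a b" "adj a c" "adj b c"
  | (sq) a b c d where "e = {a, b}" "e' = {d, c}" "square a b c d"
proof -
  from assms consider
    (1) a b c where "e = {a, b}" "e' = {a, c}" "adj a b" "adj a c" "adj b c"
  | (2) a b c d where "e = {a, b}" "e' = {c, d}" "distinct [a, b, c, d]" "adj a b" "adj b c" "adj c d"
      "adj d a" "\<not> adj a c" "\<not> adj b d"
    unfolding elementary_parallel_def by blast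
  then show ?thesis
  proof cases
    case 1 then show ?thesis using tri by blast
  next
    case (2 a b c d)
    then have "square a b c d" by (simp add: square_def)
    then show ?thesis using sq[of a b d c] 2 by (simp add: insert_commute)
  qed
qed

lemma square_parallel: "square a b c d \<Longrightarrow> ({a, b}, {d, c}) \<in> elementary_parallel E"
proof -
  assume s: "square a b c d"
  then have "distinct [a, b, c, d]" using edge_neq by (auto simp: square_def)
  then show ?thesis using s unfolding square_def elementary_parallel_def
    by (intro UnI2 CollectI exI[of _ a] exI[of _ b] exI[of _ c] exI[of _ d]) (simp add: insert_commute)
qed

lemma triangle_parallel:
  "adj a b \<Longrightarrow> adj a c \<Longrightarrow> adj b c \<Longrightarrow> ({a, b}, {a, c}) \<in> elementary_parallel E"
  unfolding elementary_parallel_def by blast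

lemma elementary_parallel_sym: "(e, e') \<in> elementary_parallel E \<Longrightarrow> (e', e) \<in> elementary_parallel E"
proof (erule elementary_parallel_cases)
  fix a b c assume "e = {a, b}" "e' = {a, c}" "adj a b" "adj a c" "adj b c"
  then show ?thesis using triangle_parallel[of a c b] by (simp add: insert_commute)
next
  fix a b c d assume "e = {a, b}" "e' = {d, c}" "square a b c d"
  then show ?thesis using square_parallel[OF square_rev] by blast
qed

lemma par_sym: "(e, e') \<in> par \<Longrightarrow> (e', e) \<in> par"
  using elementary_parallel_sym sym_rtrancl[of "elementary_parallel E"]
  by (simp add: sym_def)

lemma elementary_parallel_edge: "(e, e') \<in> elementary_parallel E \<Longrightarrow> e \<in> E \<and> e' \<in> E"
  by (erule elementary_parallel_cases) (auto simp: square_def insert_commute)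

lemma elementary_parallel_same_gate:
  assumes "(e, e') \<in> elementary_parallel E" "x \<in> V" "y \<in> V" "same_gate e x y"
  shows "same_gate e' x y"
  using assms(1)
proof (cases rule: elementary_parallel_cases)
  case (tri a b c)
  have "c \<in> clq e" "a \<in> clq e" using tri edge_V[of a c] edge_V[of a b] by (auto simp: clq_def insert_commute)
  moreover have "e \<in> E" "a \<noteq> c" using tri edge_neq[of a c] by auto
  ultimately have "clq e' = clq e" using clq_eq[of e a c] tri by auto
  then show ?thesis using assms(4) by (simp add: same_gate_def)
next
  case (sq a b c d)
  then show ?thesis using square_same_gate assms by blast
qed

lemma par_edge: "(e, e') \<in> par \<Longrightarrow> e \<in> E \<Longrightarrow> e' \<in> E"
  by (induction rule: rtrancl_induct) (auto dest: elementary_parallel_edge)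

lemma par_same_gate_imp:
  "(e, e') \<in> par \<Longrightarrow> x \<in> V \<Longrightarrow> y \<in> V \<Longrightarrow> same_gate e x y \<Longrightarrow> same_gate e' x y"
  by (induction rule: rtrancl_induct) (auto dest: elementary_parallel_same_gate)

lemma par_same_gate:
  "(e, e') \<in> par \<Longrightarrow> x \<in> V \<Longrightarrow> y \<in> V \<Longrightarrow> same_gate e x y \<longleftrightarrow> same_gate e' x y"
  using par_same_gate_imp par_sym by metis

text \<open>Two edges of a clique with a common end are sides of a triangle, and at most two such
  moves lead from \<open>e\<close> to any other edge.\<close>

lemma clq_par:
  assumes e: "e \<in> E" and ab: "a \<in> clq e" "b \<in> clq e" "a \<noteq> b"
  shows "(e, {a, b}) \<in> par"
proof -
  have share: "({x, y}, {x, z}) \<in> par"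
    if "x \<in> clq e" "y \<in> clq e" "z \<in> clq e" "x \<noteq> y" "x \<noteq> z" for x y z
  proof (cases "y = z")
    case False
    then have "({x, y}, {x, z}) \<in> elementary_parallel E"
      using triangle_parallel[of x y z] clq_eq[OF e] that by blast
    then show ?thesis by blast
  qed simp
  obtain u v where uv: "e = {u, v}" "u \<noteq> v" using edge_ex e by blast
  have mem: "u \<in> clq e" "v \<in> clq e" using edge_subset_clq e uv by auto
  show ?thesis
  proof (cases "a = u")
    case True
    then show ?thesis using share[of u v b] mem ab uv by simp
  next
    case False
    then have "(e, {u, a}) \<in> par" using share[of u v a] mem ab uv by simp
    moreover have "({u, a}, {a, b}) \<in> par"
      using share[of a u b] mem ab False by (simp add: insert_commute[of u a])
    ultimately show ?thesis by (rule rtrancl_trans)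
  qed
qed

text \<open>A ladder of squares, by induction on the distance from \<open>u\<close> to its gate. The
  quadrangle condition towards \<open>a\<close> supplies the next rung, whose ends have the same
  gates \<open>a\<close> and \<open>b\<close>.\<close>

lemma crossing_par:
  assumes e: "e \<in> E" and "gate (clq e) u a" "gate (clq e) v b" "a \<noteq> b" "adj u v"
  shows "(e, {u, v}) \<in> par"
  using assms(2-)
proof (induction "dst u a" arbitrary: u v)
  case 0
  have ab: "a \<in> clq e" "b \<in> clq e" using 0 by (auto simp: gate_def)
  have V: "u \<in> V" "v \<in> V" "a \<in> V" "b \<in> V" using 0 ab edge_V clq_sub by blast+
  have ua: "u = a" using 0(1) dist_eq_0[OF V(1,3)] by simp
  have "dst v u = 1" using dist_edge[of v u] 0(5) by (simp add: insert_commute)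
  then have "dst v b < 1" using 0(3,4) ab ua unfolding gate_def by metis
  then have "v = b" using dist_eq_0[OF V(2,4)] by simp
  then show ?case using clq_par[OF e ab 0(4)] ua by simp
next
  case (Suc k)
  have ab: "a \<in> clq e" "b \<in> clq e" using Suc by (auto simp: gate_def)
  have V: "u \<in> V" "v \<in> V" "a \<in> V" "b \<in> V" using Suc ab edge_V clq_sub by blast+
  have ua: "dst u a = Suc k" "dst u b = Suc (Suc k)"
    using Suc(2) gate_dist[OF e V(1) Suc(3) ab(2)] Suc(5) by auto
  have va: "dst v a = Suc (dst v b)" using gate_dist[OF e V(2) Suc(4) ab(1)] Suc(5) by auto
  have "dst v a \<le> dst u a + 1" "dst u b \<le> dst v b + 1"
    using dist_step'[OF adj_sym[OF Suc(6)] V(3)] dist_step'[OF Suc(6) V(4)] .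
  then have vb: "dst v b = Suc k" "dst v a = Suc (Suc k)" using ua va by auto
  obtain v' where v': "v' \<in> V" "adj v v'" "dst v' b = k" using dist_first[OF V(2,4) vb(1)] by blast
  have "dst v' a \<le> dst v' b + dst b a" by (rule dist_triangle[OF v'(1) V(4,3)])
  moreover have "adj b a" using clq_eq[OF e ab(2,1)] Suc(5) by blast
  then have "dst b a = 1" by (rule dist_edge)
  moreover have "dst v a \<le> dst v' a + 1" by (rule dist_step'[OF v'(2) V(3)])
  ultimately have v'a: "dst v' a = Suc k" using v'(3) vb(2) by linarith
  have "u \<noteq> v'" using ua v' by auto
  have sy: "dst a v = Suc (Suc k)" "dst a u = Suc k" "dst a v' = Suc k"
    using vb(2) ua(1) v'a dist_sym V v'(1) by metis+
  obtain u' where u': "u' \<in> V" "adj u' u" "adj u' v'" "dst a u' = k"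
    using quadrangle[OF V(3) Suc(6) adj_sym[OF v'(2)] \<open>u \<noteq> v'\<close>] sy by auto
  have u'a: "dst u' a = k" using u'(1,4) dist_sym V(3) by metis
  have "dst u b \<le> dst u' b + 1" by (rule dist_step'[OF adj_sym[OF u'(2)] V(4)])
  then have lt: "dst u' a < dst u' b" using u'a ua by simp
  have clq: "clq {a, b} = clq e" "adj a b" using clq_eq[OF e ab Suc(5)] by auto
  have g: "gate (clq e) u' a" using gate_clq[OF u'(1) clq(2) lt] clq by simp
  have "gate (clq {b, a}) v' b" using gate_clq[OF v'(1) adj_sym[OF clq(2)]] v'(3) v'a by simp
  then have "gate (clq e) v' b" using clq by (simp add: insert_commute)
  then have "(e, {u', v'}) \<in> par" using Suc(1)[OF u'a[symmetric] g] Suc(5) u'(3) by blast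
  \<comment> \<open>Both diagonals are absent because their ends differ by two in distance to
    \<open>a\<close>, respectively to \<open>b\<close>.\<close>
  moreover have "square u' v' v u"
  proof -
    have "u' \<noteq> v" "\<not> adj u' v" using vb(2) u'a dist_step'[of v u' a] V by (auto simp: insert_commute)
    moreover have "\<not> adj v' u" using ua v'(3) dist_step'[of u v' b] V by (auto simp: insert_commute)
    ultimately show ?thesis
      using u' v'(2) Suc(6) \<open>u \<noteq> v'\<close> unfolding square_def by (auto simp: insert_commute)
  qed
  then have "({u', v'}, {u, v}) \<in> par" using square_parallel by blast
  ultimately show ?case by (rule rtrancl_trans)
qed

lemma same_gate_refl: "x \<in> V \<Longrightarrow> e \<in> E \<Longrightarrow> same_gate e x x"
  using gate_ex by (auto simp: same_gate_def)

lemma same_gate_trans: "same_gate e x y \<Longrightarrow> same_gate e y z \<Longrightarrow> same_gate e x z"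
  unfolding same_gate_def using gate_unique by metis

lemma edge_not_same_gate: "adj u v \<Longrightarrow> \<not> same_gate {u, v} u v"
  using gate_self[of "{u, v}" u] gate_self[of "{u, v}" v] edge_subset_clq[of u v] edge_neq[of u v]
    gate_unique unfolding same_gate_def by metis

lemma par_not_same_gate:
  assumes "e \<in> E" "(e, {u, v}) \<in> par"
  shows "\<not> same_gate e u v"
proof -
  have "adj u v" using par_edge assms by blast
  then show ?thesis using edge_not_same_gate par_same_gate[OF assms(2)] edge_V by blast
qed

lemma same_gate_or_par:
  assumes "e \<in> E" "adj u v"
  shows "same_gate e u v \<or> (e, {u, v}) \<in> par"
proof -
  obtain a b where "gate (clq e) u a" "gate (clq e) v b" using gate_ex assms edge_V by meson
  then show ?thesis using crossing_par[OF assms(1)] assms(2) unfolding same_gate_def by blast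
qed

text \<open>An edge outside the hyperplane keeps the gate. Conversely, a geodesic to the gate stays
  in the fibre and hence never crosses the hyperplane, so any two vertices of a fibre are joined
  through their gate.\<close>

lemma joined_iff_same_gate:
  assumes e: "e \<in> E" and xy: "x \<in> V" "y \<in> V"
  shows "joined V (E - par `` {e}) x y \<longleftrightarrow> same_gate e x y"
proof
  assume "joined V (E - par `` {e}) x y"
  then show "same_gate e x y"
  proof (rule joined_invariant[where P = "same_gate e x"])
    fix u v assume "{u, v} \<in> E - par `` {e}" "same_gate e x u"
    then show "same_gate e x v" using same_gate_or_par[OF e, of u v] same_gate_trans by blast
  qed (rule same_gate_refl[OF xy(1) e])
next
  have to_gate: "joined V (E - par `` {e}) x c" if "x \<in> V" "gate (clq e) x c" for x c
    using that
  proof (induction "dst x c" arbitrary: x)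
    case 0
    have "c \<in> V" using 0 clq_sub by (auto simp: gate_def)
    then show ?case using 0 dist_eq_0 joined_refl by metis
  next
    case (Suc k)
    have c: "c \<in> clq e" "c \<in> V" using Suc clq_sub by (auto simp: gate_def)
    obtain x' where x': "x' \<in> V" "adj x x'" "dst x' c = k"
      using dist_first[OF Suc(3) c(2) Suc(2)[symmetric]] by blast
    \<comment> \<open>The step gains one towards \<open>c\<close> and at most one towards any other
      vertex of the clique, so \<open>c\<close> remains the gate.\<close>
    have "dst x' c < dst x' c'" if c': "c' \<in> clq e" "c' \<noteq> c" for c'
    proof -
      have "c' \<in> V" using c' clq_sub by blast
      then have "dst x c' \<le> dst x' c' + 1" using x'(2) by (intro dist_step') auto
      moreover have "dst x c' = Suc (dst x c)" by (rule gate_dist[OF e Suc(3,4) c'])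
      ultimately show ?thesis using x'(3) Suc(2) by simp
    qed
    then have g: "gate (clq e) x' c" using c(1) by (simp add: gate_def)
    then have "same_gate e x x'" using Suc(4) by (auto simp: same_gate_def)
    then have "{x, x'} \<in> E - par `` {e}" using par_not_same_gate[OF e] x'(2) by auto
    then have "joined V (E - par `` {e}) x x'"
      by (rule joined_edge[OF _ Suc(3) x'(1)])
    moreover have "joined V (E - par `` {e}) x' c" using Suc(1)[OF _ x'(1) g] x'(3) by simp
    ultimately show ?case by (rule joined_trans)
  qed
  assume "same_gate e x y"
  then obtain c where c: "gate (clq e) x c" "gate (clq e) y c" by (auto simp: same_gate_def)
  show "joined V (E - par `` {e}) x y"
    by (rule joined_trans[OF to_gate[OF xy(1) c(1)] joined_sym[OF to_gate[OF xy(2) c(2)]]])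
qed

definition fibre :: "'v set \<Rightarrow> 'v \<Rightarrow> 'v set" where
  "fibre e c = {x \<in> V. gate (clq e) x c}"

lemma fibre_sector:
  assumes "e \<in> E" "c \<in> clq e"
  shows "fibre e c \<in> sectors V E (par `` {e})"
proof -
  have c: "c \<in> V" using assms clq_sub by blast
  have "{v. joined V (E - par `` {e}) c v} = fibre e c"
  proof (intro equalityI subsetI)
    fix v assume v: "v \<in> {v. joined V (E - par `` {e}) c v}"
    then obtain p where "walk V (E - par `` {e}) p" "last p = v" by (auto simp: joined_def)
    then have "v \<in> V" by (auto simp: walk_def dest: last_in_set)
    then show "v \<in> fibre e c"
      using v joined_iff_same_gate[OF assms(1) c] gate_self[OF assms] gate_unique
      unfolding fibre_def same_gate_def by blast
  next
    fix v assume "v \<in> fibre e c"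
    then show "v \<in> {v. joined V (E - par `` {e}) c v}"
      using joined_iff_same_gate[OF assms(1) c] gate_self[OF assms]
      unfolding fibre_def same_gate_def by blast
  qed
  then show ?thesis unfolding sectors_def connected_components_def using c by blast
qed

lemma hyperplane_class: "e \<in> E \<Longrightarrow> par `` {e} \<in> hyperplanes E"
  unfolding hyperplanes_def by (rule quotientI)

lemma clq_dual: "e \<in> E \<Longrightarrow> dual_to (clq e) (par `` {e})"
  unfolding dual_to_def using clq_par by blast

end

section \<open>Weights on cliques\<close>

text \<open>Invariance lets the weight survive translation, and finiteness gives finite separating
  sets. The third clause is properness inside a possibly infinite clique; positive singletons ensure
  that distinct vertices are separated.\<close>

definition clique_weight ::
    "('g \<Rightarrow> 'v \<Rightarrow> 'v) \<Rightarrow> 'g set \<Rightarrow> 'v set \<Rightarrow> ('v set \<Rightarrow> nat) \<Rightarrow> bool" where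
  "clique_weight \<phi> H C N \<longleftrightarrow>
     (\<forall>h\<in>H. \<forall>Q. Q \<subseteq> C \<longrightarrow> N (\<phi> h ` Q) = N Q) \<and>
     (\<forall>c\<in>C. \<forall>c'\<in>C. finite (cuts N C c c')) \<and>
     (\<forall>c\<in>C. \<forall>R. finite {c' \<in> C. card (cuts N C c c') \<le> R}) \<and>
     (\<forall>c\<in>C. 0 < N {c})"

text \<open>On a finite clique the constant weight one is invariant under any group, and the
  finiteness clauses follow from having finitely many subsets and vertices.\<close>

lemma finite_clique_weight:
  assumes "finite C"
  shows "\<exists>N. clique_weight \<phi> H C N"
proof (intro exI)
  have fin: "finite (cuts (\<lambda>_. 1) C c c')" for c c'
  proof (rule finite_subset)
    show "cuts (\<lambda>_. 1) C c c' \<subseteq> Pow C \<times> {..<1}" by (auto simp: cuts_def)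
    show "finite (Pow C \<times> {..<1::nat})" using assms by blast
  qed
  show "clique_weight \<phi> H C (\<lambda>_. 1)"
    unfolding clique_weight_def
  proof (intro conjI ballI allI impI)
    show "finite {c' \<in> C. card (cuts (\<lambda>_. 1) C c c') \<le> R}" for c R
      using assms by (rule finite_subset[rotated]) blast
  qed (rule refl fin zero_less_one)+
qed

text \<open>
  A simply transitive action identifies the clique with an orbit of the group in the cube
  complex. Halfspaces then cut the clique, with multiplicity because different halfspaces can
  have the same trace; the singletons make any two vertices of the clique distinguishable.
\<close>

lemma free_transitive_clique_weight:
  fixes H :: "('g, 'm) monoid_scheme" (structure) and K :: "'z set set"
  assumes proper: "acts_properly_on_CAT0 H K \<psi>" and ne: "C \<noteq> {}"
    and cl: "\<And>h c. h \<in> carrier H \<Longrightarrow> c \<in> C \<Longrightarrow> \<phi> h c \<in> C"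
    and one: "\<And>c. c \<in> C \<Longrightarrow> \<phi> \<one> c = c"
    and mult: "\<And>h g c. h \<in> carrier H \<Longrightarrow> g \<in> carrier H \<Longrightarrow> c \<in> C \<Longrightarrow>
      \<phi> (h \<otimes> g) c = \<phi> h (\<phi> g c)"
    and free: "\<And>h c. h \<in> carrier H \<Longrightarrow> c \<in> C \<Longrightarrow> \<phi> h c = c \<Longrightarrow> h = \<one>"
    and trans: "\<And>c c'. c \<in> C \<Longrightarrow> c' \<in> C \<Longrightarrow> \<exists>h\<in>carrier H. \<phi> h c = c'"
  shows "\<exists>N. clique_weight \<phi> (carrier H) C N"
proof -
  obtain \<H> z where hs: "z \<in> \<Union>K" "\<forall>W\<in>\<H>. W \<subseteq> \<Union>K"
    "\<forall>g\<in>carrier H. \<forall>W\<in>\<H>. \<psi> g ` W \<in> \<H>"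
    "\<forall>x\<in>\<Union>K. \<forall>y\<in>\<Union>K. finite {W \<in> \<H>. (x \<in> W) \<noteq> (y \<in> W)}"
    "\<forall>R. finite {g \<in> carrier H. card {W \<in> \<H>. (z \<in> W) \<noteq> (\<psi> g z \<in> W)} \<le> R}"
    using CAT0_imp_halfspaces[OF proper] by (elim exE conjE) (rule that)
  note z = hs(1) and \<H> = hs(2)[rule_format] and inv\<H> = hs(3)[rule_format]
    and fin\<H> = hs(4)[rule_format] and prop\<H> = hs(5)[rule_format]
  have "group_action H (\<Union>K) \<psi>"
    using proper by (simp add: acts_properly_on_CAT0_def acts_on_cube_complex_def)
  then interpret A: group_action H "\<Union>K" \<psi> .
  interpret group H by (rule A.group)
  define S where "S x y = {W \<in> \<H>. (x \<in> W) \<noteq> (y \<in> W)}" for x y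
  obtain c0 where c0: "c0 \<in> C" using ne by blast
  \<comment> \<open>\<open>k c\<close> is the group element carrying \<open>c0\<close> to
    \<open>c\<close>; freeness makes it unique, and hence \<open>k\<close> equivariant.\<close>
  define k where "k c = (SOME h. h \<in> carrier H \<and> \<phi> h c0 = c)" for c
  have k: "k c \<in> carrier H" "\<phi> (k c) c0 = c" if "c \<in> C" for c
    using trans[OF c0 that] someI_ex[of "\<lambda>h. h \<in> carrier H \<and> \<phi> h c0 = c"] unfolding k_def by blast+
  have free_eq: "a = b" if ab: "a \<in> carrier H" "b \<in> carrier H" "\<phi> a c0 = \<phi> b c0" for a b
  proof -
    have "\<phi> (inv a \<otimes> b) c0 = \<phi> (inv a) (\<phi> a c0)" using ab mult[OF _ _ c0] by simp
    also have "\<dots> = \<phi> (inv a \<otimes> a) c0"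
      by (rule mult[OF inv_closed[OF ab(1)] ab(1) c0, symmetric])
    also have "\<dots> = c0" using ab one[OF c0] by simp
    finally have "inv a \<otimes> b = \<one>" using free[OF _ c0] ab by simp
    then show ?thesis using ab by (metis inv_equality inv_inv inv_closed)
  qed
  have k_act: "k (\<phi> h c) = h \<otimes> k c" if "h \<in> carrier H" "c \<in> C" for h c
    using that k[OF that(2)] k[OF cl[OF that]] mult[OF that(1) k(1)[OF that(2)] c0]
    by (intro free_eq) simp_all
  \<comment> \<open>An equivariant map from the clique onto the orbit of \<open>z\<close>. It may
    fail to be injective, since \<open>z\<close> can have a nontrivial stabiliser.\<close>
  define p where "p c = \<psi> (k c) z" for c
  have p: "p c \<in> \<Union>K" if "c \<in> C" for c
    unfolding p_def by (rule A.act_closed[OF k(1)[OF that] z])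
  have p_act: "p (\<phi> h c) = \<psi> h (p c)" if "h \<in> carrier H" "c \<in> C" for h c
    unfolding p_def k_act[OF that] by (rule A.composition_rule[OF z that(1) k(1)[OF that(2)]])
  define trace where "trace W = {c \<in> C. p c \<in> W}" for W
  \<comment> \<open>For \<open>Q\<close> empty or equal to \<open>C\<close> there may be infinitely
    many halfspaces with trace \<open>Q\<close>, and \<open>card\<close> is then zero. This is
    harmless, as such \<open>Q\<close> separate no two vertices of the clique.\<close>
  define N where "N Q = (if \<exists>c. Q = {c} then 1 else 0) + card {W \<in> \<H>. trace W = Q}" for Q
  have trace_act: "trace (\<psi> h ` W) = \<phi> h ` trace W" if h: "h \<in> carrier H" and W: "W \<in> \<H>" for h W
  proof (intro equalityI subsetI)
    fix c assume "c \<in> \<phi> h ` trace W"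
    then show "c \<in> trace (\<psi> h ` W)" using h cl p_act unfolding trace_def by auto
  next
    fix c assume "c \<in> trace (\<psi> h ` W)"
    then have c: "c \<in> C" "p c \<in> \<psi> h ` W" by (auto simp: trace_def)
    have h': "inv h \<in> carrier H" using h by simp
    define c' where "c' = \<phi> (inv h) c"
    have c': "c' \<in> C" "\<phi> h c' = c"
      using cl[OF h' c(1)] mult[OF h h' c(1)] one[OF c(1)] h by (simp_all add: c'_def)
    then have "\<psi> h (p c') \<in> \<psi> h ` W" using p_act[OF h c'(1)] c by simp
    then have "p c' \<in> W" using A.act_image_mem[OF h \<H>[OF W] p[OF c'(1)]] by simp
    then show "c \<in> \<phi> h ` trace W" using c' unfolding trace_def by blast
  qed
  have inv_img: "\<psi> (inv h) ` \<psi> h ` W = W" "\<psi> h ` \<psi> (inv h) ` W = W"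
    if "h \<in> carrier H" "W \<in> \<H>" for h W
    using A.act_image_inv[OF that(1) \<H>[OF that(2)]] A.act_image_inv'[OF that(1) \<H>[OF that(2)]] .
  have phi_inv: "\<phi> (inv h) ` \<phi> h ` Q = Q" if "h \<in> carrier H" "Q \<subseteq> C" for h Q
  proof -
    have "\<phi> (inv h) (\<phi> h c) = c" if "c \<in> C" for c
      using mult[of "inv h" h c] one \<open>h \<in> carrier H\<close> that by simp
    then show ?thesis using that(2) by force
  qed
  have trace_sub: "trace W \<subseteq> C" for W by (auto simp: trace_def)
  have N_act: "N (\<phi> h ` Q) = N Q" if h: "h \<in> carrier H" and Q: "Q \<subseteq> C" for h Q
  proof -
    have h': "inv h \<in> carrier H" using h by simp
    have "bij_betw (\<lambda>W. \<psi> h ` W) {W \<in> \<H>. trace W = Q} {W \<in> \<H>. trace W = \<phi> h ` Q}"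
    proof (rule bij_betw_byWitness[where f' = "\<lambda>W. \<psi> (inv h) ` W"])
      show "(\<lambda>W. \<psi> h ` W) ` {W \<in> \<H>. trace W = Q} \<subseteq> {W \<in> \<H>. trace W = \<phi> h ` Q}"
        using inv\<H>[OF h] trace_act[OF h] by auto
      show "(\<lambda>W. \<psi> (inv h) ` W) ` {W \<in> \<H>. trace W = \<phi> h ` Q} \<subseteq> {W \<in> \<H>. trace W = Q}"
        using inv\<H>[OF h'] trace_act[OF h'] phi_inv[OF h Q] by auto
    qed (use inv_img[OF h] in auto)
    then have "card {W \<in> \<H>. trace W = \<phi> h ` Q} = card {W \<in> \<H>. trace W = Q}"
      by (rule bij_betw_same_card[symmetric])
    moreover have "(\<exists>c. \<phi> h ` Q = {c}) \<longleftrightarrow> (\<exists>c. Q = {c})"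
    proof
      assume "\<exists>c. \<phi> h ` Q = {c}"
      then obtain c where "\<phi> h ` Q = {c}" by blast
      then have "\<phi> (inv h) ` \<phi> h ` Q = {\<phi> (inv h) c}" by simp
      then show "\<exists>c. Q = {c}" using phi_inv[OF h Q] by auto
    qed auto
    ultimately show ?thesis by (simp add: N_def)
  qed
  have S_eq: "S (p c) (p c') = {W \<in> \<H>. (c \<in> trace W) \<noteq> (c' \<in> trace W)}" if "c \<in> C" "c' \<in> C" for c c'
    using that by (auto simp: S_def trace_def)
  have finS: "finite (S (p c) (p c'))" if "c \<in> C" "c' \<in> C" for c c'
    using fin\<H> p that by (simp add: S_def)
  have fin: "finite (cuts N C c c')" if cc: "c \<in> C" "c' \<in> C" for c c'
  proof (rule finite_subset)
    let ?B = "{{c}, {c'}} \<union> trace ` S (p c) (p c')"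
    show "finite (Sigma ?B (\<lambda>Q. {..<N Q}))" using finS[OF cc] by (intro finite_SigmaI) auto
    show "cuts N C c c' \<subseteq> Sigma ?B (\<lambda>Q. {..<N Q})"
    proof
      fix s assume "s \<in> cuts N C c c'"
      then obtain Q i where s: "s = (Q, i)" "i < N Q" "(c \<in> Q) \<noteq> (c' \<in> Q)"
        by (auto simp: cuts_def)
      have "Q \<in> ?B"
      proof (cases "\<exists>a. Q = {a}")
        case True
        then show ?thesis using s by auto
      next
        case False
        then have "card {W \<in> \<H>. trace W = Q} \<noteq> 0" using s by (simp add: N_def)
        then obtain W where "W \<in> \<H>" "trace W = Q" by (metis (mono_tags, lifting) card.empty empty_Collect_eq)
        then show ?thesis using s S_eq[OF cc] by blast
      qed
      then show "s \<in> Sigma ?B (\<lambda>Q. {..<N Q})" using s by blast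
    qed
  qed
  \<comment> \<open>Grouping the separating halfspaces by trace bounds their number by the weight
    between \<open>c\<close> and \<open>c'\<close>.\<close>
  have card_le: "card (S (p c) (p c')) \<le> card (cuts N C c c')" if cc: "c \<in> C" "c' \<in> C" for c c'
  proof -
    let ?S = "S (p c) (p c')"
    have fibre: "{W \<in> \<H>. trace W = Q} = {W \<in> ?S. trace W = Q}" if "Q \<in> trace ` ?S" for Q
      using that unfolding S_eq[OF cc] by auto
    have "card ?S = (\<Sum>Q\<in>trace ` ?S. card {W \<in> ?S. trace W = Q})"
      using sum.image_gen[OF finS[OF cc], of "\<lambda>_. 1::nat" trace] by simp
    also have "\<dots> \<le> (\<Sum>Q\<in>trace ` ?S. N Q)"
      by (intro sum_mono) (simp add: N_def fibre)
    also have "\<dots> = card (Sigma (trace ` ?S) (\<lambda>Q. {..<N Q}))"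
      using finS[OF cc] by simp
    also have "\<dots> \<le> card (cuts N C c c')"
      using trace_sub unfolding S_eq[OF cc] cuts_def
      by (intro card_mono fin[OF cc, unfolded cuts_def]) auto
    finally show ?thesis .
  qed
  have S_act: "card (S (\<psi> h x) (\<psi> h y)) = card (S x y)"
    if h: "h \<in> carrier H" and xy: "x \<in> \<Union>K" "y \<in> \<Union>K" for h x y
  proof -
    have h': "inv h \<in> carrier H" using h by simp
    have sub: "(\<lambda>W. \<psi> h ` W) ` S x y \<subseteq> S (\<psi> h x) (\<psi> h y)"
      if h: "h \<in> carrier H" and xy: "x \<in> \<Union>K" "y \<in> \<Union>K" for h x y
    proof
      fix W' assume "W' \<in> (\<lambda>W. \<psi> h ` W) ` S x y"
      then obtain W where W: "W' = \<psi> h ` W" "W \<in> \<H>" "(x \<in> W) \<noteq> (y \<in> W)" by (auto simp: S_def)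
      then show "W' \<in> S (\<psi> h x) (\<psi> h y)"
        unfolding S_def using inv\<H>[OF h W(2)] A.act_image_mem[OF h \<H>[OF W(2)] xy(1)]
          A.act_image_mem[OF h \<H>[OF W(2)] xy(2)] by simp
    qed
    have "bij_betw (\<lambda>W. \<psi> h ` W) (S x y) (S (\<psi> h x) (\<psi> h y))"
    proof (rule bij_betw_byWitness[where f' = "\<lambda>W. \<psi> (inv h) ` W"])
      show "(\<lambda>W. \<psi> (inv h) ` W) ` S (\<psi> h x) (\<psi> h y) \<subseteq> S x y"
        using sub[OF h' A.act_closed[OF h xy(1)] A.act_closed[OF h xy(2)]]
          A.act_inv[OF h xy(1)] A.act_inv[OF h xy(2)] by simp
    qed (use inv_img[OF h] sub[OF h xy] in \<open>auto simp: S_def\<close>)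
    then show ?thesis by (rule bij_betw_same_card[symmetric])
  qed
  have balls: "finite {c' \<in> C. card (cuts N C c c') \<le> R}" if c: "c \<in> C" for c R
  proof (rule finite_imageD)
    \<comment> \<open>The position of \<open>c'\<close> relative to \<open>c\<close>: moving back by
      \<open>k c\<close> turns the halfspaces between their images into those between
      \<open>z\<close> and its translate by this element, where properness applies.\<close>
    let ?f = "\<lambda>c'. inv (k c) \<otimes> k c'"
    have "?f ` {c' \<in> C. card (cuts N C c c') \<le> R} \<subseteq>
        {g \<in> carrier H. card {W \<in> \<H>. (z \<in> W) \<noteq> (\<psi> g z \<in> W)} \<le> R}"
    proof
      fix g assume "g \<in> ?f ` {c' \<in> C. card (cuts N C c c') \<le> R}"
      then obtain c' where c': "g = ?f c'" "c' \<in> C" "card (cuts N C c c') \<le> R" by blast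
      have g: "g \<in> carrier H" using c'(1) k(1)[OF c] k(1)[OF c'(2)] by simp
      have "k c \<otimes> g = k c'"
        unfolding c'(1) using k(1)[OF c] k(1)[OF c'(2)] by (simp add: m_assoc[symmetric])
      then have "p c' = \<psi> (k c) (\<psi> g z)"
        unfolding p_def using A.composition_rule[OF z k(1)[OF c] g] by simp
      then have "card (S (p c) (p c')) = card (S z (\<psi> g z))"
        using S_act[OF k(1)[OF c] z A.act_closed[OF g z]] by (simp add: p_def)
      then show "g \<in> {g \<in> carrier H. card {W \<in> \<H>. (z \<in> W) \<noteq> (\<psi> g z \<in> W)} \<le> R}"
        using card_le[OF c c'(2)] c'(3) g by (simp add: S_def)
    qed
    then show "finite (?f ` {c' \<in> C. card (cuts N C c c') \<le> R})"
      using prop\<H> by (rule finite_subset)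
    show "inj_on ?f {c' \<in> C. card (cuts N C c c') \<le> R}"
    proof (rule inj_onI)
      fix a b assume ab: "a \<in> {c' \<in> C. card (cuts N C c c') \<le> R}" "b \<in> {c' \<in> C. card (cuts N C c c') \<le> R}"
        "?f a = ?f b"
      then have aC: "a \<in> C" and bC: "b \<in> C" by simp_all
      have kk: "k a = k b"
        using ab(3) k(1)[OF c] k(1)[OF aC] k(1)[OF bC] by (metis inv_closed Units_eq Units_l_cancel)
      have "a = \<phi> (k a) c0" by (rule k(2)[OF aC, symmetric])
      also have "\<dots> = b" unfolding kk by (rule k(2)[OF bC])
      finally show "a = b" .
    qed
  qed
  have "clique_weight \<phi> (carrier H) C N"
    unfolding clique_weight_def
  proof (intro conjI ballI allI impI)
    show "0 < N {c}" for c by (simp add: N_def)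
  qed (rule N_act fin balls, assumption+)+
  then show ?thesis by blast
qed

section \<open>Pushing the weights to the graph\<close>

text \<open>\<open>N\<close> gives a weight on the clique of each edge, with no compatibility
  between different edges. A single consistent weight on cuts of \<open>V\<close> arises by
  selecting one edge per orbit of hyperplanes.\<close>

locale weighted_action = quasi_median V E + A: group_action G V \<phi>
  for V :: "'v set" and E :: "'v set set" and G :: "('g, 'm) monoid_scheme" (structure)
    and \<phi> :: "'g \<Rightarrow> 'v \<Rightarrow> 'v" +
  fixes N :: "'v set \<Rightarrow> 'v set \<Rightarrow> nat"
  assumes edges: "\<And>g. g \<in> carrier G \<Longrightarrow> (\<lambda>e. \<phi> g ` e) ` E = E"
    and topical: "topical_action G V E \<phi>"
    and weights: "\<And>e. e \<in> E \<Longrightarrow> clique_weight \<phi> (set_stab G \<phi> (clq e)) (clq e) (N e)"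
begin

sublocale group G by (rule A.group)

lemma edge_act: "g \<in> carrier G \<Longrightarrow> e \<in> E \<Longrightarrow> \<phi> g ` e \<in> E"
  using edges by blast

lemma edge_sub: "e \<in> E \<Longrightarrow> e \<subseteq> V"
  using edge_ex edge_V by blast

lemma adj_act: "g \<in> carrier G \<Longrightarrow> adj u v \<Longrightarrow> adj (\<phi> g u) (\<phi> g v)"
  using edge_act[of g "{u, v}"] by simp

lemma adj_act_iff:
  assumes "g \<in> carrier G" "u \<in> V" "v \<in> V"
  shows "adj (\<phi> g u) (\<phi> g v) \<longleftrightarrow> adj u v"
  using adj_act[OF assms(1)] adj_act[of "inv g" "\<phi> g u" "\<phi> g v"] assms by (auto simp: A.act_inv)

lemma dist_act_le: "g \<in> carrier G \<Longrightarrow> u \<in> V \<Longrightarrow> v \<in> V \<Longrightarrow> dst (\<phi> g u) (\<phi> g v) \<le> dst u v"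
  using edge_act A.surj_prop by (intro dist_map_le) auto

lemma dist_act:
  assumes "g \<in> carrier G" "u \<in> V" "v \<in> V"
  shows "dst (\<phi> g u) (\<phi> g v) = dst u v"
  using dist_act_le[OF assms] dist_act_le[of "inv g" "\<phi> g u" "\<phi> g v"] assms
  by (simp add: A.act_inv A.act_closed)

lemma clq_act:
  assumes g: "g \<in> carrier G" and e: "e \<subseteq> V"
  shows "clq (\<phi> g ` e) = \<phi> g ` clq e"
proof (intro equalityI subsetI)
  fix x assume x: "x \<in> clq (\<phi> g ` e)"
  then have "x \<in> V" by (simp add: clq_def)
  then obtain y where y: "y \<in> V" "x = \<phi> g y" using A.surj_prop[OF g] by blast
  have "y = z \<or> adj y z" if "z \<in> e" for z
  proof -
    have "z \<in> V" using that e by blast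
    have "\<phi> g y = \<phi> g z \<or> adj (\<phi> g y) (\<phi> g z)" using x that unfolding clq_def y(2) by blast
    then show ?thesis
      using A.act_eq_iff[OF g y(1) \<open>z \<in> V\<close>] adj_act_iff[OF g y(1) \<open>z \<in> V\<close>] by blast
  qed
  then show "x \<in> \<phi> g ` clq e" using y by (auto simp: clq_def)
next
  fix x assume "x \<in> \<phi> g ` clq e"
  then obtain y where y: "y \<in> V" "x = \<phi> g y" "\<And>z. z \<in> e \<Longrightarrow> y = z \<or> adj y z"
    unfolding clq_def by blast
  have "\<phi> g y = \<phi> g z \<or> adj (\<phi> g y) (\<phi> g z)" if "z \<in> e" for z
    using y(3)[OF that] adj_act[OF g] by metis
  then show "x \<in> clq (\<phi> g ` e)" using A.act_closed[OF g y(1)] unfolding clq_def y(2) by simp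
qed

lemma gate_act:
  assumes "g \<in> carrier G" "x \<in> V" "C \<subseteq> V" "gate C x c"
  shows "gate (\<phi> g ` C) (\<phi> g x) (\<phi> g c)"
proof -
  have c: "c \<in> C" "c \<in> V" using assms by (auto simp: gate_def)
  have "dst (\<phi> g x) (\<phi> g c) < dst (\<phi> g x) (\<phi> g c')" if c': "c' \<in> C" "\<phi> g c' \<noteq> \<phi> g c" for c'
  proof -
    have "c' \<noteq> c" "c' \<in> V" using c' assms by auto
    then show ?thesis using assms c c' dist_act[OF assms(1,2)] by (simp add: gate_def)
  qed
  then show ?thesis using c unfolding gate_def by blast
qed

lemma same_gate_act:
  assumes "g \<in> carrier G" "e \<subseteq> V" "x \<in> V" "y \<in> V" "same_gate e x y"
  shows "same_gate (\<phi> g ` e) (\<phi> g x) (\<phi> g y)"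
  using assms(5) gate_act[OF assms(1,3) clq_sub] gate_act[OF assms(1,4) clq_sub]
  unfolding same_gate_def clq_act[OF assms(1,2)] by blast

lemma elementary_parallel_act:
  assumes "g \<in> carrier G" "(e, e') \<in> elementary_parallel E"
  shows "(\<phi> g ` e, \<phi> g ` e') \<in> elementary_parallel E"
  using assms(2)
proof (cases rule: elementary_parallel_cases)
  case (tri a b c)
  then show ?thesis using triangle_parallel[of "\<phi> g a" "\<phi> g b" "\<phi> g c"] adj_act[OF assms(1)] by simp
next
  case (sq a b c d)
  then have V: "a \<in> V" "b \<in> V" "c \<in> V" "d \<in> V" using edge_V by (auto simp: square_def)
  have "square (\<phi> g a) (\<phi> g b) (\<phi> g c) (\<phi> g d)"
    using sq(3) V assms(1) by (simp add: square_def adj_act_iff A.act_eq_iff)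
  then show ?thesis using square_parallel sq by simp
qed

lemma par_act:
  assumes "g \<in> carrier G" "(e, e') \<in> par"
  shows "(\<phi> g ` e, \<phi> g ` e') \<in> par"
  using assms(2)
proof (induction rule: rtrancl_induct)
  case (step f f')
  then show ?case using elementary_parallel_act[OF assms(1)] rtrancl.rtrancl_into_rtrancl by metis
qed simp

section \<open>Cuts pulled back along the gate map\<close>

definition gate_cut :: "'v set \<Rightarrow> 'v set \<Rightarrow> 'v set" where
  "gate_cut e Q = {x \<in> V. \<exists>c\<in>Q. gate (clq e) x c}"

lemma cut_sub: "gate_cut e Q \<subseteq> V"
  by (auto simp: gate_cut_def)

lemma cut_conv_fibre: "gate_cut e Q = (\<Union>c\<in>Q. fibre e c)"
  by (auto simp: gate_cut_def fibre_def)

lemma cut_mem_iff: "x \<in> V \<Longrightarrow> gate (clq e) x c \<Longrightarrow> x \<in> gate_cut e Q \<longleftrightarrow> c \<in> Q"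
  unfolding gate_cut_def using gate_unique by blast

lemma cut_clq: "e \<in> E \<Longrightarrow> Q \<subseteq> clq e \<Longrightarrow> gate_cut e Q \<inter> clq e = Q"
  using cut_mem_iff gate_self clq_sub by blast

lemma cut_same_gate: "x \<in> V \<Longrightarrow> y \<in> V \<Longrightarrow> same_gate e x y \<Longrightarrow> x \<in> gate_cut e Q \<longleftrightarrow> y \<in> gate_cut e Q"
  unfolding same_gate_def by (elim exE conjE) (simp only: cut_mem_iff)

text \<open>Here topicality enters. \<open>h\<close> preserves the hyperplane of \<open>e\<close>
  but may move its clique; an element of the clique stabiliser permutes the sectors in the same way.
  As fibres are sectors, the translated cut is again pulled back from the same clique.\<close>

lemma cut_stab:
  assumes e: "e \<in> E" and h: "h \<in> carrier G" and par: "(e, \<phi> h ` e) \<in> par" and Q: "Q \<subseteq> clq e"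
  shows "\<exists>h'\<in>set_stab G \<phi> (clq e). \<phi> h ` gate_cut e Q = gate_cut e (\<phi> h' ` Q)"
proof -
  have h': "inv h \<in> carrier G" using h by simp
  have sub: "(\<lambda>f. \<phi> g ` f) ` (par `` {e}) \<subseteq> par `` {e}" if g: "g \<in> carrier G" "(e, \<phi> g ` e) \<in> par" for g
    using par_act[OF g(1)] g(2) by (auto intro: rtrancl_trans)
  have "(\<phi> (inv h) ` e, \<phi> (inv h) ` \<phi> h ` e) \<in> par" by (rule par_act[OF h' par])
  then have "(e, \<phi> (inv h) ` e) \<in> par" using A.act_image_inv[OF h edge_sub[OF e]] par_sym by simp
  then have sub': "(\<lambda>f. \<phi> (inv h) ` f) ` (par `` {e}) \<subseteq> par `` {e}" using sub[OF h'] by blast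
  have "(\<lambda>f. \<phi> h ` f) ` (par `` {e}) = par `` {e}"
  proof (rule equalityI[OF sub[OF h par]], rule subsetI)
    fix f assume f: "f \<in> par `` {e}"
    then have "f \<subseteq> V" using par_edge e edge_sub by blast
    then have "f = \<phi> h ` \<phi> (inv h) ` f" using A.act_image_inv'[OF h] by simp
    moreover have "\<phi> (inv h) ` f \<in> par `` {e}" using f sub' by blast
    ultimately show "f \<in> (\<lambda>f. \<phi> h ` f) ` (par `` {e})" by (rule image_eqI)
  qed
  then have "h \<in> hyperplane_stab G \<phi> (par `` {e})" using h by (simp add: hyperplane_stab_def)
  then have "\<exists>k\<in>set_stab G \<phi> (clq e). \<forall>S\<in>sectors V E (par `` {e}). \<phi> h ` S = \<phi> k ` S"
    by (rule topical[unfolded topical_action_def, rule_format,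
          OF hyperplane_class[OF e] conjI[OF clq_is_clique[OF e] clq_dual[OF e]]])
  then obtain k where k: "k \<in> set_stab G \<phi> (clq e)"
    "\<forall>S\<in>sectors V E (par `` {e}). \<phi> h ` S = \<phi> k ` S" by blast
  have kc: "k \<in> carrier G" "\<phi> k ` clq e = clq e" using k(1) by (auto simp: set_stab_def)
  \<comment> \<open>\<open>k\<close> preserves the clique as well as distances, so it commutes with
    the gate map.\<close>
  have fib: "\<phi> k ` fibre e c = fibre e (\<phi> k c)" if "c \<in> clq e" for c
  proof (intro equalityI subsetI)
    fix x assume "x \<in> \<phi> k ` fibre e c"
    then show "x \<in> fibre e (\<phi> k c)"
      using gate_act[OF kc(1) _ clq_sub] kc(2) A.act_closed[OF kc(1)] unfolding fibre_def by force
  next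
    fix x assume x: "x \<in> fibre e (\<phi> k c)"
    then have "x \<in> V" by (simp add: fibre_def)
    then obtain y where y: "y \<in> V" "x = \<phi> k y" using A.surj_prop[OF kc(1)] by blast
    obtain c' where c': "gate (clq e) y c'" using gate_ex[OF y(1) e] by blast
    then have "gate (clq e) x (\<phi> k c')" using gate_act[OF kc(1) y(1) clq_sub] kc(2) y(2) by metis
    then have "\<phi> k c' = \<phi> k c" using x gate_unique by (auto simp: fibre_def)
    moreover have "c' \<in> V" "c \<in> V" using c' that clq_sub by (auto simp: gate_def)
    ultimately have "c' = c" using A.act_eq_iff[OF kc(1)] by simp
    then show "x \<in> \<phi> k ` fibre e c" using c' y by (auto simp: fibre_def)
  qed
  have "\<phi> h ` fibre e c = fibre e (\<phi> k c)" if "c \<in> Q" for c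
  proof -
    have "c \<in> clq e" using that Q by blast
    then show ?thesis using k(2) fibre_sector[OF e] fib by simp
  qed
  then have "\<phi> h ` gate_cut e Q = gate_cut e (\<phi> k ` Q)"
    unfolding cut_conv_fibre by (simp add: image_UN)
  then show ?thesis using k(1) by blast
qed

section \<open>Orbits of hyperplanes and the weight of a cut\<close>

definition linked :: "'v set \<Rightarrow> 'v set \<Rightarrow> bool" where
  "linked e e' \<longleftrightarrow> (\<exists>g\<in>carrier G. (\<phi> g ` e, e') \<in> par)"

lemma linked_refl: "e \<in> E \<Longrightarrow> linked e e"
  unfolding linked_def by (rule bexI[of _ "\<one>"]) (auto simp: A.act_image_one edge_sub)

lemma linked_sym:
  assumes "e \<in> E" "linked e e'"
  shows "linked e' e"
proof -
  obtain g where g: "g \<in> carrier G" "(\<phi> g ` e, e') \<in> par" using assms by (auto simp: linked_def)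
  have "(\<phi> (inv g) ` \<phi> g ` e, \<phi> (inv g) ` e') \<in> par" using par_act[OF _ g(2)] g(1) by simp
  then have "(\<phi> (inv g) ` e', e) \<in> par"
    using A.act_image_inv[OF g(1) edge_sub[OF assms(1)]] par_sym by simp
  then show ?thesis unfolding linked_def using g(1) inv_closed by blast
qed

lemma linked_trans:
  assumes "e \<in> E" "linked e e'" "linked e' e''"
  shows "linked e e''"
proof -
  obtain g h where gh: "g \<in> carrier G" "(\<phi> g ` e, e') \<in> par" "h \<in> carrier G" "(\<phi> h ` e', e'') \<in> par"
    using assms by (auto simp: linked_def)
  have "(\<phi> h ` \<phi> g ` e, e'') \<in> par" using par_act[OF gh(3,2)] gh(4) by (rule rtrancl_trans)
  then have "(\<phi> (h \<otimes> g) ` e, e'') \<in> par"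
    using A.act_image_comp[OF gh(3,1) edge_sub[OF assms(1)]] by simp
  then show ?thesis unfolding linked_def using gh m_closed by blast
qed

text \<open>Linked edges give \<open>SOME\<close> the same predicate, so \<open>rep\<close> selects
  one edge for each orbit of hyperplanes.\<close>

definition rep :: "'v set \<Rightarrow> 'v set" where
  "rep e = (SOME e'. e' \<in> E \<and> linked e e')"

lemma rep: assumes "e \<in> E" shows "rep e \<in> E" "linked e (rep e)"
  using someI_ex[of "\<lambda>e'. e' \<in> E \<and> linked e e'"] linked_refl assms unfolding rep_def by blast+

lemma rep_eq:
  assumes "e \<in> E" "f \<in> E" "linked (rep e) (rep f)"
  shows "rep e = rep f"
proof -
  have "linked e (rep f)" using linked_trans[OF assms(1) rep(2)[OF assms(1)] assms(3)] .
  then have "linked e f" using linked_trans[OF assms(1)] linked_sym[OF assms(2) rep(2)[OF assms(2)]] by blast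
  then have "linked e x \<longleftrightarrow> linked f x" for x
    using linked_trans[OF assms(1)] linked_trans[OF assms(2)] linked_sym[OF assms(1)] by blast
  then show ?thesis unfolding rep_def by simp
qed

text \<open>\<open>Q\<close> is proper and nonempty because the empty set and the whole clique pull
  back to the empty set and \<open>V\<close> for every hyperplane, and so could not carry a
  well-defined weight.\<close>

definition translated_cut :: "'v set \<Rightarrow> nat \<Rightarrow> bool" where
  "translated_cut P m \<longleftrightarrow> (\<exists>e\<in>rep ` E. \<exists>g\<in>carrier G. \<exists>Q. Q \<subseteq> clq e \<and> Q \<noteq> {} \<and> Q \<noteq> clq e \<and>
     P = \<phi> g ` gate_cut e Q \<and> m = N e Q)"

text \<open>The default zero keeps all other subsets of \<open>V\<close> out of
  \<open>cuts\<close>.\<close>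

definition weight :: "'v set \<Rightarrow> nat" where
  "weight P = (if \<exists>m. translated_cut P m then SOME m. translated_cut P m else 0)"

lemma rep_E: "e \<in> rep ` E \<Longrightarrow> e \<in> E"
  using rep by blast

text \<open>A cut remembers its hyperplane, namely that of any edge it separates. So every
  presentation of \<open>P\<close> can be rewritten with the prescribed representative
  \<open>e\<close> and translation \<open>g\<close> of that hyperplane, without changing the
  weight.\<close>

lemma translated_cut_at:
  assumes P: "translated_cut P m" and uv: "adj u v" "(u \<in> P) \<noteq> (v \<in> P)"
    and e: "e \<in> rep ` E" and g: "g \<in> carrier G" and par: "(\<phi> g ` e, {u, v}) \<in> par"
  shows "\<exists>Q. Q \<subseteq> clq e \<and> Q \<noteq> {} \<and> Q \<noteq> clq e \<and> P = \<phi> g ` gate_cut e Q \<and> m = N e Q"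
proof -
  obtain e1 g1 Q1 where e1: "e1 \<in> rep ` E" and g1: "g1 \<in> carrier G"
    and Q1: "Q1 \<subseteq> clq e1" "Q1 \<noteq> {}" "Q1 \<noteq> clq e1" and P: "P = \<phi> g1 ` gate_cut e1 Q1" and m: "m = N e1 Q1"
    using P unfolding translated_cut_def by blast
  have eE: "e \<in> E" "e1 \<in> E" using e e1 rep_E by blast+
  have g': "inv g \<in> carrier G" "inv g1 \<in> carrier G" using g g1 by simp_all
  have V: "u \<in> V" "v \<in> V" using uv edge_V by blast+
  define u1 where "u1 = \<phi> (inv g1) u"
  define v1 where "v1 = \<phi> (inv g1) v"
  have uv1: "u1 \<in> V" "v1 \<in> V" "u = \<phi> g1 u1" "v = \<phi> g1 v1" "adj u1 v1"
    using A.act_closed[OF g'(2)] V A.act_inv'[OF g1] adj_act[OF g'(2) uv(1)]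
    by (simp_all add: u1_def v1_def)
  have "(u1 \<in> gate_cut e1 Q1) \<noteq> (v1 \<in> gate_cut e1 Q1)"
    using uv(2) A.act_image_mem[OF g1 cut_sub] uv1(1,2) unfolding P uv1(3,4) by simp
  then have "\<not> same_gate e1 u1 v1" using cut_same_gate uv1(1,2) by blast
  then have "(e1, {u1, v1}) \<in> par" using same_gate_or_par[OF eE(2) uv1(5)] by blast
  then have "(\<phi> g1 ` e1, \<phi> g1 ` {u1, v1}) \<in> par" by (rule par_act[OF g1])
  then have "(\<phi> g1 ` e1, {u, v}) \<in> par" using uv1(3,4) by simp
  then have "(\<phi> g1 ` e1, \<phi> g ` e) \<in> par" using par_sym[OF par] by (rule rtrancl_trans)
  then have "(\<phi> (inv g) ` \<phi> g1 ` e1, \<phi> (inv g) ` \<phi> g ` e) \<in> par" by (rule par_act[OF g'(1)])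
  \<comment> \<open>\<open>h\<close> compares the two presentations: it carries the hyperplane of
    \<open>e1\<close> to that of \<open>e\<close>. Two representatives of one orbit coincide, so
    \<open>h\<close> stabilises this hyperplane.\<close>
  moreover define h where "h = inv g \<otimes> g1"
  have h: "h \<in> carrier G" "g \<otimes> h = g1" using g g1 by (simp_all add: h_def m_assoc[symmetric])
  ultimately have par1: "(\<phi> h ` e1, e) \<in> par"
    using A.act_image_comp[OF g'(1) g1 edge_sub[OF eE(2)]] A.act_image_inv[OF g edge_sub[OF eE(1)]]
    by (simp add: h_def)
  then have "linked e1 e" unfolding linked_def using h by blast
  then have "e1 = e" using rep_eq e e1 by blast
  then have "(e, \<phi> h ` e) \<in> par" using par1 par_sym by blast
  then obtain k where k: "k \<in> set_stab G \<phi> (clq e)" "\<phi> h ` gate_cut e Q1 = gate_cut e (\<phi> k ` Q1)"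
    using cut_stab[OF eE(1) h(1)] Q1(1) \<open>e1 = e\<close> by blast
  have "P = \<phi> g ` \<phi> h ` gate_cut e Q1"
    unfolding P \<open>e1 = e\<close> using A.act_image_comp[OF g h(1) cut_sub] h(2) by simp
  moreover have "N e (\<phi> k ` Q1) = N e Q1"
    using weights[OF eE(1)] k(1) Q1(1) \<open>e1 = e\<close> unfolding clique_weight_def by blast
  moreover have kc: "k \<in> carrier G" "\<phi> k ` clq e = clq e" using k(1) by (auto simp: set_stab_def)
  moreover have "\<phi> k ` Q1 \<subseteq> clq e" using kc(2) Q1(1) \<open>e1 = e\<close> by blast
  moreover have "\<phi> k ` Q1 \<noteq> clq e"
  proof
    assume "\<phi> k ` Q1 = clq e"
    then have "\<phi> k ` Q1 = \<phi> k ` clq e" using kc(2) by simp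
    then have "Q1 = clq e"
      using inj_on_image_eq_iff[OF A.inj_prop[OF kc(1)]] Q1(1) \<open>e1 = e\<close> clq_sub by (metis subset_trans)
    then show False using Q1(3) \<open>e1 = e\<close> by simp
  qed
  moreover have "\<phi> k ` Q1 \<noteq> {}" using Q1(2) by simp
  ultimately show ?thesis using m \<open>e1 = e\<close> k(2) by (intro exI[of _ "\<phi> k ` Q1"]) simp
qed

lemma cut_image_inj:
  assumes "e \<in> E" "g \<in> carrier G" "Q \<subseteq> clq e" "Q' \<subseteq> clq e" "\<phi> g ` gate_cut e Q = \<phi> g ` gate_cut e Q'"
  shows "Q = Q'"
proof -
  have "gate_cut e Q = gate_cut e Q'" using inj_on_image_eq_iff[OF A.inj_prop[OF assms(2)] cut_sub cut_sub] assms(5) by blast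
  then show ?thesis using cut_clq[OF assms(1)] assms(3,4) by metis
qed

text \<open>Some edge of the translated clique is separated by the cut. Rewriting the other
  presentation with the same \<open>e\<close> and \<open>g\<close> gives the same \<open>Q\<close>,
  because a pulled-back cut meets its clique in \<open>Q\<close>.\<close>

lemma translated_cut_unique:
  assumes "translated_cut P m" "translated_cut P m'"
  shows "m = m'"
proof -
  obtain e g Q where e: "e \<in> rep ` E" and g: "g \<in> carrier G"
    and Q: "Q \<subseteq> clq e" "Q \<noteq> {}" "Q \<noteq> clq e" and P: "P = \<phi> g ` gate_cut e Q" and m': "m' = N e Q"
    using assms(2) unfolding translated_cut_def by blast
  have eE: "e \<in> E" using e rep_E by blast
  obtain a b where ab: "a \<in> Q" "b \<in> clq e" "b \<notin> Q" using Q by blast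
  have abe: "a \<in> clq e" "a \<noteq> b" "a \<in> V" "b \<in> V" using ab Q clq_sub by auto
  have mem: "a \<in> gate_cut e Q" "b \<notin> gate_cut e Q" using cut_clq[OF eE Q(1)] ab by blast+
  have "adj a b" using clq_eq[OF eE abe(1) ab(2) abe(2)] by blast
  then have "adj (\<phi> g a) (\<phi> g b)" by (rule adj_act[OF g])
  moreover have "(\<phi> g a \<in> P) \<noteq> (\<phi> g b \<in> P)"
    unfolding P using A.act_image_mem[OF g cut_sub] abe(3,4) mem by simp
  moreover have "(\<phi> g ` e, {\<phi> g a, \<phi> g b}) \<in> par"
    using par_act[OF g clq_par[OF eE abe(1) ab(2) abe(2)]] by simp
  ultimately obtain Q' where Q': "Q' \<subseteq> clq e" "P = \<phi> g ` gate_cut e Q'" "m = N e Q'"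
    using translated_cut_at[OF assms(1) _ _ e g] by blast
  have "Q = Q'" using cut_image_inj[OF eE g Q(1) Q'(1)] P Q'(2) by simp
  then show ?thesis using Q'(3) m' by simp
qed

abbreviation sep where "sep \<equiv> cuts weight V"

lemma weight_eq: "translated_cut P m \<Longrightarrow> weight P = m"
  unfolding weight_def using translated_cut_unique by (auto intro: some_equality)

lemma weight_pos: "0 < weight P \<Longrightarrow> translated_cut P (weight P)"
  unfolding weight_def by (auto intro: someI_ex split: if_splits)

lemma translated_cut_act:
  assumes "g \<in> carrier G" "translated_cut P m"
  shows "translated_cut (\<phi> g ` P) m"
proof -
  obtain e h Q where *: "e \<in> rep ` E" "h \<in> carrier G" "Q \<subseteq> clq e" "Q \<noteq> {}" "Q \<noteq> clq e"
      "P = \<phi> h ` gate_cut e Q" "m = N e Q"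
    using assms(2) unfolding translated_cut_def by blast
  have "\<phi> g ` P = \<phi> (g \<otimes> h) ` gate_cut e Q"
    unfolding *(6) using A.act_image_comp[OF assms(1) *(2) cut_sub] by simp
  then show ?thesis unfolding translated_cut_def using * m_closed[OF assms(1) *(2)] by blast
qed

lemma weight_act:
  assumes g: "g \<in> carrier G" and P: "P \<subseteq> V"
  shows "weight (\<phi> g ` P) = weight P"
proof (cases "\<exists>m. translated_cut P m")
  case True
  then show ?thesis using translated_cut_act[OF g] weight_eq by metis
next
  case False
  have "\<not> translated_cut (\<phi> g ` P) m" for m
    using translated_cut_act[of "inv g" "\<phi> g ` P" m] False g A.act_image_inv[OF g P] by auto
  then show ?thesis using False by (simp add: weight_def)
qed

text \<open>Cuts of positive weight separating the ends of an edge all come from its hyperplane, so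
  the weights seen by the edge are those of the representative clique between the two gates.\<close>

lemma cuts_edge:
  assumes e: "e \<in> rep ` E" and g: "g \<in> carrier G" and uv: "adj u v" and par: "(\<phi> g ` e, {u, v}) \<in> par"
    and cc: "gate (clq e) (\<phi> (inv g) u) c" "gate (clq e) (\<phi> (inv g) v) c'"
  shows "bij_betw (\<lambda>(Q, i). (\<phi> g ` gate_cut e Q, i)) (cuts (N e) (clq e) c c') (sep u v)"
proof -
  have eE: "e \<in> E" using e rep_E by blast
  have V: "u \<in> V" "v \<in> V" using uv edge_V by blast+
  have g': "inv g \<in> carrier G" using g by simp
  have V': "\<phi> (inv g) u \<in> V" "\<phi> (inv g) v \<in> V" using A.act_closed[OF g'] V by blast+
  have mem: "u \<in> \<phi> g ` gate_cut e Q \<longleftrightarrow> c \<in> Q" "v \<in> \<phi> g ` gate_cut e Q \<longleftrightarrow> c' \<in> Q" for Q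
    using A.act_image_mem[OF g cut_sub V'(1)] A.act_image_mem[OF g cut_sub V'(2)]
      A.act_inv'[OF g] V cut_mem_iff[OF V'(1) cc(1)] cut_mem_iff[OF V'(2) cc(2)] by simp_all
  have c: "c \<in> clq e" "c' \<in> clq e" using cc by (auto simp: gate_def)
  have tr: "translated_cut (\<phi> g ` gate_cut e Q) (N e Q)"
    if "Q \<subseteq> clq e" "(c \<in> Q) \<noteq> (c' \<in> Q)" for Q
    unfolding translated_cut_def using e g that c by (intro bexI[of _ e] bexI[of _ g] exI[of _ Q]) auto
  show ?thesis unfolding bij_betw_def
  proof (intro conjI)
    show "inj_on (\<lambda>(Q, i). (\<phi> g ` gate_cut e Q, i)) (cuts (N e) (clq e) c c')"
      using cut_image_inj[OF eE g] by (auto simp: inj_on_def cuts_def)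
    show "(\<lambda>(Q, i). (\<phi> g ` gate_cut e Q, i)) ` cuts (N e) (clq e) c c' = sep u v"
    proof (intro equalityI subsetI)
      fix s assume "s \<in> (\<lambda>(Q, i). (\<phi> g ` gate_cut e Q, i)) ` cuts (N e) (clq e) c c'"
      then obtain Q i where Q: "s = (\<phi> g ` gate_cut e Q, i)" "Q \<subseteq> clq e" "i < N e Q" "(c \<in> Q) \<noteq> (c' \<in> Q)"
        by (auto simp: cuts_def)
      then show "s \<in> sep u v"
        using weight_eq[OF tr[OF Q(2,4)]] mem A.act_image_subset[OF g cut_sub]
        by (simp add: cuts_def)
    next
      fix s assume "s \<in> sep u v"
      then obtain P i where P: "s = (P, i)" "i < weight P" "(u \<in> P) \<noteq> (v \<in> P)"
        by (auto simp: cuts_def)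
      then have "translated_cut P (weight P)" by (intro weight_pos) simp
      then obtain Q where Q: "Q \<subseteq> clq e" "P = \<phi> g ` gate_cut e Q" "weight P = N e Q"
        using translated_cut_at[OF _ uv P(3) e g par] by blast
      then have "(Q, i) \<in> cuts (N e) (clq e) c c'" using P mem by (auto simp: cuts_def)
      then show "s \<in> (\<lambda>(Q, i). (\<phi> g ` gate_cut e Q, i)) ` cuts (N e) (clq e) c c'"
        using Q P by (intro rev_image_eqI[of "(Q, i)"]) auto
    qed
  qed
qed

section \<open>Weights along geodesics and properness\<close>

lemma edge_rep:
  assumes "f \<in> E"
  obtains e g where "e \<in> rep ` E" "e \<in> E" "g \<in> carrier G" "(\<phi> g ` e, f) \<in> par"
proof -
  have "linked (rep f) f" using linked_sym rep assms by blast
  then show ?thesis using that rep assms unfolding linked_def by blast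
qed

lemma same_gate_translate:
  assumes "g \<in> carrier G" "e \<in> E" "(\<phi> g ` e, f) \<in> par" "x \<in> V" "y \<in> V"
  shows "same_gate e (\<phi> (inv g) x) (\<phi> (inv g) y) \<longleftrightarrow> same_gate f x y"
proof -
  have g': "inv g \<in> carrier G" using assms by simp
  have "same_gate f x y \<longleftrightarrow> same_gate (\<phi> g ` e) x y" using par_same_gate[OF assms(3-5)] by simp
  moreover have "same_gate (\<phi> g ` e) x y \<longleftrightarrow> same_gate e (\<phi> (inv g) x) (\<phi> (inv g) y)"
  proof
    assume "same_gate (\<phi> g ` e) x y"
    then have "same_gate (\<phi> (inv g) ` \<phi> g ` e) (\<phi> (inv g) x) (\<phi> (inv g) y)"
      using same_gate_act[OF g' edge_sub[OF edge_act[OF assms(1,2)]] assms(4,5)] by blast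
    then show "same_gate e (\<phi> (inv g) x) (\<phi> (inv g) y)"
      using A.act_image_inv[OF assms(1) edge_sub[OF assms(2)]] by simp
  next
    assume "same_gate e (\<phi> (inv g) x) (\<phi> (inv g) y)"
    then show "same_gate (\<phi> g ` e) x y"
      using same_gate_act[OF assms(1) edge_sub[OF assms(2)], of "\<phi> (inv g) x" "\<phi> (inv g) y"]
        A.act_closed[OF g'] A.act_inv'[OF assms(1)] assms(4,5) by simp
  qed
  ultimately show ?thesis by blast
qed

lemma cuts_edge_bounds:
  assumes uv: "adj u v"
  shows "finite (sep u v)" "0 < card (sep u v)"
proof -
  obtain e g where e: "e \<in> rep ` E" "e \<in> E" and g: "g \<in> carrier G" and par: "(\<phi> g ` e, {u, v}) \<in> par"
    using edge_rep[OF uv] by blast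
  have V: "u \<in> V" "v \<in> V" using uv edge_V by blast+
  have V': "\<phi> (inv g) u \<in> V" "\<phi> (inv g) v \<in> V" using A.act_closed g V by simp_all
  obtain c c' where cc: "gate (clq e) (\<phi> (inv g) u) c" "gate (clq e) (\<phi> (inv g) v) c'"
    using gate_ex[OF V'(1) e(2)] gate_ex[OF V'(2) e(2)] by blast
  have c: "c \<in> clq e" "c' \<in> clq e" using cc by (auto simp: gate_def)
  have bij: "bij_betw (\<lambda>(Q, i). (\<phi> g ` gate_cut e Q, i)) (cuts (N e) (clq e) c c') (sep u v)"
    by (rule cuts_edge[OF e(1) g uv par cc])
  have fin: "finite (cuts (N e) (clq e) c c')"
    using weights[OF e(2)] c unfolding clique_weight_def by blast
  then show "finite (sep u v)" using bij_betw_finite[OF bij] by blast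
  have "\<not> same_gate e (\<phi> (inv g) u) (\<phi> (inv g) v)"
    using same_gate_translate[OF g e(2) par V] edge_not_same_gate[OF uv] by blast
  then have "c \<noteq> c'" using cc by (auto simp: same_gate_def)
  moreover have "0 < N e {c}" using weights[OF e(2)] c unfolding clique_weight_def by blast
  \<comment> \<open>The copy of index zero exists because singletons have positive weight. It gives
    every edge weight at least one, which later bounds distances by weights.\<close>
  ultimately have "({c}, 0) \<in> cuts (N e) (clq e) c c'" using c by (auto simp: cuts_def)
  then have "0 < card (cuts (N e) (clq e) c c')" using fin card_gt_0_iff by blast
  then show "0 < card (sep u v)" using bij_betw_same_card[OF bij] by simp
qed

lemma finite_cuts:
  assumes "x \<in> V" "y \<in> V"
  shows "finite (sep x y)"
  by (rule finite_by_edges[OF assms]) (use cuts_edge_bounds(1) in \<open>auto simp: cuts_def\<close>)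

text \<open>The step towards \<open>y\<close> makes \<open>w\<close> the gate of \<open>y\<close> in
  the clique of the edge, so \<open>w\<close> and \<open>y\<close> lie in one sector. A cut crossed
  by the edge belongs to its hyperplane and is not crossed again.\<close>

lemma cuts_geodesic:
  assumes x: "x \<in> V" "y \<in> V" "adj x w" and d: "dst x y = Suc (dst w y)"
  shows "card (sep x w) + card (sep w y) \<le> card (sep x y)"
proof -
  have w: "w \<in> V" using x edge_V by blast
  have "gate (clq {w, x}) y w"
    using gate_clq[OF x(2) adj_sym[OF x(3)]] d dist_sym x w by simp
  moreover have "gate (clq {w, x}) w w"
    using gate_self[OF adj_sym[OF x(3)]] edge_subset_clq[OF adj_sym[OF x(3)]] by blast
  ultimately have same: "same_gate {x, w} w y" unfolding same_gate_def by (metis insert_commute)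
  obtain e g where e: "e \<in> rep ` E" "e \<in> E" and g: "g \<in> carrier G" and par: "(\<phi> g ` e, {x, w}) \<in> par"
    using edge_rep[OF x(3)] by blast
  have g': "inv g \<in> carrier G" using g by simp
  have same': "same_gate e (\<phi> (inv g) w) (\<phi> (inv g) y)"
    using same_gate_translate[OF g e(2) par w x(2)] same by blast
  have disj: "sep x w \<inter> sep w y = {}"
  proof (rule ccontr)
    assume "sep x w \<inter> sep w y \<noteq> {}"
    then obtain P i where P: "i < weight P" "(x \<in> P) \<noteq> (w \<in> P)" "(w \<in> P) \<noteq> (y \<in> P)"
      by (auto simp: cuts_def)
    then have "translated_cut P (weight P)" by (intro weight_pos) simp
    then obtain Q where Q: "P = \<phi> g ` gate_cut e Q"
      using translated_cut_at[OF _ x(3) P(2) e(1) g par] by blast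
    have "z \<in> P \<longleftrightarrow> \<phi> (inv g) z \<in> gate_cut e Q" if "z \<in> V" for z
      unfolding Q using A.act_image_mem[OF g cut_sub A.act_closed[OF g' that]] A.act_inv'[OF g that] by simp
    then show False
      using P(3) w x(2) cut_same_gate[OF A.act_closed[OF g' w] A.act_closed[OF g' x(2)] same'] by blast
  qed
  have "sep x w \<union> sep w y \<subseteq> sep x y"
    using disj unfolding cuts_def by blast
  then have "card (sep x w \<union> sep w y) \<le> card (sep x y)"
    using finite_cuts x by (intro card_mono)
  then show ?thesis using card_Un_disjoint[OF finite_cuts finite_cuts disj] x w by simp
qed

lemma dist_le_cuts:
  assumes "x \<in> V" "y \<in> V"
  shows "dst x y \<le> card (sep x y)"
  using assms
proof (induction "dst x y" arbitrary: x)
  case (Suc k)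
  obtain w where w: "w \<in> V" "adj x w" "dst w y = k"
    using dist_first[OF Suc(3,4) Suc(2)[symmetric]] by blast
  have "dst x y = Suc (dst w y)" using Suc(2) w by simp
  then have "card (sep x w) + card (sep w y) \<le> card (sep x y)"
    by (rule cuts_geodesic[OF Suc(3,4) w(2)])
  moreover have "k \<le> card (sep w y)" using Suc(1)[of w] w Suc(4) by simp
  ultimately show ?case using cuts_edge_bounds(2)[OF w(2)] Suc(2) by linarith
qed simp

text \<open>Translating back and taking gates embeds the clique into the representative clique and
  preserves the weights measured from \<open>x\<close>; there the weights have finite balls.\<close>

lemma finite_close_in_clique:
  assumes C: "is_clique V E C" and x: "x \<in> C"
  shows "finite {y \<in> C. y \<noteq> x \<and> card (sep x y) \<le> R}" (is "finite ?F")
proof (cases "?F = {}")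
  case True
  then show ?thesis by (simp only: finite.emptyI)
next
  case False
  then obtain x2 where x2: "x2 \<in> C" "x2 \<noteq> x" by blast
  define f where "f = {x, x2}"
  have f: "f \<in> E" "C = clq f" using clique_eq_clq[OF C x x2(1)] x2(2) by (auto simp: f_def)
  obtain e g where e: "e \<in> rep ` E" "e \<in> E" and g: "g \<in> carrier G" and par: "(\<phi> g ` e, f) \<in> par"
    using edge_rep[OF f(1)] by blast
  have g': "inv g \<in> carrier G" using g by simp
  define \<gamma> where "\<gamma> y = (SOME c. gate (clq e) (\<phi> (inv g) y) c)" for y
  have \<gamma>: "gate (clq e) (\<phi> (inv g) y) (\<gamma> y)" if "y \<in> V" for y
    unfolding \<gamma>_def using gate_ex[OF A.act_closed[OF g' that] e(2)] by (rule someI_ex)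
  have CV: "y \<in> V" if "y \<in> C" for y using that f(2) clq_sub by blast
  show ?thesis
  proof (rule finite_imageD)
    have "\<gamma> y \<in> {c' \<in> clq e. card (cuts (N e) (clq e) (\<gamma> x) c') \<le> R}" if "y \<in> ?F" for y
    proof -
      have y: "y \<in> C" "x \<noteq> y" using that by auto
      have adj: "adj x y" using clq_eq[OF f(1), of x y] x y f(2) by blast
      have "(f, {x, y}) \<in> par" using clq_par[OF f(1)] x y f(2) by blast
      then have "(\<phi> g ` e, {x, y}) \<in> par" using par by (rule rtrancl_trans[rotated])
      then have "bij_betw (\<lambda>(Q, i). (\<phi> g ` gate_cut e Q, i)) (cuts (N e) (clq e) (\<gamma> x) (\<gamma> y)) (sep x y)"
        using cuts_edge[OF e(1) g adj] \<gamma>[OF CV[OF x]] \<gamma>[OF CV[OF y(1)]] by blast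
      then have "card (cuts (N e) (clq e) (\<gamma> x) (\<gamma> y)) = card (sep x y)"
        by (rule bij_betw_same_card)
      then show ?thesis using that \<gamma>[OF CV[OF y(1)]] by (simp add: gate_def)
    qed
    then have "\<gamma> ` ?F \<subseteq> {c' \<in> clq e. card (cuts (N e) (clq e) (\<gamma> x) c') \<le> R}" by blast
    moreover have "\<gamma> x \<in> clq e" using \<gamma>[OF CV[OF x]] by (simp add: gate_def)
    then have "finite {c' \<in> clq e. card (cuts (N e) (clq e) (\<gamma> x) c') \<le> R}"
      using weights[OF e(2)] unfolding clique_weight_def by blast
    ultimately show "finite (\<gamma> ` ?F)" by (rule finite_subset)
    \<comment> \<open>Distinct vertices of a clique never lie in one sector of its
      hyperplane.\<close>
    show "inj_on \<gamma> ?F"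
    proof (rule inj_onI, rule ccontr)
      fix y z assume yz: "y \<in> ?F" "z \<in> ?F" "\<gamma> y = \<gamma> z" "y \<noteq> z"
      have V: "y \<in> V" "z \<in> V" and yzf: "y \<in> clq f" "z \<in> clq f" using yz CV f(2) by auto
      have "same_gate e (\<phi> (inv g) y) (\<phi> (inv g) z)"
        using \<gamma>[OF V(1)] \<gamma>[OF V(2)] yz(3) unfolding same_gate_def by auto
      then have "same_gate f y z" using same_gate_translate[OF g e(2) par V] by blast
      moreover have "(f, {y, z}) \<in> par" by (rule clq_par[OF f(1) yzf yz(4)])
      ultimately show False using par_not_same_gate[OF f(1)] by blast
    qed
  qed
qed

text \<open>Weights add along geodesics, so the first step and the remainder are both bounded by
  \<open>R\<close>. The induction can therefore run on the distance with \<open>R\<close> fixed,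
  even when the cliques at \<open>x\<close> are infinite.\<close>

lemma finite_sphere:
  assumes lf: "\<And>x. x \<in> V \<Longrightarrow> finite {C. is_clique V E C \<and> x \<in> C}" and x: "x \<in> V"
  shows "finite {y \<in> V. dst x y = k \<and> card (sep x y) \<le> R}"
  using x
proof (induction k arbitrary: x)
  case 0
  have "{y \<in> V. dst x y = 0 \<and> card (sep x y) \<le> R} \<subseteq> {x}" using dist_eq_0 0 by auto
  then show ?case by (rule finite_subset) simp
next
  case (Suc k)
  let ?A = "\<Union>C\<in>{C. is_clique V E C \<and> x \<in> C}. {w \<in> C. w \<noteq> x \<and> card (sep x w) \<le> R}"
  have "finite ?A" using finite_close_in_clique by (intro finite_UN_I lf[OF Suc(2)]) auto
  have clV: "w \<in> V" if "w \<in> ?A" for w using that by (auto simp: is_clique_def)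
  have "{y \<in> V. dst x y = Suc k \<and> card (sep x y) \<le> R} \<subseteq>
      (\<Union>w\<in>?A. {y \<in> V. dst w y = k \<and> card (sep w y) \<le> R})"
  proof
    fix y assume "y \<in> {y \<in> V. dst x y = Suc k \<and> card (sep x y) \<le> R}"
    then have y: "y \<in> V" "dst x y = Suc k" "card (sep x y) \<le> R" by auto
    obtain w where w: "w \<in> V" "adj x w" "dst w y = k" using dist_first[OF Suc(2) y(1,2)] by blast
    have "dst x y = Suc (dst w y)" using y w by simp
    then have "card (sep x w) + card (sep w y) \<le> card (sep x y)"
      by (rule cuts_geodesic[OF Suc(2) y(1) w(2)])
    then have "card (sep x w) \<le> R" "card (sep w y) \<le> R" using y(3) by auto
    moreover have "is_clique V E (clq {x, w})" "x \<in> clq {x, w}" "w \<in> clq {x, w}" "w \<noteq> x"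
      using clq_is_clique[OF w(2)] edge_subset_clq[OF w(2)] edge_neq[OF w(2)] by auto
    ultimately show "y \<in> (\<Union>w\<in>?A. {y \<in> V. dst w y = k \<and> card (sep w y) \<le> R})"
      using y(1) w(3) by blast
  qed
  moreover have "finite (\<Union>w\<in>?A. {y \<in> V. dst w y = k \<and> card (sep w y) \<le> R})"
    using \<open>finite ?A\<close> Suc(1)[OF clV] by (rule finite_UN_I)
  ultimately show ?case by (rule finite_subset)
qed

text \<open>Weight at most \<open>R\<close> forces distance at most \<open>R\<close>, which leaves
  finitely many images of \<open>x\<close>; each image is attained on a coset of the finite
  stabiliser.\<close>

lemma proper:
  assumes lf: "\<And>x. x \<in> V \<Longrightarrow> finite {C. is_clique V E C \<and> x \<in> C}"
    and fs: "finite (stabilizer G \<phi> x)" and x: "x \<in> V"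
  shows "finite {g \<in> carrier G. card (sep x (\<phi> g x)) \<le> R}"
proof -
  let ?B = "\<Union>k\<in>{..R}. {y \<in> V. dst x y = k \<and> card (sep x y) \<le> R}"
  have "finite ?B" using finite_sphere[OF lf x] by (intro finite_UN_I) auto
  have "finite {g \<in> carrier G. \<phi> g x = y}" for y
  proof (cases "\<exists>g0\<in>carrier G. \<phi> g0 x = y")
    case True
    then obtain g0 where g0: "g0 \<in> carrier G" "\<phi> g0 x = y" by blast
    have "{g \<in> carrier G. \<phi> g x = y} \<subseteq> (\<lambda>h. g0 \<otimes> h) ` stabilizer G \<phi> x"
    proof
      fix g assume "g \<in> {g \<in> carrier G. \<phi> g x = y}"
      then have g: "g \<in> carrier G" "\<phi> g x = y" by auto
      have "\<phi> (inv g0 \<otimes> g) x = \<phi> (inv g0) (\<phi> g0 x)"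
        using A.composition_rule[OF x _ g(1), of "inv g0"] g g0 by simp
      also have "\<dots> = x" by (rule A.act_inv[OF g0(1) x])
      finally have "inv g0 \<otimes> g \<in> stabilizer G \<phi> x" using g g0 by (simp add: stabilizer_def)
      moreover have "g = g0 \<otimes> (inv g0 \<otimes> g)" using g g0 by (simp add: m_assoc[symmetric])
      ultimately show "g \<in> (\<lambda>h. g0 \<otimes> h) ` stabilizer G \<phi> x" by (rule rev_image_eqI)
    qed
    then show ?thesis using fs by (meson finite_imageI finite_subset)
  next
    case False
    then have "{g \<in> carrier G. \<phi> g x = y} = {}" by blast
    then show ?thesis by (simp only: finite.emptyI)
  qed
  then have "finite (\<Union>y\<in>?B. {g \<in> carrier G. \<phi> g x = y})" by (rule finite_UN_I[OF \<open>finite ?B\<close>])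
  moreover have "{g \<in> carrier G. card (sep x (\<phi> g x)) \<le> R} \<subseteq> (\<Union>y\<in>?B. {g \<in> carrier G. \<phi> g x = y})"
  proof
    fix g assume "g \<in> {g \<in> carrier G. card (sep x (\<phi> g x)) \<le> R}"
    then have g: "g \<in> carrier G" "card (sep x (\<phi> g x)) \<le> R" by auto
    have "\<phi> g x \<in> V" by (rule A.act_closed[OF g(1) x])
    then have "\<phi> g x \<in> ?B" using dist_le_cuts[OF x] g(2) by fastforce
    then show "g \<in> (\<Union>y\<in>?B. {g \<in> carrier G. \<phi> g x = y})" using g(1) by blast
  qed
  ultimately show ?thesis by (rule finite_subset[rotated])
qed

end

theorem proposition5p3:
  fixes G :: "('g, 'm) monoid_scheme"
    and V :: "'v set" and E :: "'v set set"
    and \<phi> :: "'g \<Rightarrow> 'v \<Rightarrow> 'v"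
  assumes "quasi_median_graph V E"
    and "group G"
    and "acts_on_graph G V E \<phi>"
    and "topical_transitive_action G V E \<phi>"
    and "\<forall>x\<in>V. finite {C. is_clique V E C \<and> x \<in> C}"
    and "\<forall>x\<in>V. finite (stabilizer G \<phi> x)"
    and "\<forall>C. is_clique V E C \<longrightarrow>
           (\<exists>(K :: 'z set set) \<psi>. acts_properly_on_CAT0 (G\<lparr>carrier := set_stab G \<phi> C\<rparr>) K \<psi>)"
  shows "\<exists>(K :: nat set set) \<psi>. acts_properly_on_CAT0 G K \<psi>"
proof -
  interpret quasi_median V E by unfold_locales (rule assms(1))
  have act: "group_action G V \<phi>" and edges: "\<And>g. g \<in> carrier G \<Longrightarrow> (\<lambda>e. \<phi> g ` e) ` E = E"
    using assms(3) by (auto simp: acts_on_graph_def)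
  interpret A: group_action G V \<phi> by (rule act)
  \<comment> \<open>A finite clique gets the constant weight. On an infinite one topical
    transitivity makes the stabiliser act freely and transitively, so weights can be imported from
    its cube complex.\<close>
  have "\<exists>n. clique_weight \<phi> (set_stab G \<phi> (clq e)) (clq e) n" if e: "e \<in> E" for e
  proof (cases "finite (clq e)")
    case True
    then show ?thesis by (rule finite_clique_weight)
  next
    case False
    define C where "C = clq e"
    have C: "is_clique V E C" "C \<noteq> {}" "C \<subseteq> V" using clq_is_clique[OF e] False clq_sub by (auto simp: C_def)
    obtain K :: "'z set set" and \<psi> where K: "acts_properly_on_CAT0 (G\<lparr>carrier := set_stab G \<phi> C\<rparr>) K \<psi>"
      using assms(7) C(1) by blast
    have ft: "(\<forall>g\<in>set_stab G \<phi> C. \<forall>x\<in>C. \<phi> g x = x \<longrightarrow> g = \<one>\<^bsub>G\<^esub>) \<and>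
        (\<forall>x\<in>C. \<forall>y\<in>C. \<exists>g\<in>set_stab G \<phi> C. \<phi> g x = y)"
      using assms(4) C(1) False unfolding topical_transitive_action_def C_def by blast
    have "\<exists>n. clique_weight \<phi> (carrier (G\<lparr>carrier := set_stab G \<phi> C\<rparr>)) C n"
    proof (rule free_transitive_clique_weight[OF K C(2)])
      show "\<phi> h c \<in> C" if "h \<in> carrier (G\<lparr>carrier := set_stab G \<phi> C\<rparr>)" "c \<in> C" for h c
        using that by (auto simp: set_stab_def)
      show "\<phi> \<one>\<^bsub>G\<lparr>carrier := set_stab G \<phi> C\<rparr>\<^esub> c = c" if "c \<in> C" for c
        using that C(3) A.act_one by auto
      show "\<phi> (h \<otimes>\<^bsub>G\<lparr>carrier := set_stab G \<phi> C\<rparr>\<^esub> g) c = \<phi> h (\<phi> g c)"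
        if "h \<in> carrier (G\<lparr>carrier := set_stab G \<phi> C\<rparr>)" "g \<in> carrier (G\<lparr>carrier := set_stab G \<phi> C\<rparr>)" "c \<in> C"
        for h g c
        using that C(3) A.composition_rule by (auto simp: set_stab_def)
    qed (use ft in auto)
    then show ?thesis by (simp add: C_def)
  qed
  then obtain N where N: "\<And>e. e \<in> E \<Longrightarrow> clique_weight \<phi> (set_stab G \<phi> (clq e)) (clq e) (N e)"
    by metis
  interpret weighted_action V E G \<phi> N
    using edges assms(4) N by unfold_locales (auto simp: topical_transitive_action_def)
  obtain x where x: "x \<in> V" using conn by (auto simp: connected_graph_def)
  show ?thesis
  proof (rule proper_cuts_imp_CAT0[OF act weight_act finite_cuts x proper])
    show "finite {C. is_clique V E C \<and> y \<in> C}" if "y \<in> V" for y using assms(5) that by blast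
    show "finite (stabilizer G \<phi> x)" using assms(6) x by blast
  qed (assumption | rule x)+
qed

end
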